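(* Let $T>0$, let $v_0\in H$, and let $v^E$ be a weak solution on $(0,T)$ to the Euler equations on $\mathbb{T}^3$ with initial datum $v_0$. Let $\frac13<\alpha<1$ and suppose that $$v^E\in L^{1/\alpha}\big(0,T;B^{\beta}_{\frac{2}{1-\alpha},\infty}(\mathbb{T}^3)\big)\qquad\text{for some }\beta\text{ with }\alpha<\beta<1 .$$ Then $v^E$ conserves the energy.
   Context: Notation: $\mathbb{T}^3=(\mathbb{R}/2\pi\mathbb{Z})^3$. $H$ is the closure in $L^2(\mathbb{T}^3)$ of the smooth, periodic, divergence-free vector fields. Besov (Nikol'skii) space: for $0<\beta<1$ and $1\le p\le\infty$, $B^\beta_{p,\infty}(\mathbb{T}^3)$ is the space of $u\in L^p(\mathbb{T}^3)$ for which there is $c>0$ with $\|u(\cdot+h)-u(\cdot)\|_{L^p}\le c|h|^\beta$ for all $h$. The smallest such $c$ is the seminorm $[u]_{B^\beta_{p,\infty}}$, and the norm is $\|u\|_{L^p}+[u]_{B^\beta_{p,\infty}}$. Euler equations: $\partial_t v^E+(v^E\cdot\nabla)v^E+\nabla p^E=0$ and $\operatorname{div}v^E=0$ in $(0,T)\times\mathbb{T}^3$, with $v^E(0)=v_0$. Weak solution to the Euler equations with datum $v_0\in H$: a measurable $v^E:(0,T)\times\mathbb{T}^3\to\mathbb{R}^3$ with $v^E\in L^\infty(0,T;H)$ such that $$\int_0^T\int_{\mathbb{T}^3}\big[v^E\cdot\partial_t\phi+(v^E\otimes v^E):\nabla\phi\big]\,dx\,dt=-\int_{\mathbb{T}^3}v_0\cdot\phi(0)\,dx$$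 for all vector fields $\phi\in C_0^\infty([0,T)\times\mathbb{T}^3)$ (smooth, compactly supported in $[0,T)\times\mathbb{T}^3$) with $\operatorname{div}\phi=0$. Such a $v^E$ is, after modification on a null set of times, weakly continuous from $[0,T]$ into $L^2(\mathbb{T}^3)$ with $v^E(0)=v_0$. "$v^E$ conserves the energy" means that for this representative $\frac12\|v^E(t)\|_{L^2}^2=\frac12\|v_0\|_{L^2}^2$ for all $t\in[0,T]$. *)

theory Defs
  imports "HOL-Analysis.Analysis"
begin

type_synonym R3 = "real ^ 3"

text \<open>
  Functions on the torus are represented by functions on \<open>R3\<close> that are \<open>2 * pi\<close>-periodic in every
  coordinate, and integrals over the torus by integrals over a period cube (the closed cube differs
  from a fundamental domain by a null set).  As usual, elements of Lebesgue spaces are represented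
  by functions, which are identified when they agree almost everywhere.
\<close>

definition torus_periodic :: "(R3 \<Rightarrow> 'b) \<Rightarrow> bool" where
  "torus_periodic u \<longleftrightarrow> (\<forall>x i. u (x + (2 * pi) *\<^sub>R axis i 1) = u x)"

definition torus :: "R3 measure" where
  "torus = lebesgue_on (cbox 0 (\<chi> i. 2 * pi))"

definition Lp_torus :: "real \<Rightarrow> (R3 \<Rightarrow> R3) set" where
  "Lp_torus p = {u. torus_periodic u \<and> u \<in> borel_measurable torus \<and>
     integrable torus (\<lambda>x. norm (u x) powr p)}"

definition Lp_norm :: "real \<Rightarrow> (R3 \<Rightarrow> R3) \<Rightarrow> real" where
  "Lp_norm p u = (LINT x|torus. norm (u x) powr p) powr (1 / p)"

primrec C_k :: "nat \<Rightarrow> ('a::real_normed_vector \<Rightarrow> 'b::real_normed_vector) \<Rightarrow> bool" where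
  "C_k 0 f \<longleftrightarrow> continuous_on UNIV f"
| "C_k (Suc k) f \<longleftrightarrow> f differentiable_on UNIV \<and>
     (\<forall>h. C_k k (\<lambda>x. frechet_derivative f (at x) h))"

definition smooth :: "('a::euclidean_space \<Rightarrow> 'b::real_normed_vector) \<Rightarrow> bool" where
  "smooth f \<longleftrightarrow> (\<forall>k. C_k k f)"

definition partial :: "3 \<Rightarrow> (R3 \<Rightarrow> R3) \<Rightarrow> R3 \<Rightarrow> R3" where
  "partial i u x = frechet_derivative u (at x) (axis i 1)"

definition div_free :: "(R3 \<Rightarrow> R3) \<Rightarrow> bool" where
  "div_free u \<longleftrightarrow> (\<forall>x. (\<Sum>i\<in>UNIV. partial i u x $ i) = 0)"

definition H_space :: "(R3 \<Rightarrow> R3) set" where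
  "H_space = {u \<in> Lp_torus 2. \<forall>\<epsilon>>0. \<exists>\<psi>. smooth \<psi> \<and> torus_periodic \<psi> \<and> div_free \<psi> \<and>
     Lp_norm 2 (\<lambda>x. u x - \<psi> x) < \<epsilon>}"

text \<open>The Nikol'skii spaces with \<open>0 < \<beta> < 1\<close> and finite integrability exponent \<open>p \<ge> 1\<close>.\<close>

definition besov_bound :: "real \<Rightarrow> real \<Rightarrow> (R3 \<Rightarrow> R3) \<Rightarrow> real \<Rightarrow> bool" where
  "besov_bound \<beta> p u c \<longleftrightarrow> 0 < c \<and> (\<forall>h. Lp_norm p (\<lambda>x. u (x + h) - u x) \<le> c * norm h powr \<beta>)"

definition besov :: "real \<Rightarrow> real \<Rightarrow> (R3 \<Rightarrow> R3) set" where
  "besov \<beta> p = {u \<in> Lp_torus p. \<exists>c. besov_bound \<beta> p u c}"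

definition besov_seminorm :: "real \<Rightarrow> real \<Rightarrow> (R3 \<Rightarrow> R3) \<Rightarrow> real" where
  "besov_seminorm \<beta> p u = Inf {c. besov_bound \<beta> p u c}"

definition besov_norm :: "real \<Rightarrow> real \<Rightarrow> (R3 \<Rightarrow> R3) \<Rightarrow> real" where
  "besov_norm \<beta> p u = Lp_norm p u + besov_seminorm \<beta> p u"

text \<open>
  Membership in \<open>L\<^sup>q(0,T;X)\<close> and \<open>L\<^sup>\<infinity>(0,T;X)\<close>, where \<open>N\<close> is the norm of \<open>X\<close>.  These predicates are
  only applied to fields that are jointly measurable in time and space; no strong (Bochner)
  measurability into the non-separable Nikol'skii space is required.
\<close>

definition in_Lq_time ::
  "real \<Rightarrow> real \<Rightarrow> (R3 \<Rightarrow> R3) set \<Rightarrow> ((R3 \<Rightarrow> R3) \<Rightarrow> real) \<Rightarrow> (real \<Rightarrow> R3 \<Rightarrow> R3) \<Rightarrow> bool" where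
  "in_Lq_time q T X N v \<longleftrightarrow> (AE t in lebesgue_on {0<..<T}. v t \<in> X) \<and>
     integrable (lebesgue_on {0<..<T}) (\<lambda>t. N (v t) powr q)"

definition in_Linf_time ::
  "real \<Rightarrow> (R3 \<Rightarrow> R3) set \<Rightarrow> ((R3 \<Rightarrow> R3) \<Rightarrow> real) \<Rightarrow> (real \<Rightarrow> R3 \<Rightarrow> R3) \<Rightarrow> bool" where
  "in_Linf_time T X N v \<longleftrightarrow> (AE t in lebesgue_on {0<..<T}. v t \<in> X) \<and>
     (\<exists>C. AE t in lebesgue_on {0<..<T}. N (v t) \<le> C)"

text \<open>
  Divergence-free test fields in \<open>C\<^sub>0\<^sup>\<infinity>([0,T) \<times> torus)\<close>.  Smoothness up to the initial time is
  expressed by taking restrictions of fields that are smooth for all times; the values at negative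
  times play no role.
\<close>

definition test_field :: "real \<Rightarrow> (real \<Rightarrow> R3 \<Rightarrow> R3) \<Rightarrow> bool" where
  "test_field T \<phi> \<longleftrightarrow> smooth (\<lambda>(t, x). \<phi> t x) \<and> (\<forall>t. torus_periodic (\<phi> t)) \<and>
     (\<exists>S<T. \<forall>t\<ge>S. \<forall>x. \<phi> t x = 0) \<and> (\<forall>t\<in>{0..<T}. div_free (\<phi> t))"

definition weak_euler_solution :: "real \<Rightarrow> (R3 \<Rightarrow> R3) \<Rightarrow> (real \<Rightarrow> R3 \<Rightarrow> R3) \<Rightarrow> bool" where
  "weak_euler_solution T v0 v \<longleftrightarrow>
     (\<forall>t\<in>{0<..<T}. torus_periodic (v t)) \<and>
     (\<lambda>(t, x). v t x) \<in> borel_measurable (lebesgue_on ({0<..<T} \<times> cbox 0 (\<chi> i. 2 * pi))) \<and>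
     in_Linf_time T H_space (Lp_norm 2) v \<and>
     (\<forall>\<phi>. test_field T \<phi> \<longrightarrow>
        (LINT t|lebesgue_on {0<..<T}. LINT x|torus.
           v t x \<bullet> vector_derivative (\<lambda>s. \<phi> s x) (at t) +
           (\<Sum>i\<in>UNIV. \<Sum>j\<in>UNIV. v t x $ i * v t x $ j * partial j (\<phi> t) x $ i))
        = - (LINT x|torus. v0 x \<bullet> \<phi> 0 x))"

definition weakly_continuous_L2 :: "real \<Rightarrow> (real \<Rightarrow> R3 \<Rightarrow> R3) \<Rightarrow> bool" where
  "weakly_continuous_L2 T w \<longleftrightarrow> (\<forall>t\<in>{0..T}. w t \<in> Lp_torus 2) \<and>
     (\<forall>\<psi>\<in>Lp_torus 2. continuous_on {0..T} (\<lambda>t. LINT x|torus. w t x \<bullet> \<psi> x))"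

definition weakly_continuous_representative ::
  "real \<Rightarrow> (R3 \<Rightarrow> R3) \<Rightarrow> (real \<Rightarrow> R3 \<Rightarrow> R3) \<Rightarrow> (real \<Rightarrow> R3 \<Rightarrow> R3) \<Rightarrow> bool" where
  "weakly_continuous_representative T v0 v w \<longleftrightarrow> weakly_continuous_L2 T w \<and>
     (AE t in lebesgue_on {0<..<T}. AE x in torus. w t x = v t x) \<and>
     (AE x in torus. w 0 x = v0 x)"

text \<open>
  The weakly continuous representative is unique (for every time, up to null sets in space), so
  that the existential quantifier refers to \<^emph>\<open>the\<close> representative.
\<close>

definition conserves_energy :: "real \<Rightarrow> (R3 \<Rightarrow> R3) \<Rightarrow> (real \<Rightarrow> R3 \<Rightarrow> R3) \<Rightarrow> bool" where
  "conserves_energy T v0 v \<longleftrightarrow> (\<exists>w. weakly_continuous_representative T v0 v w \<and>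
     (\<forall>t\<in>{0..T}. 1 / 2 * (Lp_norm 2 (w t))\<^sup>2 = 1 / 2 * (Lp_norm 2 v0)\<^sup>2))"

end

theory Submission
  imports Defs "HOL-Real_Asymp.Real_Asymp"
begin

text \<open>
  The exponents are those for which the energy bound and the Nikol'skii bound interpolate to
  Onsager's threshold.  Let \<open>p = 2 / (1 - \<alpha>)\<close>, and let \<open>f t\<close> be the Nikol'skii norm of the velocity at
  time \<open>t\<close>.  Interpolating \<open>L\<^sup>3\<close> between \<open>L\<^sup>2\<close> and \<open>L\<^sup>p\<close> bounds the integral of the cube of the
  increment by \<open>h\<close> by a multiple of \<open>f t powr (1 / \<alpha>) * norm h powr (\<beta> / \<alpha>)\<close>
  (\<open>besov_cubic_increment\<close>).  The first factor is integrable in time, and \<open>\<beta> / \<alpha> > 1\<close> means that the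
  velocity has more than a third of a derivative in \<open>L\<^sup>3\<close>.

  The energy is approximated by \<open>quad k u\<close>, the pairing of \<open>u\<close> with its convolution with an even
  trigonometric polynomial \<open>k\<close>.  Such a pairing involves finitely many Fourier modes, and each mode
  of a weak solution is Lipschitz in time (\<open>mode_evolution\<close>): test fields \<open>\<eta> t * cos (\<xi> \<bullet> x + \<theta>) P\<close> with
  \<open>P\<close> orthogonal to \<open>\<xi>\<close> are divergence-free, so neither the pressure nor a mollification in time
  enters.  Hence \<open>quad k u\<close> is an integral of a cubic flux (\<open>quad_flux_identity\<close>).  By incompressibility
  this flux equals, up to a factor, the double integral of
  \<open>k' (x - y) \<bullet> (u x - u y) * (norm (u x - u y))\<^sup>2\<close>, where \<open>k'\<close> is the gradient of \<open>k\<close>; this is the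
  identity of Duchon and Robert (\<open>increment_flux_eq\<close>).

  As kernels serve the normalised products of \<open>(1 + cos z\<^sub>i) ^ n\<close>, which concentrate at scale
  \<open>n powr (-1/2)\<close>.  For them the flux is of order \<open>n powr ((1 - \<gamma>) / 2)\<close>, where \<open>\<gamma> > 1\<close> is the exponent
  of the cubic increments (\<open>flux_kernel_bound\<close>), while \<open>quad\<close> tends to the squared norm on the space
  \<open>H\<close> (\<open>H_field_defect_tendsto_0\<close>).  So the energy agrees with the initial energy at almost
  every time (\<open>energy_constant\<close>).

  Since the flux bound is integrated in time, the energy lost in the convolution tends to 0
  uniformly in time.  Together with the Lipschitz bound for the finitely many modes that survive the
  convolution this shows that the solution, restricted to a set of times of full measure that
  contains 0, is uniformly continuous with values in \<open>L\<^sup>2\<close> (\<open>curve_uniformly_continuous\<close>).  It extends to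
  the closed time interval by completeness (\<open>L2_uniform_extension\<close>).  The extension is strongly, hence
  weakly, continuous, and its norm is constant.
\<close>

section \<open>Functions of class \<open>C\<^sup>k\<close> and smooth bumps\<close>

lemma C_k_Suc_has_derivative:
  assumes "C_k (Suc k) f"
  shows "(f has_derivative frechet_derivative f (at x)) (at x)"
  using assms by (simp add: differentiable_on_def frechet_derivative_works)

lemma C_k_SucI:
  assumes "\<And>x. (f has_derivative f' x) (at x)" and "\<And>h. C_k k (\<lambda>x. f' x h)"
  shows "C_k (Suc k) f"
proof -
  have "frechet_derivative f (at x) = f' x" for x
    using frechet_derivative_at[OF assms(1)] by simp
  then show ?thesis
    using assms by (auto simp: differentiable_on_def differentiable_def)
qed

lemma C_k_Suc_imp: "C_k (Suc k) f \<Longrightarrow> C_k k f"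
proof (induction k arbitrary: f)
  case 0
  then show ?case
    by (auto simp: differentiable_imp_continuous_on)
qed auto

lemma C_k_const: "C_k k (\<lambda>x. c)"
  by (induction k arbitrary: c) auto

lemma C_k_add:
  assumes "C_k k f" "C_k k g" shows "C_k k (\<lambda>x. f x + g x)"
  using assms
proof (induction k arbitrary: f g)
  case 0 then show ?case by (auto intro: continuous_intros)
next
  case (Suc k)
  show ?case
    by (rule C_k_SucI[OF has_derivative_add[OF C_k_Suc_has_derivative[OF Suc.prems(1)]
            C_k_Suc_has_derivative[OF Suc.prems(2)]]])
      (use Suc in auto)
qed

lemma C_k_bilinear:
  assumes "bounded_bilinear B" "C_k k f" "C_k k g" shows "C_k k (\<lambda>x. B (f x) (g x))"
  using assms(2,3)
proof (induction k arbitrary: f g)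
  case 0 then show ?case by (auto intro: bounded_bilinear.continuous_on[OF assms(1)])
next
  case (Suc k)
  have D: "C_k k (\<lambda>x. frechet_derivative f (at x) h)" "C_k k (\<lambda>x. frechet_derivative g (at x) h)" for h
    using Suc.prems by auto
  show ?case
    by (rule C_k_SucI[OF bounded_bilinear.FDERIV[OF assms(1) C_k_Suc_has_derivative[OF Suc.prems(1)]
            C_k_Suc_has_derivative[OF Suc.prems(2)]]], rule C_k_add)
      (intro Suc.IH C_k_Suc_imp[OF Suc.prems(1)] C_k_Suc_imp[OF Suc.prems(2)] D)+
qed

lemmas C_k_mult = C_k_bilinear[OF bounded_bilinear_mult]
lemmas C_k_scaleR = C_k_bilinear[OF bounded_bilinear_scaleR]

lemma C_k_compose_linear:
  assumes L: "bounded_linear L" and f: "C_k k f" shows "C_k k (\<lambda>x. f (L x + c))"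
  using f
proof (induction k arbitrary: f)
  case 0 
  have "continuous_on UNIV (\<lambda>x. L x + c)"
    by (intro continuous_intros bounded_linear.continuous_on[OF L])
  with 0 show ?case by (auto intro: continuous_on_compose2)
next
  case (Suc k)
  have *: "((\<lambda>x. f (L x + c)) has_derivative (\<lambda>h. frechet_derivative f (at (L x + c)) (L h))) (at x)" for x
    by (rule has_derivative_compose[of "\<lambda>x. L x + c" L x UNIV f, OF _ C_k_Suc_has_derivative[OF Suc.prems]])
       (auto intro!: derivative_eq_intros bounded_linear_imp_has_derivative L)
  show ?case
    by (rule C_k_SucI[OF *]) (use Suc in auto)
qed

lemma C_k_Suc_real:
  fixes f :: "real \<Rightarrow> real"
  assumes "\<And>x. (f has_real_derivative f' x) (at x)" and "C_k k f'"
  shows "C_k (Suc k) f"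
  by (rule C_k_SucI[of f "\<lambda>x h. f' x * h"])
     (use assms in \<open>auto simp: has_field_derivative_def intro: C_k_mult C_k_const\<close>)

lemma C_k_cos: "C_k k (cos :: real \<Rightarrow> real)" and C_k_sin: "C_k k (sin :: real \<Rightarrow> real)"
proof -
  have "C_k k (cos :: real \<Rightarrow> real) \<and> C_k k (sin :: real \<Rightarrow> real)"
  proof (induction k)
    case 0 then show ?case by (auto intro: continuous_intros)
  next
    case (Suc k)
    have "C_k k (\<lambda>x. -1 * sin x :: real)" by (rule C_k_mult) (use Suc C_k_const in auto)
    then have "C_k (Suc k) (cos :: real \<Rightarrow> real)"
      by (rule C_k_Suc_real[rotated]) (auto intro!: derivative_eq_intros)
    moreover have "C_k (Suc k) (sin :: real \<Rightarrow> real)"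
      by (rule C_k_Suc_real[OF DERIV_sin]) (use Suc in auto)
    ultimately show ?case ..
  qed
  then show "C_k k (cos :: real \<Rightarrow> real)" "C_k k (sin :: real \<Rightarrow> real)" by auto
qed

text \<open>
  The powers of \<open>inverse x\<close> make the family closed under differentiation, which turns the smoothness
  of \<open>exp (- 1 / x)\<close> into an induction.
\<close>

definition flat :: "nat \<Rightarrow> real \<Rightarrow> real" where
  "flat m x = (if x > 0 then exp (- inverse x) * inverse x ^ m else 0)"

lemma flat_tendsto_0: "((flat m) \<longlongrightarrow> 0) (at_right 0)"
proof -
  have "((\<lambda>x. inverse x ^ m / exp (inverse x)) \<longlongrightarrow> (0::real)) (at_right 0)"
    by (rule filterlim_compose[OF tendsto_power_div_exp_0 filterlim_inverse_at_top_right])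
  then show ?thesis
    by (rule Lim_transform_eventually)
       (auto simp: eventually_at_filter flat_def exp_minus field_simps)
qed

text \<open>
  At 0 the difference quotient of \<open>flat m\<close> is \<open>flat (m + 1)\<close> on the right and 0 on the left.
\<close>

lemma flat_has_derivative: "(flat m has_real_derivative (flat (m+2) x - real m * flat (m+1) x)) (at x)"
proof -
  consider "x > 0" | "x < 0" | "x = 0" by linarith
  then show ?thesis
  proof cases
    case 1
    have "((\<lambda>x. exp (- inverse x) * inverse x ^ m) has_real_derivative (flat (m+2) x - real m * flat (m+1) x)) (at x)"
    proof -
      have 0: "(inverse has_real_derivative - (inverse x ^ 2)) (at x)"
        using DERIV_inverse[of x UNIV] 1 by (simp add: numeral_2_eq_2)
      have 2: "((\<lambda>x. exp (- inverse x)) has_real_derivative exp (- inverse x) * inverse x ^ 2) (at x)"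
        by (rule derivative_eq_intros 0 | simp)+
      have 3: "((\<lambda>x. inverse x ^ m) has_real_derivative - real m * inverse x ^ (m+1)) (at x)"
        by (cases m) (use DERIV_power[OF 0, of m] in \<open>auto simp: power2_eq_square algebra_simps\<close>)
      show ?thesis
        by (rule DERIV_cong[OF DERIV_mult[OF 2 3]])
           (use 1 in \<open>simp add: flat_def algebra_simps power_add power2_eq_square\<close>)
    qed
    then show ?thesis
      by (rule DERIV_cong_ev[THEN iffD1, rotated -1])
         (use 1 in \<open>auto simp: flat_def intro!: eventually_nhds_in_open[of "{0<..}", THEN eventually_mono]\<close>)
  next
    case 2
    have "((\<lambda>x. 0) has_real_derivative (flat (m+2) x - real m * flat (m+1) x)) (at x)"
      using 2 by (auto simp: flat_def)
    then show ?thesis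
      by (rule DERIV_cong_ev[THEN iffD1, rotated -1])
         (use 2 in \<open>auto simp: flat_def intro!: eventually_nhds_in_open[of "{..<0}", THEN eventually_mono]\<close>)
  next
    case 3
    have "((\<lambda>h. (flat m (0 + h) - flat m 0) / h) \<longlongrightarrow> 0) (at 0)"
      unfolding filterlim_at_split
    proof
      show "((\<lambda>h. (flat m (0 + h) - flat m 0) / h) \<longlongrightarrow> 0) (at_left 0)"
        by (rule Lim_transform_eventually[OF tendsto_const])
           (auto simp: eventually_at_filter flat_def)
      show "((\<lambda>h. (flat m (0 + h) - flat m 0) / h) \<longlongrightarrow> 0) (at_right 0)"
        by (rule Lim_transform_eventually[OF flat_tendsto_0[of "Suc m"]])
           (auto simp: eventually_at_filter flat_def field_simps)
    qed
    then show ?thesis using 3 by (simp add: DERIV_def flat_def)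
  qed
qed

lemma C_k_flat: "C_k k (flat m)"
proof (induction k arbitrary: m)
  case 0
  have "continuous_on UNIV (flat m)"
    by (intro continuous_at_imp_continuous_on ballI DERIV_isCont[OF flat_has_derivative])
  then show ?case by simp
next
  case (Suc k)
  have "C_k k (\<lambda>x. flat (m+2) x + (- real m) * flat (m+1) x)"
    by (intro C_k_add C_k_mult C_k_const Suc)
  then show ?case
    by (intro C_k_Suc_real[OF flat_has_derivative]) auto
qed

text \<open>
  Speeding up the argument of \<open>flat 0\<close> makes it tend to 1 at every positive point, so that these
  functions converge to the indicator of the open interval while staying between 0 and 1.
\<close>

definition bump :: "real \<Rightarrow> real \<Rightarrow> nat \<Rightarrow> real \<Rightarrow> real" where
  "bump c d n t = flat 0 (real n * (t - c)) * flat 0 (real n * (d - t))"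

lemma C_k_bump: "C_k k (bump c d n)"
proof -
  have "C_k k (\<lambda>t. flat 0 (real n * t + (- real n * c)))"
    by (rule C_k_compose_linear[OF bounded_linear_mult_right C_k_flat])
  moreover have "C_k k (\<lambda>t. flat 0 (- real n * t + (real n * d)))"
    by (rule C_k_compose_linear[OF bounded_linear_mult_right C_k_flat])
  ultimately show ?thesis
    unfolding bump_def by (auto intro!: C_k_mult simp: algebra_simps)
qed

lemma flat_0_bounds: "0 \<le> flat 0 x" "flat 0 x \<le> 1"
  by (auto simp: flat_def)

lemma bump_bounds: "0 \<le> bump c d n t" "bump c d n t \<le> 1"
  using flat_0_bounds by (auto simp: bump_def mult_le_one)

lemma bump_eq_0: "t \<notin> {c<..<d} \<Longrightarrow> bump c d n t = 0"
  by (auto simp: bump_def flat_def zero_less_mult_iff not_less)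

lemma bump_tendsto: "(\<lambda>n. bump c d n t) \<longlonglongrightarrow> indicator {c<..<d} t"
proof (cases "t \<in> {c<..<d}")
  case True
  have *: "(\<lambda>n. flat 0 (real n * a)) \<longlonglongrightarrow> 1" if "a > 0" for a
  proof -
    have "(\<lambda>n. exp (- inverse (real n * a))) \<longlonglongrightarrow> 1"
      using that by real_asymp
    then show ?thesis
      by (rule Lim_transform_eventually)
         (use that in \<open>auto simp: flat_def intro: eventually_mono[OF eventually_gt_at_top[of 0]]\<close>)
  qed
  show ?thesis unfolding bump_def using tendsto_mult[OF *[of "t-c"] *[of "d-t"]] True by simp
qed (simp add: bump_eq_0)

text \<open>
  The time factors of the test fields are antiderivatives of bumps.
\<close>

lemma smooth_antiderivative:
  fixes g :: "real \<Rightarrow> real"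
  assumes "\<And>k. C_k k g" "\<And>x. (h has_real_derivative g x) (at x)"
  shows "smooth h"
  unfolding smooth_def
proof
  fix k show "C_k k h"
    using C_k_Suc_imp[OF C_k_Suc_real[OF assms(2,1)]] .
qed

section \<open>Integrals of periodic functions\<close>

abbreviation period_cube :: "R3 set" where "period_cube \<equiv> cbox 0 (\<chi> i. 2 * pi)"

definition period_vector :: "int ^ 3 \<Rightarrow> R3" where
  "period_vector m = (\<chi> i. 2 * pi * of_int (m $ i))"

text \<open>
  The half-open cube, whose translates by the period vectors are disjoint and cover the space.
\<close>

definition fundamental_cube :: "R3 set" where
  "fundamental_cube = {x. \<forall>i. 0 \<le> x $ i \<and> x $ i < 2 * pi}"

text \<open>
  The representative of a point in the half-open cube; composition with it extends a function on the
  cube periodically.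
\<close>

definition wrap :: "R3 \<Rightarrow> R3" where
  "wrap x = x + period_vector (\<chi> i. - \<lfloor>x $ i / (2 * pi)\<rfloor>)"

lemma torus_periodic_int_axis:
  assumes "torus_periodic f" shows "f (x + (2 * pi * of_int m) *\<^sub>R axis i 1) = f x"
proof (induction m arbitrary: x rule: int_induct[where k=0])
  case base then show ?case by simp
next
  case (step1 m)
  have "f (x + (2 * pi * of_int (m+1)) *\<^sub>R axis i 1) = f (x + (2 * pi * of_int m) *\<^sub>R axis i 1 + (2*pi) *\<^sub>R axis i 1)"
    by (simp add: algebra_simps)
  also have "\<dots> = f (x + (2 * pi * of_int m) *\<^sub>R axis i 1)"
    using assms unfolding torus_periodic_def by blast
  finally show ?case using step1 by simp
next
  case (step2 m)
  have "f (x + (2 * pi * of_int (m-1)) *\<^sub>R axis i 1) = f (x + (2 * pi * of_int (m-1)) *\<^sub>R axis i 1 + (2*pi) *\<^sub>R axis i 1)"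
    using assms unfolding torus_periodic_def by metis
  also have "\<dots> = f (x + (2 * pi * of_int m) *\<^sub>R axis i 1)"
    by (simp add: algebra_simps)
  finally show ?case using step2 by simp
qed

lemma torus_periodic_shift:
  assumes "torus_periodic f" shows "f (x + period_vector m) = f x"
proof -
  have "f (x + (\<Sum>i\<in>S. (2 * pi * of_int (m $ i)) *\<^sub>R axis i 1)) = f x" if "finite S" for S
    using that
  proof (induction S arbitrary: x)
    case (insert i S)
    have "f (x + (\<Sum>i\<in>insert i S. (2 * pi * of_int (m $ i)) *\<^sub>R axis i 1))
       = f ((x + (\<Sum>i\<in>S. (2 * pi * of_int (m $ i)) *\<^sub>R axis i 1)) + (2 * pi * of_int (m $ i)) *\<^sub>R axis i 1)"
      using insert by (simp add: algebra_simps)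
    then show ?case
      using torus_periodic_int_axis[OF assms] insert by metis
  qed simp
  from this[of UNIV] have "f (x + (\<Sum>i\<in>UNIV. (2 * pi * of_int (m $ i)) *\<^sub>R axis i 1)) = f x" by simp
  moreover have "(\<Sum>i\<in>UNIV. (2 * pi * of_int (m $ i)) *\<^sub>R axis i 1) = period_vector m"
    by (simp add: vec_eq_iff period_vector_def axis_def if_distrib[of "\<lambda>z. _ * z"] cong: if_cong)
  ultimately show ?thesis by simp
qed

lemma unique_period: "x + period_vector m \<in> fundamental_cube \<longleftrightarrow> m = (\<chi> i. - \<lfloor>x $ i / (2 * pi)\<rfloor>)"
proof -
  have *: "0 \<le> t + 2 * pi * of_int k \<and> t + 2 * pi * of_int k < 2 * pi \<longleftrightarrow> k = - \<lfloor>t / (2 * pi)\<rfloor>" for t k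
  proof -
    have "0 \<le> t + 2 * pi * of_int k \<longleftrightarrow> of_int (-k) \<le> t / (2*pi)"
      by (simp add: field_simps) linarith
    moreover have "t + 2 * pi * of_int k < 2 * pi \<longleftrightarrow> t / (2*pi) < of_int (-k) + 1"
      by (simp add: field_simps)
    ultimately show ?thesis
      using floor_eq_iff[of "t/(2*pi)" "-k"] by linarith
  qed
  show ?thesis
    by (simp add: fundamental_cube_def period_vector_def vec_eq_iff *)
qed

lemma wrap_mem: "wrap x \<in> fundamental_cube"
  using unique_period[of x "\<chi> i. - \<lfloor>x $ i / (2 * pi)\<rfloor>"] by (simp add: wrap_def)

lemma torus_periodic_wrap: "torus_periodic f \<Longrightarrow> f (wrap x) = f x"
  by (simp add: wrap_def torus_periodic_shift)

lemma torus_periodic_comp_wrap: "torus_periodic (\<lambda>x. f (wrap x))"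
proof -
  have "wrap (x + (2 * pi) *\<^sub>R axis i 1) = wrap x" for x i
  proof -
    have "(x $ j + 2 * pi) / (2 * pi) = x $ j / (2*pi) + 1" for j
      by (simp add: field_simps)
    then have "\<lfloor>(x $ j + 2 * pi) / (2 * pi)\<rfloor> = \<lfloor>x $ j / (2*pi)\<rfloor> + 1" for j by simp
    then show ?thesis
      by (auto simp: wrap_def vec_eq_iff period_vector_def axis_def algebra_simps)
  qed
  then show ?thesis by (simp add: torus_periodic_def)
qed

lemma wrap_fundamental: "x \<in> fundamental_cube \<Longrightarrow> wrap x = x"
proof -
  assume x: "x \<in> fundamental_cube"
  have 0: "period_vector 0 = 0" by (simp add: period_vector_def vec_eq_iff)
  show ?thesis
    using unique_period[of x 0] x by (simp add: wrap_def 0 flip: zero_vec_def)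
qed

lemma fundamental_cube_measurable [measurable]: "fundamental_cube \<in> sets borel"
proof -
  have "{x::R3. 0 \<le> x $ i \<and> x $ i < 2 * pi} \<in> sets borel" for i
    by measurable
  then have "(\<Inter>i\<in>UNIV. {x::R3. 0 \<le> x $ i \<and> x $ i < 2 * pi}) \<in> sets borel"
    by (intro sets.finite_INT) auto
  moreover have "(\<Inter>i\<in>UNIV. {x::R3. 0 \<le> x $ i \<and> x $ i < 2 * pi}) = fundamental_cube"
    by (auto simp: fundamental_cube_def)
  ultimately show ?thesis by simp
qed

lemma borel_measurable_vec_R3:
  fixes f :: "'a \<Rightarrow> R3"
  assumes "\<And>i. (\<lambda>x. f x $ i) \<in> borel_measurable M" shows "f \<in> borel_measurable M"
proof -
  have "(\<lambda>x. \<Sum>i\<in>UNIV. f x $ i *\<^sub>R (axis i 1 :: R3)) \<in> borel_measurable M"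
    by (intro borel_measurable_sum borel_measurable_scaleR assms borel_measurable_const)
  moreover have "(\<Sum>i\<in>UNIV. y $ i *\<^sub>R (axis i 1 :: R3)) = y" for y :: R3
    by (simp add: vec_eq_iff axis_def if_distrib[of "\<lambda>z. _ * z"] cong: if_cong)
  ultimately show ?thesis by simp
qed

lemma wrap_measurable [measurable]: "wrap \<in> borel_measurable borel"
proof (rule borel_measurable_vec_R3)
  fix i
  have "(\<lambda>x. x $ i - 2 * pi * of_int \<lfloor>x $ i / (2 * pi)\<rfloor>) \<in> borel_measurable (borel :: R3 measure)"
    by measurable
  then show "(\<lambda>x. wrap x $ i) \<in> borel_measurable borel"
    by (simp add: wrap_def period_vector_def)
qed

lemma nn_integral_lborel_translate:
  fixes f :: "R3 \<Rightarrow> ennreal"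
  assumes [measurable]: "f \<in> borel_measurable borel"
  shows "(\<integral>\<^sup>+x. f (x + c) \<partial>lborel) = (\<integral>\<^sup>+x. f x \<partial>lborel)"
  by (subst (2) lborel_distr_plus[of c, symmetric], subst nn_integral_distr) (auto simp: add.commute)

lemma nn_integral_sum_periods:
  "(\<integral>\<^sup>+m. indicator fundamental_cube (x + period_vector m) \<partial>count_space UNIV) = 1"
proof -
  have "(indicator fundamental_cube (x + period_vector m) :: ennreal)
      = indicator {\<chi> i. - \<lfloor>x $ i / (2 * pi)\<rfloor>} m" for m
    by (auto simp: indicator_def unique_period)
  then show ?thesis by simp
qed

lemma period_vector_uminus: "period_vector (- m) = - period_vector m"
  by (simp add: period_vector_def vec_eq_iff)

lemma nn_integral_sum_periods_minus:
  "(\<integral>\<^sup>+m. indicator fundamental_cube (x - period_vector m) \<partial>count_space UNIV) = 1"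
proof -
  have "(indicator fundamental_cube (x - period_vector m) :: ennreal)
      = indicator {- (\<chi> i. - \<lfloor>x $ i / (2 * pi)\<rfloor>)} m" for m
    using unique_period[of x "-m"] by (auto simp: indicator_def period_vector_uminus equation_minus_iff[of m])
  then show ?thesis by simp
qed

text \<open>
  The shifted cube is cut along the cells of the lattice of periods, and the pieces are moved back
  into the fundamental cube, which they tile again.  The cutting and the reassembly both insert the
  identity that the indicators of all translates of the half-open cube sum to 1.
\<close>

lemma nn_integral_fundamental_shift:
  fixes f :: "R3 \<Rightarrow> ennreal"
  assumes [measurable]: "f \<in> borel_measurable borel" and per: "torus_periodic f"
  shows "(\<integral>\<^sup>+x. f (x + h) * indicator fundamental_cube x \<partial>lborel)
       = (\<integral>\<^sup>+x. f x * indicator fundamental_cube x \<partial>lborel)"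
proof -
  let ?Q = "indicator fundamental_cube :: R3 \<Rightarrow> ennreal"
  have "(\<integral>\<^sup>+x. f (x + h) * ?Q x \<partial>lborel) = (\<integral>\<^sup>+x. f x * ?Q (x - h) \<partial>lborel)"
    using nn_integral_lborel_translate[of "\<lambda>x. f (x + h) * ?Q x" "-h"] by simp
  also have "\<dots> = (\<integral>\<^sup>+x. (\<integral>\<^sup>+m. f x * ?Q (x - h) * ?Q (x + period_vector m) \<partial>count_space UNIV) \<partial>lborel)"
    by (simp add: nn_integral_cmult nn_integral_sum_periods)
  also have "\<dots> = (\<integral>\<^sup>+m. (\<integral>\<^sup>+x. f x * ?Q (x - h) * ?Q (x + period_vector m) \<partial>lborel) \<partial>count_space UNIV)"
    by (rule nn_integral_count_space_nn_integral) auto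
  also have "\<dots> = (\<integral>\<^sup>+m. (\<integral>\<^sup>+x. f x * ?Q (x - h - period_vector m) * ?Q x \<partial>lborel) \<partial>count_space UNIV)"
  proof (rule nn_integral_cong)
    fix m
    have "f (x - period_vector m) = f x" for x
      using torus_periodic_shift[OF per, of x "-m"] by (simp add: period_vector_uminus)
    then show "(\<integral>\<^sup>+x. f x * ?Q (x - h) * ?Q (x + period_vector m) \<partial>lborel)
            = (\<integral>\<^sup>+x. f x * ?Q (x - h - period_vector m) * ?Q x \<partial>lborel)"
      using nn_integral_lborel_translate[of "\<lambda>x. f x * ?Q (x - h) * ?Q (x + period_vector m)" "- period_vector m"]
      by (simp add: algebra_simps)
  qed
  also have "\<dots> = (\<integral>\<^sup>+x. (\<integral>\<^sup>+m. f x * ?Q (x - h - period_vector m) * ?Q x \<partial>count_space UNIV) \<partial>lborel)"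
    by (rule nn_integral_count_space_nn_integral[symmetric]) auto
  also have "\<dots> = (\<integral>\<^sup>+x. f x * ?Q x \<partial>lborel)"
  proof (rule nn_integral_cong)
    fix x
    have "(\<integral>\<^sup>+m. f x * ?Q (x - h - period_vector m) * ?Q x \<partial>count_space UNIV)
        = f x * ?Q x * (\<integral>\<^sup>+m. ?Q (x - h - period_vector m) \<partial>count_space UNIV)"
      by (subst nn_integral_cmult[symmetric]) (auto simp: ac_simps)
    then show "(\<integral>\<^sup>+m. f x * ?Q (x - h - period_vector m) * ?Q x \<partial>count_space UNIV) = f x * ?Q x"
      by (simp add: nn_integral_sum_periods_minus)
  qed
  finally show ?thesis .
qed

lemma space_torus [simp]: "space torus = period_cube"
  by (simp add: torus_def)

lemma measurable_torus_ident [measurable]: "(\<lambda>x. x) \<in> measurable torus borel"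
  unfolding torus_def using id_borel_measurable_lebesgue_on by (simp add: id_def)

lemma period_cube_lmeasurable [simp]: "period_cube \<in> sets lebesgue" "period_cube \<in> lmeasurable"
  by auto

interpretation torus: finite_measure torus
  unfolding torus_def by (rule finite_measure_lebesgue_on) simp

lemma AE_torus_iff: "(AE x in torus. P x) \<longleftrightarrow> (AE x in lborel. x \<in> period_cube \<longrightarrow> P x)"
  unfolding torus_def by (subst AE_restrict_space_iff) (auto simp: AE_completion_iff)

lemma AE_period_cube_iff: "AE x in lborel. x \<in> period_cube \<longleftrightarrow> x \<in> fundamental_cube"
proof -
  have "AE x in lebesgue. x \<notin> period_cube - box 0 (\<chi> i. 2 * pi)"
    using negligible_frontier_interval[where a="0::R3" and b="\<chi> i. 2 * pi"]
    by (intro AE_not_in) (simp add: negligible_iff_null_sets)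
  then have "AE x in lborel. x \<notin> period_cube - box 0 (\<chi> i. 2 * pi)"
    by (simp add: AE_completion_iff)
  then show ?thesis
    by eventually_elim (auto simp: fundamental_cube_def mem_box_cart less_imp_le)
qed

lemma nn_integral_torus:
  "(\<integral>\<^sup>+x. f x \<partial>torus) = (\<integral>\<^sup>+x. f x * indicator fundamental_cube x \<partial>lborel)"
proof -
  have "(\<integral>\<^sup>+x. f x \<partial>torus) = (\<integral>\<^sup>+x. f x * indicator period_cube x \<partial>lborel)"
    unfolding torus_def by (subst nn_integral_restrict_space) (auto simp: nn_integral_completion)
  also have "\<dots> = (\<integral>\<^sup>+x. f x * indicator fundamental_cube x \<partial>lborel)"
    by (rule nn_integral_cong_AE, use AE_period_cube_iff in eventually_elim) (auto simp: indicator_def)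
  finally show ?thesis .
qed

lemma AE_lborel_translate:
  fixes P :: "R3 \<Rightarrow> bool"
  assumes "AE x in lborel. P x" shows "AE x in lborel. P (x + c)"
proof -
  have "AE x in distr lborel borel ((+) c). P x"
    unfolding lborel_distr_plus by (rule assms)
  from AE_distrD[OF _ this] have "AE x in lborel. P (c + x)" by simp
  then show ?thesis by (simp add: add.commute)
qed

text \<open>
  The exceptional set is a countable union of translates of a null set.
\<close>

lemma AE_torus_periodic:
  assumes "AE x in torus. P x" "torus_periodic P" shows "AE x in lborel. P x"
proof -
  have "AE x in lborel. x + period_vector m \<in> fundamental_cube \<longrightarrow> P (x + period_vector m)" for m
  proof (rule AE_lborel_translate)
    show "AE x in lborel. x \<in> fundamental_cube \<longrightarrow> P x"
      using assms(1) AE_period_cube_iff unfolding AE_torus_iff by eventually_elim auto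
  qed
  then have "AE x in lborel. \<forall>m. x + period_vector m \<in> fundamental_cube \<longrightarrow> P (x + period_vector m)"
    by (simp add: AE_all_countable)
  then show ?thesis
    by eventually_elim (metis assms(2) torus_periodic_shift wrap_mem wrap_def)
qed

lemma AE_lborel_imp_torus: "AE x in lborel. P x \<Longrightarrow> AE x in torus. P x"
  by (auto simp: AE_torus_iff)

text \<open>
  Stated for distributions, translation invariance passes at once to integrability and to
  integrals with values in any Banach space.
\<close>

lemma distr_torus_shift:
  assumes [measurable]: "f \<in> borel_measurable borel" and per: "torus_periodic f"
  shows "distr torus borel (\<lambda>x. f (x + h)) = distr torus borel f"
proof (rule measure_eqI)
  fix A assume "A \<in> sets (distr torus borel (\<lambda>x. f (x + h)))"
  then have [measurable]: "A \<in> sets borel" by simp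
  have [measurable]: "f \<in> borel_measurable torus" "(\<lambda>x. f (x + h)) \<in> borel_measurable torus"
    by (auto intro: measurable_compose[OF measurable_torus_ident])
  have *: "emeasure (distr torus borel g) A = (\<integral>\<^sup>+x. indicator A (g x) * indicator fundamental_cube x \<partial>lborel)"
    if [measurable]: "g \<in> borel_measurable torus" for g
    by (subst nn_integral_torus[symmetric], subst nn_integral_distr[of g torus borel "indicator A", symmetric])
       auto
  show "emeasure (distr torus borel (\<lambda>x. f (x + h))) A = emeasure (distr torus borel f) A"
    unfolding *[OF \<open>f \<in> borel_measurable torus\<close>] *[OF \<open>(\<lambda>x. f (x + h)) \<in> borel_measurable torus\<close>]
    by (rule nn_integral_fundamental_shift[of "\<lambda>x. indicator A (f x)"])
       (use per in \<open>auto simp: torus_periodic_def\<close>)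
qed simp

lemma torus_measurable: "f \<in> borel_measurable borel \<Longrightarrow> f \<in> borel_measurable torus"
  by (rule measurable_compose[OF measurable_torus_ident])

lemma torus_integral_shift:
  fixes f :: "R3 \<Rightarrow> 'b::{banach, second_countable_topology}"
  assumes [measurable]: "f \<in> borel_measurable borel" and per: "torus_periodic f"
  shows "(LINT x|torus. f (x + h)) = (LINT x|torus. f x)"
    and "integrable torus (\<lambda>x. f (x + h)) \<longleftrightarrow> integrable torus f"
proof -
  have m: "f \<in> borel_measurable torus" "(\<lambda>x. f (x + h)) \<in> borel_measurable torus"
    by (auto intro: torus_measurable)
  show "(LINT x|torus. f (x + h)) = (LINT x|torus. f x)"
    using distr_torus_shift[OF assms, of h] integral_distr[OF m(1), of "\<lambda>x. x"]
      integral_distr[OF m(2), of "\<lambda>x. x"] by simp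
  show "integrable torus (\<lambda>x. f (x + h)) \<longleftrightarrow> integrable torus f"
    using distr_torus_shift[OF assms, of h] integrable_distr_eq[OF m(1), of "\<lambda>x. x"]
      integrable_distr_eq[OF m(2), of "\<lambda>x. x"] by simp
qed

lemma torus_integrable_bounded:
  fixes f :: "R3 \<Rightarrow> 'b::{banach, second_countable_topology}"
  assumes "f \<in> borel_measurable borel" "\<And>x. norm (f x) \<le> C"
  shows "integrable torus f"
  by (rule torus.integrable_const_bound[of _ C]) (use assms in \<open>auto intro: torus_measurable\<close>)

text \<open>
  The difference quotients have integral 0 by translation invariance and are bounded by the mean
  value theorem, so dominated convergence applies.  This is the form in which integration by parts
  on the torus is used.
\<close>

lemma torus_integral_derivative_zero:
  fixes g g' :: "R3 \<Rightarrow> real"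
  assumes per: "torus_periodic g" and [measurable]: "g \<in> borel_measurable borel" "g' \<in> borel_measurable borel"
    and bounds: "\<And>x. \<bar>g x\<bar> \<le> C" "\<And>x. \<bar>g' x\<bar> \<le> C"
    and D: "\<And>x. ((\<lambda>s. g (x + s *\<^sub>R e)) has_real_derivative g' x) (at 0)"
  shows "(LINT x|torus. g' x) = 0"
proof -
  have D': "((\<lambda>s. g (x + s *\<^sub>R e)) has_real_derivative g' (x + s *\<^sub>R e)) (at s)" for x s
  proof -
    have "((\<lambda>r. g (x + s *\<^sub>R e + r *\<^sub>R e)) has_real_derivative g' (x + s *\<^sub>R e)) (at 0)" by (rule D)
    then show ?thesis
      using DERIV_shift[of "\<lambda>r. g (x + r *\<^sub>R e)" "g' (x + s *\<^sub>R e)" 0 s] by (simp add: algebra_simps)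
  qed
  define q where "q n x = real (Suc n) * (g (x + inverse (real (Suc n)) *\<^sub>R e) - g x)" for n x
  have int: "integrable torus g" "integrable torus (\<lambda>x. g (x + h))" for h
    by (rule torus_integrable_bounded[of _ C]; use bounds in simp)+
  have q0: "(LINT x|torus. q n x) = 0" for n
    unfolding q_def using torus_integral_shift(1)[OF _ per] int by simp
  have qb: "\<bar>q n x\<bar> \<le> C" for n x
  proof -
    let ?s = "inverse (real (Suc n))"
    obtain z where "g (x + ?s *\<^sub>R e) - g (x + 0 *\<^sub>R e) = (?s - 0) * g' (x + z *\<^sub>R e)"
      using MVT2[of 0 ?s "\<lambda>s. g (x + s *\<^sub>R e)" "\<lambda>s. g' (x + s *\<^sub>R e)"] D' by auto
    then have "q n x = g' (x + z *\<^sub>R e)" by (simp add: q_def)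
    then show ?thesis using bounds by simp
  qed
  have ql: "(\<lambda>n. q n x) \<longlonglongrightarrow> g' x" for x
  proof -
    have "((\<lambda>s. (g (x + s *\<^sub>R e) - g x) / s) \<longlongrightarrow> g' x) (at 0)"
      using D[of x] by (simp add: DERIV_def)
    moreover have "filterlim (\<lambda>n. inverse (real (Suc n))) (at 0) sequentially"
      using LIMSEQ_inverse_real_of_nat by (auto simp: filterlim_at)
    ultimately have "(\<lambda>n. (g (x + inverse (real (Suc n)) *\<^sub>R e) - g x) / inverse (real (Suc n))) \<longlonglongrightarrow> g' x"
      by (rule filterlim_compose)
    then show ?thesis by (simp add: q_def field_simps)
  qed
  have "(\<lambda>n. LINT x|torus. q n x) \<longlonglongrightarrow> (LINT x|torus. g' x)"
    by (rule integral_dominated_convergence[where w="\<lambda>_. C"])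
       (use ql qb in \<open>auto intro!: torus_measurable simp: q_def[abs_def]\<close>)
  then show ?thesis using q0 LIMSEQ_unique[OF _ tendsto_const] by simp
qed

text \<open>
  Borel representatives remain measurable after composition with \<open>(x, y) \<mapsto> x - y\<close>, which Lebesgue
  measurable functions need not.
\<close>

lemma ex_borel_periodic:
  fixes f :: "R3 \<Rightarrow> R3"
  assumes "f \<in> borel_measurable torus" "torus_periodic f"
  obtains g where "g \<in> borel_measurable borel" "torus_periodic g" "AE x in torus. f x = g x"
proof -
  have m: "(\<lambda>x. if x \<in> period_cube then f x else 0) \<in> borel_measurable lebesgue"
    using assms(1) unfolding torus_def by (simp add: borel_measurable_if)
  have "\<exists>g\<in>borel_measurable lborel. AE x in lborel. (if x \<in> period_cube then f x else 0) $ i = g x" for i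
  proof (rule completion_ex_borel_measurable_real)
    have "(\<lambda>y::R3. y $ i) \<in> borel_measurable borel" by simp
    from measurable_compose[OF m this]
    show "(\<lambda>x. (if x \<in> period_cube then f x else 0) $ i) \<in> borel_measurable lebesgue" .
  qed
  then have "\<forall>i. \<exists>g. g \<in> borel_measurable lborel \<and> (AE x in lborel. (if x \<in> period_cube then f x else 0) $ i = g x)"
    by blast
  from choice[OF this] obtain g where g: "\<And>i. g i \<in> borel_measurable lborel"
    "\<And>i. AE x in lborel. (if x \<in> period_cube then f x else 0) $ i = g i x" by blast
  define h where "h x = (\<chi> i. g i (wrap x))" for x
  have "AE x in lborel. \<forall>i. (if x \<in> period_cube then f x else 0) $ i = g i x"
    using g(2) by (simp add: AE_all_countable)
  then have "AE x in torus. f x = h x"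
    unfolding AE_torus_iff using AE_period_cube_iff
    by eventually_elim (auto simp: h_def vec_eq_iff wrap_fundamental)
  moreover have "h \<in> borel_measurable borel"
    by (rule borel_measurable_vec_R3) (use g(1) measurable_compose[OF wrap_measurable] in \<open>auto simp: h_def\<close>)
  moreover have "torus_periodic h" unfolding h_def by (rule torus_periodic_comp_wrap)
  ultimately show ?thesis using that by blast
qed

section \<open>Trigonometric kernels\<close>

definition frequency :: "int ^ 3 \<Rightarrow> R3" where
  "frequency k = (\<chi> i. of_int (k $ i))"

text \<open>
  Even trigonometric polynomials together with their gradients.  Statements about the pairing of a
  field with a kernel are linear in the kernel, hence follow by induction from the case of a single
  cosine.
\<close>

inductive trig_pair :: "(R3 \<Rightarrow> real) \<Rightarrow> (R3 \<Rightarrow> R3) \<Rightarrow> bool" where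
  trig_cos: "trig_pair (\<lambda>z. cos (frequency k \<bullet> z)) (\<lambda>z. - sin (frequency k \<bullet> z) *\<^sub>R frequency k)"
| trig_add: "trig_pair f f' \<Longrightarrow> trig_pair g g' \<Longrightarrow> trig_pair (\<lambda>z. f z + g z) (\<lambda>z. f' z + g' z)"
| trig_scale: "trig_pair f f' \<Longrightarrow> trig_pair (\<lambda>z. c * f z) (\<lambda>z. c *\<^sub>R f' z)"

lemma frequency_inner_axis: "frequency k \<bullet> (c *\<^sub>R axis i 1) = c * of_int (k $ i)"
  by (simp add: frequency_def inner_axis)

lemma cos_frequency_periodic:
  "cos (frequency k \<bullet> (x + (2 * pi) *\<^sub>R axis i 1) + \<theta>) = cos (frequency k \<bullet> x + \<theta>)"
  "sin (frequency k \<bullet> (x + (2 * pi) *\<^sub>R axis i 1) + \<theta>) = sin (frequency k \<bullet> x + \<theta>)"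
proof -
  have *: "frequency k \<bullet> (x + (2 * pi) *\<^sub>R axis i 1) + \<theta> = (frequency k \<bullet> x + \<theta>) + of_int (k $ i) * (2 * pi)"
    using frequency_inner_axis[of k "2*pi" i] by (simp add: inner_add_right)
  show "cos (frequency k \<bullet> (x + (2 * pi) *\<^sub>R axis i 1) + \<theta>) = cos (frequency k \<bullet> x + \<theta>)"
    unfolding * by (simp add: cos_add sin_int_2pin cos_int_2pin mult.commute[of _ "2*pi"])
  show "sin (frequency k \<bullet> (x + (2 * pi) *\<^sub>R axis i 1) + \<theta>) = sin (frequency k \<bullet> x + \<theta>)"
    unfolding * by (simp add: sin_add sin_int_2pin cos_int_2pin mult.commute[of _ "2*pi"])
qed

lemma trig_pair_derivative:
  "trig_pair f f' \<Longrightarrow> (f has_derivative (\<lambda>h. f' z \<bullet> h)) (at z)"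
proof (induction rule: trig_pair.induct)
  case (trig_cos k)
  show ?case by (auto intro!: derivative_eq_intros simp: inner_commute)
next
  case (trig_add f f' g g')
  then show ?case by (auto intro!: derivative_eq_intros simp: inner_add_left)
next
  case (trig_scale f f' c)
  then show ?case by (auto intro!: derivative_eq_intros)
qed

lemma trig_pair_properties:
  assumes "trig_pair f f'"
  shows "torus_periodic f" "torus_periodic f'" "f (- z) = f z" "f' (- z) = - f' z"
    "f \<in> borel_measurable borel" "f' \<in> borel_measurable borel"
    "\<exists>C. \<forall>z. \<bar>f z\<bar> \<le> C \<and> norm (f' z) \<le> C"
  using assms
proof (induction arbitrary: z rule: trig_pair.induct)
  case (trig_cos k)
  { case 1 then show ?case using cos_frequency_periodic[of k _ _ 0] by (simp add: torus_periodic_def) }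
  { case 2 then show ?case using cos_frequency_periodic[of k _ _ 0] by (simp add: torus_periodic_def) }
  { case 7 then show ?case
  proof (intro exI allI conjI)
      fix z
      have "\<bar>sin (frequency k \<bullet> z)\<bar> * norm (frequency k) \<le> 1 * norm (frequency k)"
        by (intro mult_right_mono) auto
      then show "norm (- sin (frequency k \<bullet> z) *\<^sub>R frequency k) \<le> 1 + norm (frequency k)" by simp
      show "\<bar>cos (frequency k \<bullet> z)\<bar> \<le> 1 + norm (frequency k)"
        by (rule order_trans[OF abs_cos_le_one]) simp
    qed }
next
  case (trig_add f f' g g')
  { case 7
    from trig_add.IH(7,14) obtain C D where CD: "\<And>z. \<bar>f z\<bar> \<le> C \<and> norm (f' z) \<le> C" "\<And>z. \<bar>g z\<bar> \<le> D \<and> norm (g' z) \<le> D"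
      by blast
    show ?case
    proof (intro exI allI conjI)
      fix z
      show "\<bar>f z + g z\<bar> \<le> C + D" using CD[of z] by linarith
      show "norm (f' z + g' z) \<le> C + D" using CD[of z] by (intro norm_triangle_mono) auto
    qed }
next
  case (trig_scale f f' c)
  { case 7
    from trig_scale.IH(7) obtain C where C: "\<And>z. \<bar>f z\<bar> \<le> C \<and> norm (f' z) \<le> C"
      by blast
    show ?case
      using C by (intro exI[of _ "\<bar>c\<bar> * C"]) (auto simp: abs_mult intro!: mult_left_mono) }
qed (auto simp: torus_periodic_def algebra_simps)

definition trig :: "(R3 \<Rightarrow> real) \<Rightarrow> bool" where "trig f \<longleftrightarrow> (\<exists>f'. trig_pair f f')"

text \<open>
  The gradient is determined by the function, so that closure properties only have to be proved for
  the functions.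
\<close>

lemma trig_pairI:
  assumes "trig f" "\<And>z. (f has_derivative (\<lambda>h. f' z \<bullet> h)) (at z)"
  shows "trig_pair f f'"
proof -
  obtain g where g: "trig_pair f g" using assms(1) by (auto simp: trig_def)
  have "f' z = g z" for z
  proof -
    have "(\<lambda>h. f' z \<bullet> h) = (\<lambda>h. g z \<bullet> h)"
      using has_derivative_unique[OF assms(2) trig_pair_derivative[OF g]] .
    then show ?thesis by (metis inner_commute vector_eq_rdot)
  qed
  then have "f' = g" by auto
  with g show ?thesis by simp
qed

lemma trig_intros:
  "trig (\<lambda>z. cos (frequency k \<bullet> z))" "trig f \<Longrightarrow> trig g \<Longrightarrow> trig (\<lambda>z. f z + g z)" "trig f \<Longrightarrow> trig (\<lambda>z. c * f z)"
  unfolding trig_def by (blast intro: trig_pair.intros)+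

lemma trig_induct [consumes 1, case_names cos add scale]:
  assumes "trig f" "\<And>k. P (\<lambda>z. cos (frequency k \<bullet> z))"
    "\<And>f g. trig f \<Longrightarrow> P f \<Longrightarrow> trig g \<Longrightarrow> P g \<Longrightarrow> P (\<lambda>z. f z + g z)"
    "\<And>f c. trig f \<Longrightarrow> P f \<Longrightarrow> P (\<lambda>z. c * f z)"
  shows "P f"
proof -
  obtain f' where "trig_pair f f'" using assms(1) by (auto simp: trig_def)
  then show ?thesis
  proof induction
    case (trig_cos k) show ?case by (rule assms(2))
  next
    case (trig_add f f' g g')
    then show ?case using assms(3)[of f g] by (auto simp: trig_def)
  next
    case (trig_scale f f' c)
    then show ?case using assms(4)[of f c] by (auto simp: trig_def)
  qed
qed

text \<open>
  The product of two cosines is half the sum of the cosines of the sum and of the difference.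
\<close>

lemma trig_mult: "trig f \<Longrightarrow> trig g \<Longrightarrow> trig (\<lambda>z. f z * g z)"
proof (induction f rule: trig_induct)
  case (cos k)
  from cos show ?case
  proof (induction g rule: trig_induct)
    case (cos l)
    have "frequency k \<bullet> z - frequency l \<bullet> z = frequency (k - l) \<bullet> z"
      "frequency k \<bullet> z + frequency l \<bullet> z = frequency (k + l) \<bullet> z" for z
      by (simp_all add: frequency_def inner_vec_def algebra_simps sum.distrib sum_subtractf)
    then have "(\<lambda>z. cos (frequency k \<bullet> z) * cos (frequency l \<bullet> z))
        = (\<lambda>z. (1/2) * (cos (frequency (k - l) \<bullet> z) + cos (frequency (k + l) \<bullet> z)))"
      by (simp add: cos_times_cos fun_eq_iff)
    then show ?case by (simp only: trig_intros)
  next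
    case (add f g)
    then show ?case using trig_intros(2) by (simp add: distrib_left)
  next
    case (scale f c)
    then show ?case using trig_intros(3) by (simp add: mult.left_commute)
  qed
next
  case (add f h)
  then show ?case using trig_intros(2) by (simp add: distrib_right)
next
  case (scale f c)
  then show ?case using trig_intros(3) by (simp add: mult.assoc)
qed

lemma trig_const: "trig (\<lambda>z. c)"
proof -
  have "frequency 0 = 0" by (simp add: frequency_def vec_eq_iff)
  then show ?thesis using trig_intros(3)[OF trig_intros(1)[of 0], of c] by simp
qed

lemma trig_power: "trig f \<Longrightarrow> trig (\<lambda>z. f z ^ n)"
  by (induction n) (auto intro: trig_const trig_mult)

lemma trig_prod: "(\<And>i. i \<in> S \<Longrightarrow> trig (f i)) \<Longrightarrow> trig (\<lambda>z. \<Prod>i\<in>S. f i z)"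
  by (induction S rule: infinite_finite_induct) (auto intro: trig_const trig_mult)

lemma trig_cos_coordinate: "trig (\<lambda>z. cos (z $ i))"
proof -
  have "frequency (axis i 1) \<bullet> z = z $ i" for z
    by (simp add: frequency_def inner_vec_def axis_def if_distrib[of "\<lambda>u. of_int u * _"] cong: if_cong)
  then show ?thesis using trig_intros(1)[of "axis i 1"] by simp
qed

text \<open>
  Up to normalisation the kernel: it is nonnegative, a trigonometric polynomial, and concentrates at
  the lattice of periods as \<open>n\<close> grows.
\<close>

definition cos_power :: "nat \<Rightarrow> R3 \<Rightarrow> real" where
  "cos_power n z = (\<Prod>i\<in>UNIV. (1 + cos (z $ i)) ^ n)"

text \<open>
  The factors that are constant along the coordinate direction \<open>i\<close>.
\<close>

definition cos_power_except :: "nat \<Rightarrow> 3 \<Rightarrow> R3 \<Rightarrow> real" where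
  "cos_power_except n i z = (\<Prod>j\<in>UNIV - {i}. (1 + cos (z $ j)) ^ n)"

lemma cos_power_split: "cos_power n z = (1 + cos (z $ i)) ^ n * cos_power_except n i z"
  unfolding cos_power_def cos_power_except_def by (subst prod.remove[of UNIV i]) auto

lemma one_plus_cos_bounds: "0 \<le> 1 + cos (t::real)" "1 + cos t \<le> 2"
  using cos_ge_minus_one[of t] cos_le_one[of t] by linarith+

lemma trig_cos_power: "trig (cos_power n)" "trig (cos_power_except n i)"
  unfolding cos_power_def[abs_def] cos_power_except_def[abs_def]
  by (auto intro!: trig_prod trig_power trig_intros(2) trig_const trig_cos_coordinate)

lemma trig_properties:
  assumes "trig f"
  shows "torus_periodic f" "f \<in> borel_measurable borel" "integrable torus f" "\<exists>C. \<forall>z. \<bar>f z\<bar> \<le> C"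
proof -
  from assms obtain f' where *: "trig_pair f f'" by (auto simp: trig_def)
  note p = trig_pair_properties[OF *]
  show "torus_periodic f" "f \<in> borel_measurable borel" "\<exists>C. \<forall>z. \<bar>f z\<bar> \<le> C" using p by blast+
  then obtain C where "\<And>z. norm (f z) \<le> C" by auto
  with p(5) show "integrable torus f" by (rule torus_integrable_bounded)
qed

lemma cos_power_nonneg: "0 \<le> cos_power n z" "0 \<le> cos_power_except n i z"
  unfolding cos_power_def cos_power_except_def using one_plus_cos_bounds by (auto intro!: prod_nonneg)

definition cos_moment :: "nat \<Rightarrow> 3 \<Rightarrow> nat \<Rightarrow> real" where
  "cos_moment n i m = (LINT z|torus. (1 + cos (z $ i)) ^ m * cos_power_except n i z)"

text \<open>
  The derivative of \<open>sin z\<^sub>i * (1 + cos z\<^sub>i) ^ m * R\<close> in the direction \<open>i\<close>, where \<open>R\<close> collects the other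
  factors, is \<open>(m + 1) * (1 + cos z\<^sub>i) ^ (m + 1) * R - (2 * m + 1) * (1 + cos z\<^sub>i) ^ m * R\<close>, and its integral
  is 0.  All moments of the kernel follow from this recursion, without evaluating an integral and
  without Fubini's theorem in the coordinates.
\<close>

lemma cos_moment_recursion:
  "real (m + 1) * cos_moment n i (Suc m) = real (2 * m + 1) * cos_moment n i m"
proof -
  let ?R = "cos_power_except n i"
  have int: "integrable torus (\<lambda>z. (1 + cos (z $ i)) ^ m * ?R z)" for m
    by (intro trig_properties trig_mult trig_power trig_intros(2) trig_const trig_cos_coordinate trig_cos_power)
  define g where "g z = sin (z $ i) * ((1 + cos (z $ i)) ^ m * ?R z)" for z :: R3
  define g' where "g' z = real (m + 1) * ((1 + cos (z $ i)) ^ Suc m * ?R z) - real (2 * m + 1) * ((1 + cos (z $ i)) ^ m * ?R z)" for z :: R3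
  have tg': "trig g'"
    unfolding g'_def[abs_def] diff_conv_add_uminus mult_minus_left[symmetric]
    by (intro trig_mult trig_power trig_intros(2) trig_const trig_cos_coordinate trig_cos_power)
  have th: "trig (\<lambda>z. (1 + cos (z $ i)) ^ m * ?R z)"
    by (intro trig_mult trig_power trig_intros(2) trig_const trig_cos_coordinate trig_cos_power)
  obtain C where C: "\<And>z. \<bar>(1 + cos (z $ i)) ^ m * ?R z\<bar> \<le> C" using trig_properties(4)[OF th] by blast
  obtain D where D: "\<And>z. \<bar>g' z\<bar> \<le> D" using trig_properties(4)[OF tg'] by blast
  have "(LINT z|torus. g' z) = 0"
  proof (rule torus_integral_derivative_zero[of g g' "max C D" "axis i 1"])
    show "torus_periodic g"
      using trig_properties(1)[OF th] by (auto simp: g_def torus_periodic_def axis_def)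
    show "g \<in> borel_measurable borel"
      unfolding g_def using trig_properties(2)[OF th] by measurable
    show "g' \<in> borel_measurable borel" using trig_properties(2)[OF tg'] .
    show "\<bar>g' x\<bar> \<le> max C D" for x using D[of x] by simp
    show "\<bar>g x\<bar> \<le> max C D" for x
    proof -
      have "\<bar>g x\<bar> \<le> 1 * \<bar>(1 + cos (x $ i)) ^ m * ?R x\<bar>"
        unfolding g_def abs_mult[of "sin _"] by (intro mult_right_mono) auto
      then show ?thesis using C[of x] by simp
    qed
    fix x :: R3
    have R: "?R (x + s *\<^sub>R axis i 1) = ?R x" for s
      unfolding cos_power_except_def by (intro prod.cong) (auto simp: axis_def)
    have ax: "(x + s *\<^sub>R axis i 1) $ i = x $ i + s" for s by (simp add: axis_def)
    let ?c = "cos (x $ i)" and ?s = "sin (x $ i)"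
    have "((\<lambda>s. (sin (x $ i + s) * (1 + cos (x $ i + s)) ^ m) * ?R x) has_real_derivative
       (?c * (1 + ?c) ^ m - real m * ?s\<^sup>2 * (1 + ?c) ^ (m - 1)) * ?R x) (at 0)"
      by (auto intro!: derivative_eq_intros simp: power2_eq_square algebra_simps)
    moreover have "(?c * (1 + ?c) ^ m - real m * ?s\<^sup>2 * (1 + ?c) ^ (m - 1)) * ?R x = g' x"
    proof -
      have s2: "?s\<^sup>2 = (1 + ?c) * (1 - ?c)" by (simp add: sin_squared_eq power2_eq_square algebra_simps)
      have "real m * ?s\<^sup>2 * (1 + ?c) ^ (m - 1) = real m * (1 - ?c) * (1 + ?c) ^ m"
        unfolding s2 by (cases m) auto
      then have "?c * (1 + ?c) ^ m - real m * ?s\<^sup>2 * (1 + ?c) ^ (m - 1)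
          = real (m + 1) * (1 + ?c) ^ Suc m - real (2 * m + 1) * (1 + ?c) ^ m"
        by (simp only:) (simp add: algebra_simps)
      then show ?thesis by (simp only:) (simp add: g'_def left_diff_distrib mult.assoc)
    qed
    ultimately show "((\<lambda>s. g (x + s *\<^sub>R axis i 1)) has_real_derivative g' x) (at 0)"
      by (simp add: g_def R mult.assoc ax)
  qed
  then show ?thesis
    unfolding g'_def cos_moment_def using int[of m] int[of "Suc m"] by simp
qed

definition cos_mass :: "nat \<Rightarrow> real" where
  "cos_mass n = (LINT z|torus. cos_power n z)"

lemma cos_moment_self: "cos_moment n i n = cos_mass n"
  by (simp add: cos_moment_def cos_mass_def cos_power_split[of n _ i])

text \<open>
  All cosines are nonnegative on the unit cube, where the product is therefore at least 1.
\<close>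

lemma cos_mass_pos: "0 < cos_mass n"
proof -
  have sub: "cbox 0 1 \<subseteq> period_cube"
  proof -
    have "(1::real) \<le> 2 * pi" using pi_ge_two by linarith
    then show ?thesis by (auto simp: mem_box_cart one_vec_def) (meson order_trans)
  qed
  have m: "measure torus (cbox 0 1) = 1"
  proof -
    have "measure torus (cbox 0 1) = measure lebesgue (cbox 0 (1::R3))"
      unfolding torus_def using sub by (intro measure_restrict_space) auto
    also have "\<dots> = 1"
      using content_cbox_cart[of "0::R3" 1] by (simp add: measure_completion interval_ne_empty_cart)
    finally show ?thesis .
  qed
  have "1 = (LINT z|torus. indicator (cbox 0 1) z :: real)"
    using m sub by (simp add: Int_absorb2)
  also have "\<dots> \<le> (LINT z|torus. cos_power n z)"
  proof (rule integral_mono)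
    show "integrable torus (indicator (cbox 0 1) :: R3 \<Rightarrow> real)"
      by (rule torus_integrable_bounded[of _ 1]) (auto simp: indicator_def)
    show "integrable torus (cos_power n)" using trig_properties(3)[OF trig_cos_power(1)] .
    fix z :: R3
    show "indicator (cbox 0 1) z \<le> cos_power n z"
    proof (cases "z \<in> cbox 0 1")
      case True
      have "1 \<le> (1 + cos (z $ i)) ^ n" for i
      proof (rule one_le_power)
        have "0 \<le> z $ i" "z $ i \<le> 1" using True by (auto simp: mem_box_cart)
        then have "0 \<le> cos (z $ i)" using pi_ge_two by (intro cos_ge_zero) linarith+
        then show "1 \<le> 1 + cos (z $ i)" by simp
      qed
      then have "1 \<le> cos_power n z" unfolding cos_power_def by (intro prod_ge_1) auto
      then show ?thesis using True by simp
    qed (simp add: cos_power_nonneg)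
  qed
  finally show ?thesis by (simp add: cos_mass_def)
qed

definition kernel :: "nat \<Rightarrow> R3 \<Rightarrow> real" where
  "kernel n z = (1 / cos_mass n) * cos_power n z"

definition kernel_grad :: "nat \<Rightarrow> R3 \<Rightarrow> R3" where
  "kernel_grad n z = (\<chi> i. (1 / cos_mass n) *
     (- real n * sin (z $ i) * (1 + cos (z $ i)) ^ (n - 1) * cos_power_except n i z))"

text \<open>
  Near the lattice of periods this is, to leading order, half the squared distance to it.  It is itself
  a trigonometric polynomial, so that its kernel moments are moments of cosines.
\<close>

definition cos_gap :: "R3 \<Rightarrow> real" where
  "cos_gap z = (\<Sum>i\<in>UNIV. 1 - cos (z $ i))"

lemma trig_kernel: "trig (kernel n)"
  unfolding kernel_def[abs_def] by (intro trig_intros(3) trig_cos_power)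

lemma trig_pair_kernel: "trig_pair (kernel n) (kernel_grad n)"
proof (rule trig_pairI[OF trig_kernel])
  fix z :: R3
  have "((\<lambda>z. (1 + cos (z $ i)) ^ n) has_derivative
      (\<lambda>h. (- real n * sin (z $ i) * (1 + cos (z $ i)) ^ (n - 1)) * h $ i)) (at z)" for i
    by (auto intro!: derivative_eq_intros bounded_linear_imp_has_derivative bounded_linear_vec_nth)
  from has_derivative_prod[where I=UNIV and f="\<lambda>i z. (1 + cos (z $ i)) ^ n", OF this]
  have "(cos_power n has_derivative (\<lambda>h. \<Sum>i\<in>UNIV. (- real n * sin (z $ i) * (1 + cos (z $ i)) ^ (n - 1)) * h $ i
      * cos_power_except n i z)) (at z)"
    by (simp add: cos_power_def[abs_def] cos_power_except_def)
  then have "(kernel n has_derivative (\<lambda>h. (1 / cos_mass n) * (\<Sum>i\<in>UNIV. (- real n * sin (z $ i) * (1 + cos (z $ i)) ^ (n - 1)) * h $ i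
      * cos_power_except n i z))) (at z)"
    unfolding kernel_def[abs_def] by (rule has_derivative_mult_right)
  moreover have "(\<lambda>h. (1 / cos_mass n) * (\<Sum>i\<in>UNIV. (- real n * sin (z $ i) * (1 + cos (z $ i)) ^ (n - 1)) * h $ i
      * cos_power_except n i z)) = (\<lambda>h. kernel_grad n z \<bullet> h)"
    unfolding kernel_grad_def inner_vec_def sum_distrib_left
    by (intro ext sum.cong) (simp_all add: ac_simps)
  ultimately show "(kernel n has_derivative (\<lambda>h. kernel_grad n z \<bullet> h)) (at z)" by simp
qed

lemma kernel_nonneg: "0 \<le> kernel n z"
  using cos_mass_pos[of n] cos_power_nonneg(1)[of n z] by (simp add: kernel_def)

lemma integral_kernel: "(LINT z|torus. kernel n z) = 1"
  using cos_mass_pos[of n] by (simp add: kernel_def flip: cos_mass_def)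

lemma integrable_cos_moment: "integrable torus (\<lambda>z. (1 + cos (z $ i)) ^ m * cos_power_except n i z)"
  by (intro trig_properties trig_mult trig_power trig_intros(2) trig_const trig_cos_coordinate trig_cos_power)

lemma cos_moment_above:
  "cos_moment n i (Suc n) = (2 - 1 / real (n + 1)) * cos_mass n"
  "cos_moment n i (Suc (Suc n)) = (2 - 1 / real (n + 2)) * (2 - 1 / real (n + 1)) * cos_mass n"
proof -
  show 1: "cos_moment n i (Suc n) = (2 - 1 / real (n + 1)) * cos_mass n"
    using cos_moment_recursion[of n n i] by (simp add: cos_moment_self field_simps)
  show "cos_moment n i (Suc (Suc n)) = (2 - 1 / real (n + 2)) * (2 - 1 / real (n + 1)) * cos_mass n"
  proof -
    have "cos_moment n i (Suc (Suc n)) = (2 - 1 / real (n + 2)) * cos_moment n i (Suc n)"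
      using cos_moment_recursion[of "Suc n" n i] by (simp add: field_simps)
    then show ?thesis by (simp add: 1)
  qed
qed

text \<open>
  With respect to the normalised kernel, \<open>1 - cos z\<^sub>i\<close> has mean \<open>1 / (n + 1)\<close>: the kernel lives at scale
  \<open>n powr (-1/2)\<close>.
\<close>

lemma integral_cos_power_gap:
  "(LINT z|torus. cos_power n z * (1 - cos (z $ i))) = cos_mass n / real (n + 1)"
proof -
  have "cos_power n z * (1 - cos (z $ i)) = 2 * cos_power n z - (1 + cos (z $ i)) ^ Suc n * cos_power_except n i z" for z
    by (simp add: cos_power_split[of n _ i] algebra_simps)
  then have "(LINT z|torus. cos_power n z * (1 - cos (z $ i))) = 2 * cos_mass n - cos_moment n i (Suc n)"
    using integrable_cos_moment[of i "Suc n" n] trig_properties(3)[OF trig_cos_power(1)[of n]]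
    by (simp add: cos_mass_def cos_moment_def)
  then show ?thesis by (simp add: cos_moment_above field_simps)
qed

lemma integral_cos_power_gap_square:
  "(LINT z|torus. cos_power n z * (1 - cos (z $ i))\<^sup>2) \<le> 3 * cos_mass n / (real (n + 1))\<^sup>2"
proof -
  have "cos_power n z * (1 - cos (z $ i))\<^sup>2 = 4 * cos_power n z - 4 * ((1 + cos (z $ i)) ^ Suc n * cos_power_except n i z)
     + (1 + cos (z $ i)) ^ Suc (Suc n) * cos_power_except n i z" for z
    by (simp add: cos_power_split[of n _ i] algebra_simps power2_eq_square)
  then have "(LINT z|torus. cos_power n z * (1 - cos (z $ i))\<^sup>2)
      = 4 * cos_mass n - 4 * cos_moment n i (Suc n) + cos_moment n i (Suc (Suc n))"
    using integrable_cos_moment[of i "Suc n" n] integrable_cos_moment[of i "Suc (Suc n)" n]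
      trig_properties(3)[OF trig_cos_power(1)[of n]]
    by (simp add: cos_mass_def cos_moment_def)
  also have "\<dots> = 3 * cos_mass n / (real (n + 1) * real (n + 2))"
  proof -
    define a b where "a = 1 / real (n + 1)" and "b = 1 / real (n + 2)"
    have "a * b = a - b" by (simp add: a_def b_def field_simps)
    then have "4 - 4 * (2 - a) + (2 - b) * (2 - a) = 3 * (a * b)" by (simp add: algebra_simps)
    then have "4 * cos_mass n - 4 * ((2 - a) * cos_mass n) + (2 - b) * (2 - a) * cos_mass n = 3 * (a * b) * cos_mass n"
      by (metis (no_types, opaque_lifting) left_diff_distrib distrib_right mult.assoc)
    then show ?thesis unfolding cos_moment_above by (simp add: a_def b_def)
  qed
  also have "\<dots> \<le> 3 * cos_mass n / (real (n + 1))\<^sup>2"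
    using cos_mass_pos[of n] by (intro divide_left_mono) (auto simp: power2_eq_square)
  finally show ?thesis .
qed

text \<open>
  This is the second moment of \<open>tan (z\<^sub>i / 2)\<close>, which is, up to the factor \<open>- n\<close>, the logarithmic derivative
  of the kernel.
\<close>

lemma cos_moment_below:
  assumes "n \<ge> 1" shows "2 * cos_moment n i (n - 1) - cos_mass n \<le> cos_mass n / real n"
proof -
  obtain m where n: "n = Suc m" using assms by (cases n) auto
  have "real (2 * m + 1) * cos_moment n i m = real (m + 1) * cos_mass n"
    using cos_moment_recursion[of m n i] by (simp add: n cos_moment_self)
  then have "2 * cos_moment n i m - cos_mass n = cos_mass n / real (2 * m + 1)"
    by (simp add: field_simps)
  also have "\<dots> \<le> cos_mass n / real n"
    using cos_mass_pos[of n] by (intro divide_left_mono) (auto simp: n)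
  finally show ?thesis by (simp add: n)
qed

lemma cos_gap_nonneg: "0 \<le> cos_gap z"
  by (auto simp: cos_gap_def intro!: sum_nonneg)

lemma trig_cos_gap: "trig cos_gap"
proof -
  have "trig (\<lambda>z. (cos (z $ 1) + (cos (z $ 2) + cos (z $ 3))) * (-1) + 3)"
    by (intro trig_mult trig_intros(2) trig_const trig_cos_coordinate)
  then show ?thesis by (simp add: cos_gap_def[abs_def] sum_3 algebra_simps)
qed

lemma integral_kernel_gap: "(LINT z|torus. kernel n z * cos_gap z) = 3 / real (n + 1)"
proof -
  have int: "integrable torus (\<lambda>z. cos_power n z * (1 - cos (z $ i)))" for i
  proof -
    have "trig (\<lambda>z. cos_power n z * (1 + (-1) * cos (z $ i)))"
      by (intro trig_mult trig_intros(2) trig_const trig_cos_coordinate trig_cos_power)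
    from trig_properties(3)[OF this] show ?thesis by simp
  qed
  have "(LINT z|torus. kernel n z * cos_gap z) = (1 / cos_mass n) * (LINT z|torus. (\<Sum>i\<in>UNIV. cos_power n z * (1 - cos (z $ i))))"
  proof -
    have "kernel n z * cos_gap z = (1 / cos_mass n) * (\<Sum>i\<in>UNIV. cos_power n z * (1 - cos (z $ i)))" for z
      by (simp add: kernel_def cos_gap_def sum_distrib_left)
    then show ?thesis by (simp only: integral_mult_right_zero)
  qed
  also have "\<dots> = (1 / cos_mass n) * (\<Sum>i\<in>(UNIV :: 3 set). cos_mass n / real (n + 1))"
    using int by (simp add: integral_cos_power_gap)
  also have "\<dots> = 3 / real (n + 1)" using cos_mass_pos[of n] by simp
  finally show ?thesis .
qed

lemma integral_kernel_gap_square: "(LINT z|torus. kernel n z * (cos_gap z)\<^sup>2) \<le> 27 / (real (n + 1))\<^sup>2"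
proof -
  have int: "integrable torus (\<lambda>z. cos_power n z * (1 - cos (z $ i))\<^sup>2)" for i
  proof -
    have "trig (\<lambda>z. cos_power n z * (1 + (-1) * cos (z $ i))\<^sup>2)"
      by (intro trig_mult trig_power trig_intros(2) trig_const trig_cos_coordinate trig_cos_power)
    from trig_properties(3)[OF this] show ?thesis by simp
  qed
  have "kernel n z * (cos_gap z)\<^sup>2 \<le> (3 / cos_mass n) * (\<Sum>i\<in>UNIV. cos_power n z * (1 - cos (z $ i))\<^sup>2)" for z
  proof -
    have "(cos_gap z)\<^sup>2 \<le> 3 * (\<Sum>i\<in>UNIV. (1 - cos (z $ i))\<^sup>2)"
      using sum_squares_bound[of "1 - cos (z $ 1)" "1 - cos (z $ 2)"]
        sum_squares_bound[of "1 - cos (z $ 1)" "1 - cos (z $ 3)"] sum_squares_bound[of "1 - cos (z $ 2)" "1 - cos (z $ 3)"]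
      by (simp add: cos_gap_def sum_3 power2_eq_square algebra_simps)
    from mult_left_mono[OF this kernel_nonneg[of n z]] show ?thesis
      by (simp add: kernel_def sum_distrib_left sum_3 algebra_simps)
  qed
  then have "(LINT z|torus. kernel n z * (cos_gap z)\<^sup>2)
     \<le> (LINT z|torus. (3 / cos_mass n) * (\<Sum>i\<in>UNIV. cos_power n z * (1 - cos (z $ i))\<^sup>2))"
  proof (intro integral_mono)
    show "integrable torus (\<lambda>z. kernel n z * (cos_gap z)\<^sup>2)"
      by (intro trig_properties trig_mult trig_power trig_kernel trig_cos_gap)
  qed (use int in auto)
  also have "\<dots> = (3 / cos_mass n) * (\<Sum>i\<in>UNIV. LINT z|torus. cos_power n z * (1 - cos (z $ i))\<^sup>2)"
    using int by simp
  also have "\<dots> \<le> (3 / cos_mass n) * (\<Sum>i\<in>(UNIV :: 3 set). 3 * cos_mass n / (real (n + 1))\<^sup>2)"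
    using cos_mass_pos[of n] integral_cos_power_gap_square by (intro mult_left_mono sum_mono) auto
  also have "\<dots> = 27 / (real (n + 1))\<^sup>2" using cos_mass_pos[of n] by simp
  finally show ?thesis .
qed

lemma kernel_grad_measurable [measurable]: "kernel_grad n \<in> borel_measurable borel"
  and kernel_measurable [measurable]: "kernel n \<in> borel_measurable borel"
  and cos_gap_measurable [measurable]: "cos_gap \<in> borel_measurable borel"
  using trig_pair_properties[OF trig_pair_kernel] trig_properties[OF trig_cos_gap] by blast+

lemma kernel_grad_component_measurable [measurable]:
  "(\<lambda>z. kernel_grad n z $ i) \<in> borel_measurable borel"
  using measurable_compose[OF kernel_grad_measurable, of "\<lambda>x. x $ i" borel n] by simp

text \<open>
  The derivative of the kernel is \<open>- n * tan (z\<^sub>i / 2)\<close> times the kernel.  The tangent is of order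
  \<open>n powr (-1/2)\<close> and \<open>cos_gap\<close> of order \<open>1 / n\<close> in mean, which gives the order
  \<open>n * n powr (-1/2) * n powr (- \<gamma> / 2)\<close>.  The product of tangent and \<open>cos_gap\<close> is separated by the
  inequality between the geometric and the arithmetic mean.
\<close>

lemma integral_kernel_grad_component:
  assumes n: "n \<ge> 1" and \<gamma>: "0 < \<gamma>" "\<gamma> \<le> 2"
  shows "(LINT z|torus. \<bar>kernel_grad n z $ i\<bar> * cos_gap z powr (\<gamma> / 2)) \<le> 15 * real n powr ((1 - \<gamma>) / 2)"
proof -
  \<comment> \<open>the weight for which both terms of the arithmetic mean have the same order\<close>
  define l where "l = real n powr ((1 - \<gamma>) / 2)"
  have l: "l > 0" using n by (simp add: l_def)
  define P where "P z = (1 - cos (z $ i)) * ((1 + cos (z $ i)) ^ (n - 1) * cos_power_except n i z)" for z :: R3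
  have Pint: "integrable torus P" and Pval: "(LINT z|torus. P z) \<le> cos_mass n / real n"
  proof -
    obtain m where m: "n = Suc m" using n by (cases n) auto
    have P: "P z = 2 * ((1 + cos (z $ i)) ^ (n - 1) * cos_power_except n i z) - cos_power n z" for z
      unfolding P_def cos_power_split[of n _ i] by (simp add: m algebra_simps)
    show "integrable torus P" unfolding P[abs_def]
      using integrable_cos_moment[of i "n-1" n] trig_properties(3)[OF trig_cos_power(1)[of n]] by simp
    have "(LINT z|torus. P z) = 2 * cos_moment n i (n - 1) - cos_mass n"
      unfolding P using integrable_cos_moment[of i "n-1" n] trig_properties(3)[OF trig_cos_power(1)[of n]]
      by (simp add: cos_moment_def cos_mass_def)
    then show "(LINT z|torus. P z) \<le> cos_mass n / real n" using cos_moment_below[OF n, of i] by simp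
  qed
  define S where "S z = real n powr (- \<gamma>) * (kernel n z + real n ^ 2 * (kernel n z * (cos_gap z)\<^sup>2))" for z
  have kint: "integrable torus (kernel n)" "integrable torus (\<lambda>z. kernel n z * (cos_gap z)\<^sup>2)"
    by (intro trig_properties trig_mult trig_power trig_kernel trig_cos_gap)+
  have Sint: "integrable torus S" unfolding S_def[abs_def] using kint by simp
  have Sval: "(LINT z|torus. S z) \<le> 28 * real n powr (- \<gamma>)"
  proof -
    have "(LINT z|torus. S z) = real n powr (- \<gamma>) * (1 + real n ^ 2 * (LINT z|torus. kernel n z * (cos_gap z)\<^sup>2))"
      unfolding S_def using kint by (simp add: integral_kernel)
    also have "\<dots> \<le> real n powr (- \<gamma>) * (1 + real n ^ 2 * (27 / (real (n + 1))\<^sup>2))"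
      using integral_kernel_gap_square[of n] by (intro mult_left_mono add_left_mono) auto
    also have "\<dots> \<le> real n powr (- \<gamma>) * (1 + 27)"
    proof (intro mult_left_mono add_left_mono)
      have "(real n / real (n + 1)) ^ 2 \<le> 1" by (intro power_le_one) auto
      then have "27 * (real n / real (n + 1)) ^ 2 \<le> 27" by linarith
      then show "real n ^ 2 * (27 / (real (n + 1))\<^sup>2) \<le> 27" by (simp add: power_divide mult.commute)
    qed auto
    finally show ?thesis by simp
  qed
  have le: "\<bar>kernel_grad n z $ i\<bar> * cos_gap z powr (\<gamma> / 2) \<le> (real n / 2) * (l / cos_mass n * P z + S z / l)" for z
  proof -
    define c s X R where "c = cos (z $ i)" and "s = sin (z $ i)" and "X = cos_gap z powr (\<gamma> / 2)"
      and "R = (1 + c) ^ (n - 1) * cos_power_except n i z"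
    have c: "0 \<le> 1 - c" "0 \<le> 1 + c" using one_plus_cos_bounds[of "z $ i"] by (auto simp: c_def)
    have R: "0 \<le> R" using c cos_power_nonneg by (auto simp: R_def)
    have X: "0 \<le> X" by (simp add: X_def)
    have s2: "s\<^sup>2 = (1 - c) * (1 + c)" by (simp add: s_def c_def sin_squared_eq power2_eq_square algebra_simps)
    have KR: "cos_power n z = (1 + c) * R"
    proof -
      have "(1 + c) ^ n = (1 + c) * (1 + c) ^ (n - 1)" using n by (cases n) auto
      then show ?thesis by (simp add: cos_power_split[of n z i] R_def c_def)
    qed
    have amgm: "\<bar>s\<bar> * X \<le> (l * (1 - c) + (1 + c) * X\<^sup>2 / l) / 2"
    proof -
      define p q where "p = sqrt (l * (1 - c))" and "q = sqrt ((1 + c) * X\<^sup>2 / l)"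
      have "p * q = sqrt (s\<^sup>2 * X\<^sup>2)"
        unfolding p_def q_def real_sqrt_mult[symmetric] s2 using l by (simp add: mult.assoc)
      also have "\<dots> = \<bar>s\<bar> * X" using X by (simp add: real_sqrt_mult)
      finally have "\<bar>s\<bar> * X = p * q" by simp
      also have "\<dots> \<le> (p\<^sup>2 + q\<^sup>2) / 2" using sum_squares_bound[of p q] by simp
      also have "p\<^sup>2 = l * (1 - c)" unfolding p_def using l c by simp
      also have "q\<^sup>2 = (1 + c) * X\<^sup>2 / l" unfolding q_def using l c by simp
      finally show ?thesis .
    qed
    have X2: "X\<^sup>2 \<le> real n powr (- \<gamma>) * (1 + real n ^ 2 * (cos_gap z)\<^sup>2)"
    proof -
      have X2: "X\<^sup>2 = cos_gap z powr \<gamma>"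
        by (simp add: X_def powr_def power2_eq_square flip: exp_add)
      define y where "y = real n * cos_gap z"
      have y: "0 \<le> y" using cos_gap_nonneg by (simp add: y_def)
      have "y powr \<gamma> \<le> 1 + y\<^sup>2"
      proof (cases "y \<le> 1")
        case True
        then have "y powr \<gamma> \<le> 1" using y \<gamma> by (intro powr_le1) auto
        then show ?thesis by (simp add: add_increasing2)
      next
        case False
        then have "y powr \<gamma> \<le> y powr 2" using \<gamma> by (intro powr_mono) auto
        then show ?thesis using False by simp
      qed
      moreover have "cos_gap z powr \<gamma> = real n powr (- \<gamma>) * y powr \<gamma>"
        using n cos_gap_nonneg[of z] by (simp add: y_def powr_mult powr_minus)
      ultimately show ?thesis
        unfolding X2 by (simp add: y_def power_mult_distrib mult_left_mono)
    qed
    have "\<bar>kernel_grad n z $ i\<bar> * X = (real n / cos_mass n) * R * (\<bar>s\<bar> * X)"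
      using cos_mass_pos[of n] R c cos_power_nonneg(2)[of n i z]
      by (simp add: kernel_grad_def abs_mult R_def c_def s_def power_abs)
    also have "\<dots> \<le> (real n / cos_mass n) * R * ((l * (1 - c) + (1 + c) * X\<^sup>2 / l) / 2)"
      using cos_mass_pos[of n] R amgm by (intro mult_left_mono) auto
    also have "\<dots> = (real n / 2) * (l / cos_mass n * P z + kernel n z * X\<^sup>2 / l)"
      unfolding kernel_def KR P_def using l cos_mass_pos[of n] by (simp add: R_def c_def field_simps)
    also have "\<dots> \<le> (real n / 2) * (l / cos_mass n * P z + S z / l)"
    proof -
      have "kernel n z * X\<^sup>2 \<le> S z"
        using mult_left_mono[OF X2 kernel_nonneg[of n z]] by (simp add: S_def algebra_simps)
      then show ?thesis using l by (intro mult_left_mono add_left_mono divide_right_mono) auto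
    qed
    finally show ?thesis by (simp add: X_def)
  qed
  have "(LINT z|torus. \<bar>kernel_grad n z $ i\<bar> * cos_gap z powr (\<gamma> / 2))
     \<le> (LINT z|torus. (real n / 2) * (l / cos_mass n * P z + S z / l))"
  proof (rule integral_mono[OF _ _ le])
    show int: "integrable torus (\<lambda>z. (real n / 2) * (l / cos_mass n * P z + S z / l))"
      using Pint Sint by simp
    show "integrable torus (\<lambda>z. \<bar>kernel_grad n z $ i\<bar> * cos_gap z powr (\<gamma> / 2))"
    proof (rule Bochner_Integration.integrable_bound[OF int])
      show "(\<lambda>z. \<bar>kernel_grad n z $ i\<bar> * cos_gap z powr (\<gamma> / 2)) \<in> borel_measurable torus"
        by (rule torus_measurable) measurable
      show "AE z in torus. norm (\<bar>kernel_grad n z $ i\<bar> * cos_gap z powr (\<gamma> / 2))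
          \<le> norm ((real n / 2) * (l / cos_mass n * P z + S z / l))"
        using order_trans[OF le abs_ge_self] by (auto simp: abs_mult)
    qed
  qed
  also have "\<dots> = (real n / 2) * (l / cos_mass n * (LINT z|torus. P z) + (LINT z|torus. S z) / l)"
    using Pint Sint by simp
  also have "\<dots> \<le> (real n / 2) * (l / cos_mass n * (cos_mass n / real n) + (28 * real n powr (- \<gamma>)) / l)"
    using l cos_mass_pos[of n] Pval Sval by (intro mult_left_mono add_mono divide_right_mono) auto
  also have "\<dots> = l / 2 + 14 * (real n * real n powr (- \<gamma>) / l)"
    using n cos_mass_pos[of n] by (simp add: field_simps)
  also have "real n * real n powr (- \<gamma>) / l = l"
  proof -
    have "real n * real n powr (- \<gamma>) = real n powr (1 - \<gamma>)"
      using n powr_add[of "real n" 1 "- \<gamma>"] by simp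
    also have "\<dots> = l * l" using n by (simp add: l_def flip: powr_add)
    finally show ?thesis using l by simp
  qed
  finally have "(LINT z|torus. \<bar>kernel_grad n z $ i\<bar> * cos_gap z powr (\<gamma> / 2)) \<le> l / 2 + 14 * l" .
  then show ?thesis using l unfolding l_def[symmetric] by linarith
qed

lemma integral_kernel_grad:
  assumes n: "n \<ge> 1" and \<gamma>: "0 < \<gamma>" "\<gamma> \<le> 2"
  shows "integrable torus (\<lambda>z. norm (kernel_grad n z) * cos_gap z powr (\<gamma> / 2))"
    and "(LINT z|torus. norm (kernel_grad n z) * cos_gap z powr (\<gamma> / 2)) \<le> 45 * real n powr ((1 - \<gamma>) / 2)"
proof -
  obtain C D where C: "\<And>z. norm (kernel_grad n z) \<le> C" and D: "\<And>z. \<bar>cos_gap z\<bar> \<le> D"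
    using trig_pair_properties(7)[OF trig_pair_kernel] trig_properties(4)[OF trig_cos_gap] by meson
  have X: "cos_gap z powr (\<gamma> / 2) \<le> D powr (\<gamma> / 2)" for z
    using D[of z] cos_gap_nonneg[of z] \<gamma> by (intro powr_mono2) auto
  have "0 \<le> C" using C[of 0] norm_ge_zero order_trans by blast
  show int: "integrable torus (\<lambda>z. norm (kernel_grad n z) * cos_gap z powr (\<gamma> / 2))"
    by (rule torus_integrable_bounded[of _ "C * D powr (\<gamma> / 2)"])
       (use X C \<open>0 \<le> C\<close> in \<open>auto simp: abs_mult intro!: mult_mono\<close>)
  have inti: "integrable torus (\<lambda>z. \<bar>kernel_grad n z $ i\<bar> * cos_gap z powr (\<gamma> / 2))" for i
    by (rule torus_integrable_bounded[of _ "C * D powr (\<gamma> / 2)"])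
       (use X order_trans[OF component_le_norm_cart C] \<open>0 \<le> C\<close> in \<open>auto simp: abs_mult intro!: mult_mono\<close>)
  have "(LINT z|torus. norm (kernel_grad n z) * cos_gap z powr (\<gamma> / 2))
     \<le> (LINT z|torus. (\<Sum>i\<in>UNIV. \<bar>kernel_grad n z $ i\<bar> * cos_gap z powr (\<gamma> / 2)))"
  proof (rule integral_mono[OF int])
    show "integrable torus (\<lambda>z. \<Sum>i\<in>UNIV. \<bar>kernel_grad n z $ i\<bar> * cos_gap z powr (\<gamma> / 2))"
      using inti by simp
    show "norm (kernel_grad n z) * cos_gap z powr (\<gamma> / 2)
        \<le> (\<Sum>i\<in>UNIV. \<bar>kernel_grad n z $ i\<bar> * cos_gap z powr (\<gamma> / 2))" for z
      by (auto simp flip: sum_distrib_right intro!: mult_right_mono norm_le_l1_cart)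
  qed
  also have "\<dots> = (\<Sum>i\<in>UNIV. LINT z|torus. \<bar>kernel_grad n z $ i\<bar> * cos_gap z powr (\<gamma> / 2))"
    using inti by (intro Bochner_Integration.integral_sum) auto
  also have "\<dots> \<le> (\<Sum>i\<in>(UNIV :: 3 set). 15 * real n powr ((1 - \<gamma>) / 2))"
    by (intro sum_mono integral_kernel_grad_component[OF n \<gamma>])
  also have "\<dots> = 45 * real n powr ((1 - \<gamma>) / 2)" by simp
  finally show "(LINT z|torus. norm (kernel_grad n z) * cos_gap z powr (\<gamma> / 2)) \<le> 45 * real n powr ((1 - \<gamma>) / 2)" .
qed

text \<open>
  Up to \<open>pi / 3\<close> the sine has slope at least \<open>1 / 2\<close>, and beyond it is at least \<open>sqrt 3 / 2 > pi / 4\<close>.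
\<close>

lemma sin_ge_half: 
  assumes "0 \<le> x" "x \<le> pi / 2" shows "x / 2 \<le> sin x"
proof (cases "x \<le> pi / 3")
  case True
  have "sin 0 - 0 / 2 \<le> sin x - x / 2"
  proof (rule DERIV_nonneg_imp_nondecreasing[OF assms(1), of "\<lambda>x. sin x - x / 2"])
    fix t assume t: "0 \<le> t" "t \<le> x"
    have "cos (pi / 3) \<le> cos t" using t True by (intro cos_monotone_0_pi_le) auto
    then have "0 \<le> cos t - 1 / 2" by (simp add: cos_60)
    then show "\<exists>y. ((\<lambda>x. sin x - x / 2) has_real_derivative y) (at t) \<and> 0 \<le> y"
      by (intro exI[of _ "cos t - 1 / 2"]) (auto intro!: derivative_eq_intros)
  qed
  then show ?thesis by simp
next
  case False
  have "sin (pi / 3) \<le> sin x" using False assms by (intro sin_monotone_2pi_le) auto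
  moreover have "x / 2 \<le> sqrt 3 / 2"
  proof -
    have "pi / 2 < 1.65" using pi_approx by simp
    moreover have "(1.65::real) \<le> sqrt 3" by (rule real_le_rsqrt) (simp add: power2_eq_square)
    ultimately show ?thesis using assms by simp
  qed
  ultimately show ?thesis by (simp add: sin_60)
qed

lemma square_le_one_minus_cos:
  assumes "\<bar>y\<bar> \<le> pi" shows "y\<^sup>2 \<le> 8 * (1 - cos y)"
proof -
  have "(\<bar>y\<bar> / 2) / 2 \<le> sin (\<bar>y\<bar> / 2)" using assms by (intro sin_ge_half) auto
  then have "((\<bar>y\<bar> / 2) / 2)\<^sup>2 \<le> (sin (\<bar>y\<bar> / 2))\<^sup>2" by (intro power_mono) auto
  moreover have "1 - cos y = 2 * (sin (\<bar>y\<bar> / 2))\<^sup>2"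
    using cos_double_sin[of "\<bar>y\<bar> / 2"] by simp
  ultimately show ?thesis by (simp add: power_divide)
qed

text \<open>
  The period vector moves every coordinate into \<open>[- pi, pi]\<close>.
\<close>

lemma norm_shift_le_cos_gap: "\<exists>m. (norm (z + period_vector m))\<^sup>2 \<le> 8 * cos_gap z"
proof -
  define m :: "int ^ 3" where "m = (\<chi> i. - \<lfloor>(z $ i + pi) / (2 * pi)\<rfloor>)"
  define y where "y = z + period_vector m"
  have y: "\<bar>y $ i\<bar> \<le> pi" for i
  proof -
    define w where "w = (of_int \<lfloor>(z $ i + pi) / (2 * pi)\<rfloor> :: real)"
    have "w \<le> (z $ i + pi) / (2 * pi)" "(z $ i + pi) / (2 * pi) < w + 1"
      unfolding w_def by linarith+
    then have "w * (2 * pi) \<le> z $ i + pi" "z $ i + pi < (w + 1) * (2 * pi)"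
      by (simp_all add: pos_le_divide_eq pos_divide_less_eq)
    moreover have "y $ i = z $ i - w * (2 * pi)"
      by (simp add: y_def m_def period_vector_def w_def)
    ultimately show ?thesis by (simp add: abs_le_iff algebra_simps)
  qed
  have "(norm y)\<^sup>2 = (\<Sum>i\<in>UNIV. (y $ i)\<^sup>2)"
    by (simp add: norm_vec_def L2_set_def sum_nonneg)
  also have "\<dots> \<le> (\<Sum>i\<in>UNIV. 8 * (1 - cos (y $ i)))"
    using y square_le_one_minus_cos by (intro sum_mono) auto
  also have "\<dots> = 8 * cos_gap y" by (simp add: cos_gap_def sum_distrib_left)
  also have "cos_gap y = cos_gap z"
    unfolding y_def by (rule torus_periodic_shift) (rule trig_properties[OF trig_cos_gap])
  finally show ?thesis unfolding y_def by blast
qed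

section \<open>Double integrals over the torus\<close>

interpretation torus2: pair_sigma_finite torus torus ..

abbreviation torus2 :: "(R3 \<times> R3) measure" where "torus2 \<equiv> torus \<Otimes>\<^sub>M torus"

lemma torus2_measurable: "f \<in> borel_measurable borel \<Longrightarrow> f \<in> borel_measurable torus2"
proof -
  assume f: "f \<in> borel_measurable (borel :: (R3 \<times> R3) measure)"
  have "(\<lambda>p. (fst p, snd p)) \<in> measurable torus2 (borel \<Otimes>\<^sub>M borel)"
    by (intro measurable_Pair measurable_compose[OF measurable_fst measurable_torus_ident]
        measurable_compose[OF measurable_snd measurable_torus_ident])
  then have "(\<lambda>p. p) \<in> measurable torus2 borel" by (simp add: borel_prod)
  from measurable_compose[OF this f] show ?thesis .
qed

lemma torus2_measurable_fst: "f \<in> borel_measurable torus \<Longrightarrow> (\<lambda>p. f (fst p)) \<in> borel_measurable torus2"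
  by (rule measurable_compose[OF measurable_fst])

lemma torus2_integrable_fst:
  fixes f :: "R3 \<Rightarrow> 'b::{banach, second_countable_topology}"
  assumes "integrable torus f" shows "integrable torus2 (\<lambda>p. f (fst p))"
proof (rule integrableI_bounded)
  show "(\<lambda>p. f (fst p)) \<in> borel_measurable torus2" using assms by (intro torus2_measurable_fst) auto
  have "(\<integral>\<^sup>+p. ennreal (norm (f (fst p))) \<partial>torus2) = (\<integral>\<^sup>+x. \<integral>\<^sup>+y. ennreal (norm (f x)) \<partial>torus \<partial>torus)"
    using assms by (subst torus.nn_integral_fst[symmetric]) (auto intro: measurable_compose[OF measurable_fst])
  also have "\<dots> = (\<integral>\<^sup>+x. ennreal (norm (f x)) \<partial>torus) * emeasure torus (space torus)"
    using assms by (simp add: nn_integral_multc)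
  also have "\<dots> < \<infinity>"
  proof -
    have "emeasure torus period_cube < top"
      using torus.emeasure_finite[of period_cube] by (simp add: less_top[symmetric])
    then show ?thesis using assms by (simp add: integrable_iff_bounded ennreal_mult_less_top)
  qed
  finally show "(\<integral>\<^sup>+p. ennreal (norm (f (fst p))) \<partial>torus2) < \<infinity>" .
qed

lemma torus2_integrable_snd:
  fixes f :: "R3 \<Rightarrow> 'b::{banach, second_countable_topology}"
  assumes "integrable torus f" shows "integrable torus2 (\<lambda>p. f (snd p))"
  using torus2.integrable_product_swap[OF torus2_integrable_fst[OF assms]] by (simp add: case_prod_beta')

lemma torus2_integral_swap:
  fixes f :: "R3 \<times> R3 \<Rightarrow> 'b::{banach, second_countable_topology}"
  assumes "f \<in> borel_measurable torus2"
  shows "(LINT p|torus2. f (snd p, fst p)) = (LINT p|torus2. f p)"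
  using torus2.integral_product_swap[OF assms] by (simp add: case_prod_beta')

text \<open>
  For fixed \<open>y\<close> the substitution \<open>x = z + y\<close> is a translation of the torus.
\<close>

lemma torus2_nn_integral_shift:
  fixes H :: "R3 \<times> R3 \<Rightarrow> ennreal"
  assumes [measurable]: "H \<in> borel_measurable borel" and per: "\<And>y. torus_periodic (\<lambda>x. H (x, y))"
  shows "(\<integral>\<^sup>+p. H p \<partial>torus2) = (\<integral>\<^sup>+z. \<integral>\<^sup>+y. H (z + y, y) \<partial>torus \<partial>torus)"
proof -
  have "(\<integral>\<^sup>+p. H p \<partial>torus2) = (\<integral>\<^sup>+y. \<integral>\<^sup>+x. H (x, y) \<partial>torus \<partial>torus)"
    by (rule torus2.nn_integral_snd[symmetric]) (rule torus2_measurable, fact)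
  also have "\<dots> = (\<integral>\<^sup>+y. \<integral>\<^sup>+x. H (x + y, y) \<partial>torus \<partial>torus)"
  proof (rule nn_integral_cong)
    fix y
    have [measurable]: "(\<lambda>x. H (x, y)) \<in> borel_measurable borel"
      by (rule measurable_compose[OF _ assms(1)]) (simp add: borel_prod[symmetric])
    show "(\<integral>\<^sup>+x. H (x, y) \<partial>torus) = (\<integral>\<^sup>+x. H (x + y, y) \<partial>torus)"
      unfolding nn_integral_torus using nn_integral_fundamental_shift[OF _ per, of y y] by simp
  qed
  also have "\<dots> = (\<integral>\<^sup>+z. \<integral>\<^sup>+y. H (z + y, y) \<partial>torus \<partial>torus)"
  proof (rule torus2.Fubini')
    have "(\<lambda>p. (fst p + snd p, snd p)) \<in> borel_measurable (borel :: (R3 \<times> R3) measure)"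
      by (intro borel_measurable_Pair) (auto simp: borel_prod[symmetric])
    from measurable_compose[OF this assms(1)]
    show "(\<lambda>(x, y). H (x + y, y)) \<in> borel_measurable torus2"
      using torus2_measurable by (simp add: case_prod_beta')
  qed
  finally show ?thesis .
qed

lemma borel_fst_snd [measurable]:
  "fst \<in> borel_measurable (borel :: ('a::second_countable_topology \<times> 'b::second_countable_topology) measure)"
  "snd \<in> borel_measurable (borel :: ('a::second_countable_topology \<times> 'b::second_countable_topology) measure)"
  by (simp_all flip: borel_prod)

text \<open>
  A double integral that depends on \<open>x - y\<close> and on the increment from \<open>y\<close> to \<open>x\<close> is an average, with
  weight \<open>k z\<close>, of integrals of increments by the fixed vector \<open>z\<close>.
\<close>

lemma torus2_increment_bound:
  fixes k m :: "R3 \<Rightarrow> real" and \<Phi> :: "R3 \<Rightarrow> real" and u :: "R3 \<Rightarrow> R3"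
  assumes [measurable]: "k \<in> borel_measurable borel" "\<Phi> \<in> borel_measurable borel" "u \<in> borel_measurable borel"
    and per: "torus_periodic k" "torus_periodic u"
    and nonneg: "\<And>z. 0 \<le> k z" "\<And>z. 0 \<le> \<Phi> z"
    and int: "\<And>z. integrable torus (\<lambda>y. \<Phi> (u (z + y) - u y))"
    and le: "\<And>z. (LINT y|torus. \<Phi> (u (z + y) - u y)) \<le> m z"
    and km: "integrable torus (\<lambda>z. k z * m z)"
  shows "integrable torus2 (\<lambda>p. k (fst p - snd p) * \<Phi> (u (fst p) - u (snd p)))" (is "integrable _ ?f")
    and "(LINT p|torus2. k (fst p - snd p) * \<Phi> (u (fst p) - u (snd p))) \<le> (LINT z|torus. k z * m z)"
proof -
  have fm: "?f \<in> borel_measurable borel" by measurable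
  have m0: "0 \<le> m z" for z
    using order_trans[OF _ le[of z], of 0] nonneg by (auto intro: Bochner_Integration.integral_nonneg)
  have "(\<integral>\<^sup>+p. ennreal (?f p) \<partial>torus2)
      = (\<integral>\<^sup>+z. \<integral>\<^sup>+y. ennreal (k (z + y - y) * \<Phi> (u (z + y) - u y)) \<partial>torus \<partial>torus)"
  proof (subst torus2_nn_integral_shift)
    have "k (x + w - y) = k (x - y)" if "\<And>x. k (x + w) = k x" for x y w
      using that[of "x - y"] by (simp add: algebra_simps)
    then show "torus_periodic (\<lambda>x. ennreal (?f (x, y)))" for y
      using per by (simp add: torus_periodic_def)
  qed (use fm in auto)
  also have "\<dots> \<le> (\<integral>\<^sup>+z. ennreal (k z * m z) \<partial>torus)"
  proof (rule nn_integral_mono)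
    fix z
    have "(\<integral>\<^sup>+y. ennreal (k (z + y - y) * \<Phi> (u (z + y) - u y)) \<partial>torus)
        = ennreal (LINT y|torus. k z * \<Phi> (u (z + y) - u y))"
      using int nonneg by (subst nn_integral_eq_integral) auto
    also have "\<dots> \<le> ennreal (k z * m z)"
      using nonneg le by (intro ennreal_leI) (auto intro: mult_left_mono)
    finally show "(\<integral>\<^sup>+y. ennreal (k (z + y - y) * \<Phi> (u (z + y) - u y)) \<partial>torus) \<le> ennreal (k z * m z)" .
  qed
  also have "\<dots> = ennreal (LINT z|torus. k z * m z)"
    using km m0 nonneg by (intro nn_integral_eq_integral) auto
  finally have *: "(\<integral>\<^sup>+p. ennreal (?f p) \<partial>torus2) \<le> ennreal (LINT z|torus. k z * m z)" .
  have f0: "0 \<le> ?f p" for p using nonneg by simp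
  show int: "integrable torus2 ?f"
  proof (intro integrableI_bounded torus2_measurable fm)
    show "(\<integral>\<^sup>+p. ennreal (norm (?f p)) \<partial>torus2) < \<infinity>"
      using le_less_trans[OF *] f0 by (simp add: abs_of_nonneg del: abs_mult)
  qed
  have "ennreal (LINT p|torus2. ?f p) \<le> ennreal (LINT z|torus. k z * m z)"
    using * nn_integral_eq_integral[OF int] f0 by simp
  then show "(LINT p|torus2. ?f p) \<le> (LINT z|torus. k z * m z)"
    using m0 nonneg by (subst (asm) ennreal_le_iff) (auto intro: Bochner_Integration.integral_nonneg)
qed

lemma torus2_integral_kernel_marginal:
  fixes g :: "R3 \<Rightarrow> real"
  assumes k: "trig k" and g: "integrable torus g"
  shows "integrable torus2 (\<lambda>p. k (fst p - snd p) * g (fst p))" (is ?i1)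
    and "integrable torus2 (\<lambda>p. k (fst p - snd p) * g (snd p))" (is ?i2)
    and "(LINT p|torus2. k (fst p - snd p) * g (fst p)) = (LINT z|torus. k z) * (LINT x|torus. g x)" (is ?e1)
    and "(LINT p|torus2. k (fst p - snd p) * g (snd p)) = (LINT z|torus. k z) * (LINT x|torus. g x)" (is ?e2)
proof -
  note kp = trig_properties[OF k]
  have [measurable]: "k \<in> borel_measurable borel" by (rule kp(2))
  obtain C where C: "\<And>z. \<bar>k z\<bar> \<le> C" using kp(4) by blast
  have C': "\<bar>k z\<bar> \<le> \<bar>C\<bar>" for z using C[of z] by simp
  have even: "k (- z) = k z" for z using k trig_pair_properties(3) by (auto simp: trig_def)
  have even': "k (snd p - fst p) = k (fst p - snd p)" for p :: "R3 \<times> R3"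
    using even[of "fst p - snd p"] by simp
  have km: "(\<lambda>p. k (fst p - snd p)) \<in> borel_measurable torus2"
    by (rule torus2_measurable) measurable
  show i1: ?i1
    by (rule Bochner_Integration.integrable_bound[OF integrable_mult_right[OF torus2_integrable_fst[OF g], of C]])
       (use km g C' in \<open>auto intro!: borel_measurable_times torus2_measurable_fst mult_right_mono simp: abs_mult\<close>)
  show i2: ?i2
    using torus2.integrable_product_swap[OF i1] by (simp add: case_prod_beta' even')
  have "(LINT p|torus2. k (fst p - snd p) * g (fst p)) = (LINT x|torus. LINT y|torus. k (x - y) * g x)"
    using torus2.integral_fst'[OF i1] by simp
  also have "\<dots> = (LINT x|torus. (LINT z|torus. k z) * g x)"
  proof (rule Bochner_Integration.integral_cong[OF refl])
    fix x
    have "(LINT y|torus. k (x - y)) = (LINT y|torus. k (y + (- x)))"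
      using even[of "x - _"] by simp
    also have "\<dots> = (LINT z|torus. k z)" by (rule torus_integral_shift(1)[OF kp(2,1)])
    finally show "(LINT y|torus. k (x - y) * g x) = (LINT z|torus. k z) * g x" by simp
  qed
  finally show e1: ?e1 by simp
  show ?e2
    using torus2_integral_swap[OF borel_measurable_integrable[OF i1]] e1 by (simp add: even')
qed

definition L2_field :: "(R3 \<Rightarrow> R3) \<Rightarrow> bool" where
  "L2_field f \<longleftrightarrow> f \<in> borel_measurable borel \<and> torus_periodic f \<and> integrable torus (\<lambda>x. (norm (f x))\<^sup>2)"

text \<open>
  The pairing in \<open>L\<^sup>2\<close> of \<open>f\<close> with its convolution with the even kernel \<open>k\<close>.
\<close>

definition quad :: "(R3 \<Rightarrow> real) \<Rightarrow> (R3 \<Rightarrow> R3) \<Rightarrow> real" where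
  "quad k f = (LINT p|torus2. k (fst p - snd p) * (f (fst p) \<bullet> f (snd p)))"

text \<open>
  For a kernel of mass 1 this is twice the difference between the squared norm and \<open>quad\<close>.  Unlike that
  difference it is visibly nonnegative when \<open>k\<close> is, and it is controlled by increments.
\<close>

definition defect :: "(R3 \<Rightarrow> real) \<Rightarrow> (R3 \<Rightarrow> R3) \<Rightarrow> real" where
  "defect k f = (LINT p|torus2. k (fst p - snd p) * (norm (f (fst p) - f (snd p)))\<^sup>2)"

text \<open>
  Expanding the square in the defect leaves, besides \<open>quad\<close>, two terms in which the kernel can be
  integrated out.
\<close>

lemma L2_field_quad:
  assumes k: "trig k" and f: "L2_field f"
  shows "integrable torus2 (\<lambda>p. k (fst p - snd p) * (f (fst p) \<bullet> f (snd p)))" (is ?i1)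
    and "integrable torus2 (\<lambda>p. k (fst p - snd p) * (norm (f (fst p) - f (snd p)))\<^sup>2)" (is ?i2)
    and "defect k f = 2 * (LINT z|torus. k z) * (LINT x|torus. (norm (f x))\<^sup>2) - 2 * quad k f" (is ?e)
proof -
  have [measurable]: "k \<in> borel_measurable borel" by (rule trig_properties(2)[OF k])
  have [measurable]: "f \<in> borel_measurable borel" and fi: "integrable torus (\<lambda>x. (norm (f x))\<^sup>2)"
    using f by (auto simp: L2_field_def)
  note m = torus2_integral_kernel_marginal[OF k fi]
  show i1: ?i1
  proof (rule Bochner_Integration.integrable_bound[OF Bochner_Integration.integrable_add[OF integrable_norm[OF m(1)] integrable_norm[OF m(2)]]])
    show "(\<lambda>p. k (fst p - snd p) * (f (fst p) \<bullet> f (snd p))) \<in> borel_measurable torus2"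
      by (rule torus2_measurable) measurable
    have "\<bar>a \<bullet> b\<bar> \<le> (norm a)\<^sup>2 + (norm b)\<^sup>2" for a b :: R3
    proof -
      have "\<bar>a \<bullet> b\<bar> \<le> norm a * norm b" by (rule Cauchy_Schwarz_ineq2)
      also have "\<dots> \<le> (norm a)\<^sup>2 + (norm b)\<^sup>2"
        using sum_squares_bound[of "norm a" "norm b"] mult_nonneg_nonneg[OF norm_ge_zero[of a] norm_ge_zero[of b]]
        by linarith
      finally show ?thesis .
    qed
    then show "AE p in torus2. norm (k (fst p - snd p) * (f (fst p) \<bullet> f (snd p)))
        \<le> norm (norm (k (fst p - snd p) * (norm (f (fst p)))\<^sup>2) + norm (k (fst p - snd p) * (norm (f (snd p)))\<^sup>2))"
      by (auto simp: abs_mult mult_left_mono simp flip: distrib_left)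
  qed
  have eq: "k (fst p - snd p) * (norm (f (fst p) - f (snd p)))\<^sup>2
     = k (fst p - snd p) * (norm (f (fst p)))\<^sup>2 + k (fst p - snd p) * (norm (f (snd p)))\<^sup>2
       - 2 * (k (fst p - snd p) * (f (fst p) \<bullet> f (snd p)))" for p
    by (simp add: power2_norm_eq_inner inner_diff_left inner_diff_right inner_commute algebra_simps)
  show ?i2 unfolding eq using m(1,2) i1 by simp
  show ?e unfolding defect_def eq quad_def using m i1 by simp
qed

section \<open>Smooth periodic fields\<close>

lemma periodic_continuous_bounded:
  fixes f :: "R3 \<Rightarrow> 'b::real_normed_vector"
  assumes "continuous_on UNIV f" "torus_periodic f"
  obtains C where "0 \<le> C" "\<And>x. norm (f x) \<le> C"
proof -
  have "bounded (f ` period_cube)"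
    by (intro compact_imp_bounded compact_continuous_image continuous_on_subset[OF assms(1)]) auto
  then obtain C where C: "\<And>x. x \<in> period_cube \<Longrightarrow> norm (f x) \<le> C"
    by (auto simp: bounded_iff)
  have "norm (f x) \<le> C" for x
  proof -
    have "wrap x \<in> period_cube"
      using wrap_mem[of x] by (auto simp: fundamental_cube_def mem_box_cart less_imp_le)
    then show ?thesis using C torus_periodic_wrap[OF assms(2), of x] by metis
  qed
  moreover have "0 \<le> C" using C[of 0] norm_ge_zero[of "f 0"] calculation order_trans by blast
  ultimately show ?thesis using that by blast
qed

locale smooth_field =
  fixes \<psi> :: "R3 \<Rightarrow> R3"
  assumes smooth: "smooth \<psi>" and periodic: "torus_periodic \<psi>"
begin

lemma derivative: "(\<psi> has_derivative frechet_derivative \<psi> (at x)) (at x)"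
  using smooth C_k_Suc_has_derivative[of 0 \<psi>] unfolding smooth_def by blast

lemma continuous: "continuous_on UNIV \<psi>"
  using smooth unfolding smooth_def by (metis C_k.simps(1))

lemma continuous_derivative: "continuous_on UNIV (\<lambda>x. frechet_derivative \<psi> (at x) h)"
proof -
  have "C_k (Suc 0) \<psi>" using smooth unfolding smooth_def by blast
  then show ?thesis by simp
qed

lemma periodic_derivative: "torus_periodic (\<lambda>x. frechet_derivative \<psi> (at x) h)"
  unfolding torus_periodic_def
proof (intro allI)
  fix x i
  let ?e = "(2 * pi) *\<^sub>R axis i 1 :: R3"
  have "((\<lambda>y. \<psi> (y + ?e)) has_derivative frechet_derivative \<psi> (at (x + ?e))) (at x)"
    by (rule has_derivative_compose[of "\<lambda>y. y + ?e" "\<lambda>h. h" x UNIV, OF _ derivative])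
       (auto intro!: derivative_eq_intros)
  moreover have "(\<lambda>y. \<psi> (y + ?e)) = \<psi>" using periodic by (auto simp: torus_periodic_def)
  ultimately have "(\<psi> has_derivative frechet_derivative \<psi> (at (x + ?e))) (at x)" by simp
  from has_derivative_unique[OF this derivative]
  show "frechet_derivative \<psi> (at (x + ?e)) h = frechet_derivative \<psi> (at x) h" by simp
qed

lemma L2_field: "L2_field \<psi>"
proof -
  obtain C where C: "\<And>x. norm (\<psi> x) \<le> C" using periodic_continuous_bounded[OF continuous periodic] by blast
  have [measurable]: "\<psi> \<in> borel_measurable borel" using continuous by (rule borel_measurable_continuous_onI)
  have "integrable torus (\<lambda>x. (norm (\<psi> x))\<^sup>2)"
    by (rule torus_integrable_bounded[of _ "C\<^sup>2"]) (use C in \<open>auto intro: power_mono\<close>)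
  then show ?thesis using periodic by (simp add: L2_field_def)
qed

lemma Lipschitz: obtains C where "0 \<le> C" "\<And>x y. norm (\<psi> x - \<psi> y) \<le> C * norm (x - y)"
proof -
  have "\<exists>C. 0 \<le> C \<and> (\<forall>x. norm (frechet_derivative \<psi> (at x) (axis i 1)) \<le> C)" for i
    using periodic_continuous_bounded[OF continuous_derivative periodic_derivative] by metis
  then obtain C where C: "\<And>i. 0 \<le> C i" "\<And>i x. norm (frechet_derivative \<psi> (at x) (axis i 1)) \<le> C i" by metis
  define B where "B = (\<Sum>i\<in>UNIV. C i)"
  have onorm: "norm (frechet_derivative \<psi> (at x) h) \<le> B * norm h" for x h
  proof -
    interpret D: bounded_linear "frechet_derivative \<psi> (at x)"
      using derivative has_derivative_bounded_linear by blast
    have "h = (\<Sum>i\<in>UNIV. h $ i *\<^sub>R axis i 1)"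
      by (simp add: vec_eq_iff axis_def if_distrib[of "\<lambda>z. _ * z"] cong: if_cong)
    then have "frechet_derivative \<psi> (at x) h = (\<Sum>i\<in>UNIV. h $ i *\<^sub>R frechet_derivative \<psi> (at x) (axis i 1))"
      by (metis (no_types, lifting) D.scaleR D.sum sum.cong)
    also have "norm \<dots> \<le> (\<Sum>i\<in>UNIV. norm h * C i)"
      using C by (intro sum_norm_le) (auto intro!: mult_mono component_le_norm_cart)
    finally show ?thesis by (simp add: B_def sum_distrib_left mult.commute)
  qed
  have "norm (\<psi> x - \<psi> y) \<le> B * norm (x - y)" for x y
    by (rule differentiable_bound[of UNIV \<psi> "\<lambda>x. frechet_derivative \<psi> (at x)"])
       (use derivative onorm in \<open>auto intro!: onorm_le\<close>)
  moreover have "0 \<le> B" using C by (auto simp: B_def intro: sum_nonneg)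
  ultimately show ?thesis using that by blast
qed

text \<open>
  The divergence of the field \<open>sin (\<xi> \<bullet> x + \<theta>) *\<^sub>R \<psi> x\<close> has integral 0.
\<close>

lemma weak_div_free:
  assumes "div_free \<psi>"
  shows "(LINT x|torus. (\<psi> x \<bullet> frequency k) * cos (frequency k \<bullet> x + \<theta>)) = 0"
proof -
  let ?s = "\<lambda>x. sin (frequency k \<bullet> x + \<theta>)" and ?c = "\<lambda>x. cos (frequency k \<bullet> x + \<theta>)"
  define g' where "g' i x = partial i \<psi> x $ i * ?s x + \<psi> x $ i * (frequency k $ i * ?c x)" for i x
  have cont: "continuous_on UNIV (g' i)" for i
    unfolding g'_def partial_def[abs_def] by (intro continuous_intros continuous_derivative continuous)
  have per: "torus_periodic (g' i)" for i
    using periodic periodic_derivative cos_frequency_periodic[of k _ _ \<theta>]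
    by (simp add: g'_def[abs_def] torus_periodic_def partial_def)
  have 0: "(LINT x|torus. g' i x) = 0 \<and> integrable torus (g' i)" for i
  proof -
    define g where "g x = \<psi> x $ i * ?s x" for x
    have cg: "continuous_on UNIV g"
      unfolding g_def by (intro continuous_intros continuous)
    have pg: "torus_periodic g" using periodic cos_frequency_periodic[of k _ _ \<theta>]
      by (simp add: g_def[abs_def] torus_periodic_def)
    obtain C D where C: "\<And>x. norm (g x) \<le> C" and D: "\<And>x. norm (g' i x) \<le> D"
      using periodic_continuous_bounded[OF cg pg] periodic_continuous_bounded[OF cont per] by metis
    have "(LINT x|torus. g' i x) = 0"
    proof (rule torus_integral_derivative_zero[OF pg, of _ "max C D" "axis i 1"])
      show "\<bar>g x\<bar> \<le> max C D" for x using C[of x] by simp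
      show "\<bar>g' i x\<bar> \<le> max C D" for x using D[of x] by simp
      fix x
      have 1: "((\<lambda>s. x + s *\<^sub>R (axis i 1 :: R3)) has_vector_derivative (axis i 1 :: R3)) (at 0)"
        by (auto intro!: derivative_eq_intros)
      have 2: "((\<lambda>s. \<psi> (x + s *\<^sub>R (axis i 1 :: R3))) has_vector_derivative partial i \<psi> x) (at 0)"
        using vector_derivative_diff_chain_within[of "\<lambda>s. x + s *\<^sub>R (axis i 1 :: R3)" "axis i 1 :: R3" 0 UNIV \<psi> "frechet_derivative \<psi> (at x)"]
          1 derivative[of x] by (auto simp: o_def partial_def has_derivative_at_withinI)
      have 3: "((\<lambda>s. \<psi> (x + s *\<^sub>R (axis i 1 :: R3)) $ i) has_real_derivative partial i \<psi> x $ i) (at 0)"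
        using bounded_linear.has_vector_derivative[OF bounded_linear_vec_nth 2]
        by (simp add: has_real_derivative_iff_has_vector_derivative)
      have 4: "((\<lambda>s. ?s (x + s *\<^sub>R (axis i 1 :: R3))) has_real_derivative frequency k $ i * ?c x) (at 0)"
        by (auto intro!: derivative_eq_intros simp: inner_add_right inner_axis)
      show "((\<lambda>s. g (x + s *\<^sub>R (axis i 1 :: R3))) has_real_derivative g' i x) (at 0)"
        unfolding g_def g'_def
        by (rule DERIV_cong[OF DERIV_mult[OF 3 4]]) (simp add: algebra_simps)
    qed (use cg cont in \<open>auto intro: borel_measurable_continuous_onI\<close>)
    moreover have "integrable torus (g' i)"
      by (rule torus_integrable_bounded[OF borel_measurable_continuous_onI[OF cont] D])
    ultimately show ?thesis by simp
  qed
  have "(\<Sum>i\<in>UNIV. g' i x) = (\<psi> x \<bullet> frequency k) * ?c x" for x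
  proof -
    have "(\<Sum>i\<in>UNIV. g' i x) = (\<Sum>i\<in>UNIV. partial i \<psi> x $ i) * ?s x + (\<psi> x \<bullet> frequency k) * ?c x"
      by (simp add: g'_def inner_vec_def sum.distrib sum_distrib_right algebra_simps)
    then show ?thesis using assms by (simp add: div_free_def)
  qed
  then have "(LINT x|torus. (\<psi> x \<bullet> frequency k) * ?c x) = (LINT x|torus. (\<Sum>i\<in>UNIV. g' i x))" by simp
  also have "\<dots> = 0" using 0 by simp
  finally show ?thesis .
qed

text \<open>
  The squared increments are at most a multiple of \<open>cos_gap\<close>, whose mean under the kernel is of order
  \<open>1 / n\<close>.
\<close>

lemma defect_tendsto_0: "(\<lambda>n. defect (kernel n) \<psi>) \<longlonglongrightarrow> 0"
proof -
  obtain C where C: "0 \<le> C" "\<And>x y. norm (\<psi> x - \<psi> y) \<le> C * norm (x - y)" using Lipschitz by blast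
  define V where "V = measure torus period_cube"
  have inc: "(norm (\<psi> (z + y) - \<psi> y))\<^sup>2 \<le> 8 * C\<^sup>2 * cos_gap z" for z y
  proof -
    obtain m where m: "(norm (z + period_vector m))\<^sup>2 \<le> 8 * cos_gap z" using norm_shift_le_cos_gap by blast
    have "\<psi> (z + y) - \<psi> y = \<psi> (z + y + period_vector m) - \<psi> y" by (simp add: torus_periodic_shift[OF periodic])
    then have "norm (\<psi> (z + y) - \<psi> y) \<le> C * norm (z + period_vector m)"
      using C(2)[of "z + y + period_vector m" y] by (simp add: algebra_simps)
    then have "(norm (\<psi> (z + y) - \<psi> y))\<^sup>2 \<le> (C * norm (z + period_vector m))\<^sup>2" by (intro power_mono) auto
    also have "\<dots> \<le> C\<^sup>2 * (8 * cos_gap z)" using m by (simp add: power_mult_distrib mult_left_mono)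
    finally show ?thesis by simp
  qed
  have [measurable]: "\<psi> \<in> borel_measurable borel" using continuous by (rule borel_measurable_continuous_onI)
  have up: "defect (kernel n) \<psi> \<le> 8 * C\<^sup>2 * V * (3 / real (n + 1))" for n
  proof -
    have int: "integrable torus (\<lambda>y. (norm (\<psi> (z + y) - \<psi> y))\<^sup>2)" for z
      by (rule torus_integrable_bounded[of _ "8 * C\<^sup>2 * cos_gap z"]) (use inc in auto)
    have "(LINT y|torus. (norm (\<psi> (z + y) - \<psi> y))\<^sup>2) \<le> (LINT y|torus. 8 * C\<^sup>2 * cos_gap z)" for z
      using int inc by (intro integral_mono) auto
    then have le: "(LINT y|torus. (norm (\<psi> (z + y) - \<psi> y))\<^sup>2) \<le> 8 * C\<^sup>2 * V * cos_gap z" for z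
      by (simp add: V_def mult_ac)
    have kint: "integrable torus (\<lambda>z. kernel n z * cos_gap z)"
      by (intro trig_properties(3) trig_mult trig_kernel trig_cos_gap)
    have "defect (kernel n) \<psi> \<le> (LINT z|torus. kernel n z * (8 * C\<^sup>2 * V * cos_gap z))"
      unfolding defect_def
      by (rule torus2_increment_bound(2)[of "kernel n" "\<lambda>w. (norm w)\<^sup>2" \<psi> "\<lambda>z. 8 * C\<^sup>2 * V * cos_gap z"])
         (use int le periodic kint trig_properties(1)[OF trig_kernel] kernel_nonneg in
           \<open>auto simp: mult.left_commute[of "kernel n _"]\<close>)
    also have "\<dots> = 8 * C\<^sup>2 * V * (LINT z|torus. kernel n z * cos_gap z)"
      by (simp add: mult.left_commute[of "kernel n _"])
    finally show ?thesis by (simp add: integral_kernel_gap)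
  qed
  have lo: "0 \<le> defect (kernel n) \<psi>" for n
    unfolding defect_def using kernel_nonneg by (intro Bochner_Integration.integral_nonneg) auto
  have lim: "(\<lambda>n. 8 * C\<^sup>2 * V * (3 / real (n + 1))) \<longlonglongrightarrow> 0"
    by real_asymp
  show ?thesis
    by (rule tendsto_sandwich[OF always_eventually[OF allI[OF lo]] always_eventually[OF allI[OF up]] tendsto_const lim])
qed

end

section \<open>The space \<open>H\<close>\<close>

lemma norm_add_square_le: "(norm (a + b))\<^sup>2 \<le> 2 * (norm a)\<^sup>2 + 2 * (norm (b :: 'a :: real_inner))\<^sup>2"
proof -
  have "0 \<le> (norm (a - b))\<^sup>2" by simp
  then show ?thesis
    unfolding power2_norm_eq_inner inner_add_left inner_add_right inner_diff_left inner_diff_right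
    by (simp add: inner_commute)
qed

lemma norm_diff_square_le: "(norm (a - b))\<^sup>2 \<le> 2 * (norm a)\<^sup>2 + 2 * (norm (b :: 'a :: real_inner))\<^sup>2"
  using norm_add_square_le[of a "- b"] by simp

lemma L2_field_add: 
  assumes "L2_field f" "L2_field g" shows "L2_field (\<lambda>x. f x + g x)"
proof -
  have [measurable]: "f \<in> borel_measurable borel" "g \<in> borel_measurable borel"
    and int: "integrable torus (\<lambda>x. 2 * (norm (f x))\<^sup>2 + 2 * (norm (g x))\<^sup>2)"
    using assms by (auto simp: L2_field_def)
  have "integrable torus (\<lambda>x. (norm (f x + g x))\<^sup>2)"
    by (rule Bochner_Integration.integrable_bound[OF int])
       (auto intro: torus_measurable order_trans[OF norm_add_square_le])
  then show ?thesis using assms by (auto simp: L2_field_def torus_periodic_def)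
qed

lemma L2_field_uminus: "L2_field f \<Longrightarrow> L2_field (\<lambda>x. - f x)"
  by (auto simp: L2_field_def torus_periodic_def)

lemma L2_field_diff: "L2_field f \<Longrightarrow> L2_field g \<Longrightarrow> L2_field (\<lambda>x. f x - g x)"
  using L2_field_add[OF _ L2_field_uminus, of f g] by simp

lemma defect_nonneg: "(\<And>z. 0 \<le> k z) \<Longrightarrow> 0 \<le> defect k f"
  unfolding defect_def by (intro Bochner_Integration.integral_nonneg) auto

lemma defect_add_le:
  assumes k: "trig k" "\<And>z. 0 \<le> k z" and f: "L2_field f" and g: "L2_field g"
  shows "defect k (\<lambda>x. f x + g x) \<le> 2 * defect k f + 2 * defect k g"
proof -
  have "defect k (\<lambda>x. f x + g x)
    \<le> (LINT p|torus2. 2 * (k (fst p - snd p) * (norm (f (fst p) - f (snd p)))\<^sup>2)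
         + 2 * (k (fst p - snd p) * (norm (g (fst p) - g (snd p)))\<^sup>2))"
    unfolding defect_def
  proof (rule integral_mono[OF L2_field_quad(2)[OF k(1) L2_field_add[OF f g]]])
    show "k (fst p - snd p) * (norm (f (fst p) + g (fst p) - (f (snd p) + g (snd p))))\<^sup>2
     \<le> 2 * (k (fst p - snd p) * (norm (f (fst p) - f (snd p)))\<^sup>2)
         + 2 * (k (fst p - snd p) * (norm (g (fst p) - g (snd p)))\<^sup>2)" for p
      using mult_left_mono[OF norm_add_square_le k(2)[of "fst p - snd p"], of "f (fst p) - f (snd p)" "g (fst p) - g (snd p)"]
      by (simp add: algebra_simps)
  qed (use L2_field_quad(2)[OF k(1) f] L2_field_quad(2)[OF k(1) g] in simp)
  also have "\<dots> = 2 * defect k f + 2 * defect k g"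
    unfolding defect_def using L2_field_quad(2)[OF k(1) f] L2_field_quad(2)[OF k(1) g] by simp
  finally show ?thesis .
qed

lemma defect_uminus: "defect k (\<lambda>x. - f x) = defect k f"
  by (simp add: defect_def norm_minus_commute)

lemma defect_le_norm:
  assumes k: "trig k" "\<And>z. 0 \<le> k z" and f: "L2_field f"
  shows "defect k f \<le> 4 * (LINT z|torus. k z) * (LINT x|torus. (norm (f x))\<^sup>2)"
proof -
  have fi: "integrable torus (\<lambda>x. (norm (f x))\<^sup>2)" using f by (simp add: L2_field_def)
  note m = torus2_integral_kernel_marginal[OF k(1) fi]
  have "defect k f \<le> (LINT p|torus2. 2 * (k (fst p - snd p) * (norm (f (fst p)))\<^sup>2)
         + 2 * (k (fst p - snd p) * (norm (f (snd p)))\<^sup>2))"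
    unfolding defect_def
  proof (rule integral_mono[OF L2_field_quad(2)[OF k(1) f]])
    show "k (fst p - snd p) * (norm (f (fst p) - f (snd p)))\<^sup>2
     \<le> 2 * (k (fst p - snd p) * (norm (f (fst p)))\<^sup>2) + 2 * (k (fst p - snd p) * (norm (f (snd p)))\<^sup>2)" for p
      using mult_left_mono[OF norm_diff_square_le k(2)[of "fst p - snd p"], of "f (fst p)" "f (snd p)"]
      by (simp add: algebra_simps)
  qed (use m in simp)
  also have "\<dots> = 4 * (LINT z|torus. k z) * (LINT x|torus. (norm (f x))\<^sup>2)" using m by simp
  finally show ?thesis .
qed

definition H_field :: "(R3 \<Rightarrow> R3) \<Rightarrow> bool" where
  "H_field f \<longleftrightarrow> L2_field f \<and> (\<forall>\<epsilon>>0. \<exists>\<psi>. smooth \<psi> \<and> torus_periodic \<psi> \<and> div_free \<psi> \<and>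
     (LINT x|torus. (norm (f x - \<psi> x))\<^sup>2) < \<epsilon>)"

lemma powr_2_norm: "norm x powr 2 = (norm x)\<^sup>2"
  by (simp add: powr_numeral)

lemma Lp_norm_2: "Lp_norm 2 f = sqrt (LINT x|torus. (norm (f x))\<^sup>2)"
  by (simp add: Lp_norm_def powr_2_norm powr_half_sqrt Bochner_Integration.integral_nonneg)

lemma torus_integral_cong_AE:
  fixes f g :: "R3 \<Rightarrow> 'b::{banach, second_countable_topology}"
  assumes "f \<in> borel_measurable torus" "g \<in> borel_measurable torus" "AE x in torus. f x = g x"
  shows "(LINT x|torus. f x) = (LINT x|torus. g x)" "integrable torus f \<longleftrightarrow> integrable torus g"
  using integral_cong_AE[OF assms] integrable_cong_AE[OF assms] by auto

lemma H_space_imp_H_field: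
  assumes v: "v \<in> H_space" and g: "g \<in> borel_measurable borel" "torus_periodic g" and eq: "AE x in torus. v x = g x"
  shows "H_field g"
proof -
  have v2: "v \<in> Lp_torus 2" using v by (simp add: H_space_def)
  have [measurable]: "v \<in> borel_measurable torus" "g \<in> borel_measurable torus"
    using v2 torus_measurable[OF g(1)] by (auto simp: Lp_torus_def)
  have "integrable torus (\<lambda>x. (norm (v x))\<^sup>2)" using v2 by (simp add: Lp_torus_def powr_2_norm)
  moreover have "integrable torus (\<lambda>x. (norm (v x))\<^sup>2) \<longleftrightarrow> integrable torus (\<lambda>x. (norm (g x))\<^sup>2)"
    by (rule torus_integral_cong_AE(2)) (use eq in auto)
  ultimately have "L2_field g" using g by (simp add: L2_field_def)
  moreover have "\<exists>\<psi>. smooth \<psi> \<and> torus_periodic \<psi> \<and> div_free \<psi> \<and> (LINT x|torus. (norm (g x - \<psi> x))\<^sup>2) < \<epsilon>"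
    if "\<epsilon> > 0" for \<epsilon>
  proof -
    from v \<open>\<epsilon> > 0\<close> obtain \<psi> where \<psi>: "smooth \<psi>" "torus_periodic \<psi>" "div_free \<psi>" "Lp_norm 2 (\<lambda>x. v x - \<psi> x) < sqrt \<epsilon>"
      unfolding H_space_def by (auto dest!: spec[of _ "sqrt \<epsilon>"])
    interpret smooth_field \<psi> using \<psi> by unfold_locales
    have [measurable]: "\<psi> \<in> borel_measurable torus"
      using L2_field by (auto simp: L2_field_def intro: torus_measurable)
    have "(LINT x|torus. (norm (g x - \<psi> x))\<^sup>2) = (LINT x|torus. (norm (v x - \<psi> x))\<^sup>2)"
      by (rule torus_integral_cong_AE(1)) (use eq in auto)
    also have "\<dots> < \<epsilon>" using \<psi>(4) by (simp add: Lp_norm_2)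
    finally show ?thesis using \<psi> by blast
  qed
  ultimately show ?thesis by (simp add: H_field_def)
qed

lemma L2_field_integrable:
  assumes "L2_field f" shows "integrable torus f" 
proof -
  have [measurable]: "f \<in> borel_measurable torus" and i: "integrable torus (\<lambda>x. (norm (f x))\<^sup>2)"
    using assms by (auto simp: L2_field_def intro: torus_measurable)
  have "norm w \<le> 1 + (norm w)\<^sup>2" for w :: R3
    using sum_squares_bound[of 1 "norm w"] by (simp; smt (verit) norm_ge_zero)
  then show ?thesis
    by (intro Bochner_Integration.integrable_bound[OF Bochner_Integration.integrable_add[OF torus.integrable_const i, of 1]]) auto
qed

text \<open>
  The inequality between the means stands in for the Cauchy-Schwarz inequality: \<open>\<delta>\<close> bounds the \<open>L\<^sup>2\<close>
  norm.
\<close>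

lemma integral_norm_le:
  assumes f: "L2_field f" and "(LINT x|torus. (norm (f x))\<^sup>2) \<le> \<delta>\<^sup>2" "\<delta> > 0"
  shows "(LINT x|torus. norm (f x)) \<le> \<delta> * (measure torus period_cube + 1)"
proof -
  have i: "integrable torus (\<lambda>x. (norm (f x))\<^sup>2)" using f by (simp add: L2_field_def)
  have "norm (f x) \<le> \<delta> + (norm (f x))\<^sup>2 / \<delta>" for x
  proof -
    have "2 * (norm (f x) * \<delta>) \<le> \<delta>\<^sup>2 + (norm (f x))\<^sup>2"
      using sum_squares_bound[of \<delta> "norm (f x)"] by (simp add: mult_ac)
    moreover have "0 \<le> norm (f x) * \<delta>" using \<open>\<delta> > 0\<close> by simp
    ultimately have "norm (f x) * \<delta> \<le> \<delta>\<^sup>2 + (norm (f x))\<^sup>2" by linarith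
    then show ?thesis using \<open>\<delta> > 0\<close> by (simp add: field_simps power2_eq_square)
  qed
  then have "(LINT x|torus. norm (f x)) \<le> (LINT x|torus. \<delta> + (norm (f x))\<^sup>2 / \<delta>)"
    using i L2_field_integrable[OF f] by (intro integral_mono) auto
  also have "\<dots> = \<delta> * measure torus period_cube + (LINT x|torus. (norm (f x))\<^sup>2) / \<delta>"
    using i by (simp add: mult.commute)
  also have "\<dots> \<le> \<delta> * measure torus period_cube + \<delta>\<^sup>2 / \<delta>"
    using assms by (intro add_left_mono divide_right_mono) auto
  also have "\<dots> = \<delta> * (measure torus period_cube + 1)"
    using \<open>\<delta> > 0\<close> by (simp add: power2_eq_square algebra_simps)
  finally show ?thesis .
qed

text \<open>
  The left-hand side is continuous in \<open>L\<^sup>2\<close> and vanishes for smooth divergence-free fields.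
\<close>

lemma H_field_weak_div_free:
  assumes "H_field f"
  shows "(LINT x|torus. (f x \<bullet> frequency k) * cos (frequency k \<bullet> x + \<theta>)) = 0" (is "?I = 0")
proof -
  have f: "L2_field f" using assms by (simp add: H_field_def)
  have fm [measurable]: "f \<in> borel_measurable torus" using f by (auto simp: L2_field_def intro: torus_measurable)
  let ?c = "\<lambda>x. cos (frequency k \<bullet> x + \<theta>)"
  have cm [measurable]: "?c \<in> borel_measurable torus" by (rule torus_measurable) measurable
  have int: "integrable torus (\<lambda>x. (g x \<bullet> frequency k) * ?c x)"
    and le: "\<bar>LINT x|torus. (g x \<bullet> frequency k) * ?c x\<bar> \<le> norm (frequency k) * (LINT x|torus. norm (g x))"
    if g: "L2_field g" for g
  proof -
    have [measurable]: "g \<in> borel_measurable torus" using g by (auto simp: L2_field_def intro: torus_measurable)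
    have b: "\<bar>(g x \<bullet> frequency k) * ?c x\<bar> \<le> norm (frequency k) * norm (g x)" for x
    proof -
      have "\<bar>(g x \<bullet> frequency k) * ?c x\<bar> \<le> (norm (g x) * norm (frequency k)) * 1"
        unfolding abs_mult by (intro mult_mono Cauchy_Schwarz_ineq2) auto
      then show ?thesis by (simp add: mult.commute)
    qed
    have i: "integrable torus (\<lambda>x. norm (frequency k) * norm (g x))" using L2_field_integrable[OF g] by simp
    show int: "integrable torus (\<lambda>x. (g x \<bullet> frequency k) * ?c x)"
      by (rule Bochner_Integration.integrable_bound[OF i]) (use b in \<open>auto simp: abs_mult\<close>)
    have "\<bar>LINT x|torus. (g x \<bullet> frequency k) * ?c x\<bar> \<le> (LINT x|torus. norm (frequency k) * norm (g x))"
      by (rule order_trans[OF integral_abs_bound integral_mono]) (use int i b in auto)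
    then show "\<bar>LINT x|torus. (g x \<bullet> frequency k) * ?c x\<bar> \<le> norm (frequency k) * (LINT x|torus. norm (g x))"
      by simp
  qed
  have small: "\<bar>?I\<bar> \<le> (norm (frequency k) * (measure torus period_cube + 1)) * \<delta>" if \<delta>: "\<delta> > 0" for \<delta>
  proof -
    from assms \<delta> obtain \<psi> where \<psi>: "smooth \<psi>" "torus_periodic \<psi>" "div_free \<psi>" "(LINT x|torus. (norm (f x - \<psi> x))\<^sup>2) < \<delta>\<^sup>2"
      unfolding H_field_def by (meson zero_less_power)
    interpret smooth_field \<psi> using \<psi> by unfold_locales
    have d: "L2_field (\<lambda>x. f x - \<psi> x)" using L2_field_diff[OF f L2_field] .
    have "?I = (LINT x|torus. ((f x - \<psi> x) \<bullet> frequency k) * ?c x) + (LINT x|torus. (\<psi> x \<bullet> frequency k) * ?c x)"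
      using int[OF d] int[OF L2_field]
      by (subst Bochner_Integration.integral_add[symmetric]) (auto simp: inner_diff_left algebra_simps)
    also have "\<dots> = (LINT x|torus. ((f x - \<psi> x) \<bullet> frequency k) * ?c x)" using weak_div_free[OF \<psi>(3)] by simp
    finally have "\<bar>?I\<bar> \<le> norm (frequency k) * (LINT x|torus. norm (f x - \<psi> x))" using le[OF d] by simp
    also have "\<dots> \<le> norm (frequency k) * (\<delta> * (measure torus period_cube + 1))"
      using integral_norm_le[OF d _ \<delta>] \<psi>(4) by (intro mult_left_mono) auto
    finally show ?thesis by (simp add: mult_ac)
  qed
  have "\<bar>?I\<bar> \<le> 0"
  proof (rule field_le_epsilon)
    fix e :: real assume e: "e > 0"
    define M where "M = norm (frequency k) * (measure torus period_cube + 1)"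
    have "M \<ge> 0" by (simp add: M_def)
    have "\<bar>?I\<bar> \<le> M * (e / (M + 1))"
      unfolding M_def by (rule small) (use e \<open>M \<ge> 0\<close> in \<open>simp add: M_def[symmetric]\<close>)
    also have "\<dots> \<le> e" using e \<open>M \<ge> 0\<close> by (simp add: field_simps)
    finally show "\<bar>?I\<bar> \<le> 0 + e" by simp
  qed
  then show ?thesis by simp
qed

text \<open>
  Smooth fields have small defect, and the defect is bounded in \<open>L\<^sup>2\<close>, uniformly in the kernel.
\<close>

lemma H_field_defect_tendsto_0:
  assumes "H_field f" shows "(\<lambda>n. defect (kernel n) f) \<longlonglongrightarrow> 0"
proof (rule LIMSEQ_I)
  fix r :: real assume r: "r > 0"
  have f: "L2_field f" using assms by (simp add: H_field_def)
  from assms r obtain \<psi> where \<psi>: "smooth \<psi>" "torus_periodic \<psi>" "div_free \<psi>" "(LINT x|torus. (norm (f x - \<psi> x))\<^sup>2) < r / 16"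
    unfolding H_field_def by (meson zero_less_divide_iff zero_less_numeral)
  interpret smooth_field \<psi> using \<psi> by unfold_locales
  have d: "L2_field (\<lambda>x. f x - \<psi> x)" using L2_field_diff[OF f L2_field] .
  have 1: "defect (kernel n) f \<le> 2 * defect (kernel n) (\<lambda>x. f x - \<psi> x) + 2 * defect (kernel n) \<psi>" for n
    using defect_add_le[OF trig_kernel kernel_nonneg d L2_field, of n] by simp
  have 2: "defect (kernel n) (\<lambda>x. f x - \<psi> x) < r / 4" for n
    using defect_le_norm[OF trig_kernel kernel_nonneg d, of n] \<psi>(4) by (simp add: integral_kernel)
  have "eventually (\<lambda>n. defect (kernel n) \<psi> < r / 4) sequentially"
    using order_tendstoD(2)[OF defect_tendsto_0, of "r/4"] r by simp
  then have "eventually (\<lambda>n. norm (defect (kernel n) f - 0) < r) sequentially"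
  proof (elim eventually_mono)
    fix n assume *: "defect (kernel n) \<psi> < r / 4"
    have "0 \<le> defect (kernel n) f" by (rule defect_nonneg[OF kernel_nonneg])
    then show "norm (defect (kernel n) f - 0) < r"
      using * 1[of n] 2[of n] by simp
  qed
  then show "\<exists>no. \<forall>n\<ge>no. norm (defect (kernel n) f - 0) < r"
    by (simp add: eventually_sequentially)
qed

section \<open>The cubic flux and the identity of Duchon and Robert\<close>

text \<open>
  Orthogonality to all gradients of trigonometric functions; the phase \<open>\<theta>\<close> covers sines and cosines.
\<close>

definition weakly_div_free :: "(R3 \<Rightarrow> R3) \<Rightarrow> bool" where
  "weakly_div_free u \<longleftrightarrow> (\<forall>k \<theta>. (LINT x|torus. (u x \<bullet> frequency k) * cos (frequency k \<bullet> x + \<theta>)) = 0)"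

text \<open>
  For an Euler solution the time derivative of \<open>quad k\<close> is twice this quantity, where \<open>k'\<close> is the
  gradient of \<open>k\<close>.
\<close>

definition flux :: "(R3 \<Rightarrow> R3) \<Rightarrow> (R3 \<Rightarrow> R3) \<Rightarrow> real" where
  "flux k' u = (LINT p|torus2. (u (fst p) \<bullet> u (snd p)) * (u (fst p) \<bullet> k' (fst p - snd p)))"

definition increment_flux :: "(R3 \<Rightarrow> R3) \<Rightarrow> (R3 \<Rightarrow> R3) \<Rightarrow> real" where
  "increment_flux k' u = (LINT p|torus2.
     (k' (fst p - snd p) \<bullet> (u (fst p) - u (snd p))) * (norm (u (fst p) - u (snd p)))\<^sup>2)"

definition L3_field :: "(R3 \<Rightarrow> R3) \<Rightarrow> bool" where
  "L3_field u \<longleftrightarrow> L2_field u \<and> integrable torus (\<lambda>x. norm (u x) ^ 3)"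

lemma weakly_div_free_const: "weakly_div_free (\<lambda>x. c)"
proof -
  interpret smooth_field "\<lambda>x::R3. c"
    by unfold_locales (auto simp: smooth_def C_k_const torus_periodic_def)
  have "div_free (\<lambda>x. c)" by (simp add: div_free_def partial_def)
  then show ?thesis using weak_div_free unfolding weakly_div_free_def by blast
qed

lemma L2_field_const: "L2_field (\<lambda>x. c)"
proof -
  interpret smooth_field "\<lambda>x::R3. c"
    by unfold_locales (auto simp: smooth_def C_k_const torus_periodic_def)
  show ?thesis by (rule L2_field)
qed

lemma trig_pair_grad_integrable:
  assumes k: "trig_pair k k'" and u: "L2_field u"
  shows "integrable torus (\<lambda>y. u y \<bullet> k' (x - y))"
proof -
  note tp = trig_pair_properties[OF k]
  from tp(7) obtain C where C: "\<And>z. norm (k' z) \<le> C" by blast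
  have [measurable]: "u \<in> borel_measurable borel" "k' \<in> borel_measurable borel"
    using u tp by (auto simp: L2_field_def)
  show ?thesis
  proof (rule Bochner_Integration.integrable_bound[OF integrable_mult_right[OF integrable_norm[OF L2_field_integrable[OF u]], of C]])
    show "(\<lambda>y. u y \<bullet> k' (x - y)) \<in> borel_measurable torus" by (rule torus_measurable) measurable
    have "\<bar>u y \<bullet> k' (x - y)\<bar> \<le> \<bar>C * norm (u y)\<bar>" for y
    proof -
      have "\<bar>u y \<bullet> k' (x - y)\<bar> \<le> norm (u y) * norm (k' (x - y))" by (rule Cauchy_Schwarz_ineq2)
      also have "\<dots> \<le> norm (u y) * C" using C by (intro mult_left_mono) auto
      finally show ?thesis by (simp add: mult.commute)
    qed
    then show "AE y in torus. norm (u y \<bullet> k' (x - y)) \<le> norm (C * norm (u y))" by simp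
  qed
qed

text \<open>
  The convolution of a divergence-free field with a gradient vanishes.
\<close>

lemma trig_pair_grad_orthogonal:
  assumes "trig_pair k k'" and div: "weakly_div_free u" and u: "L2_field u"
  shows "(LINT y|torus. u y \<bullet> k' (x - y)) = 0"
  using assms(1)
proof induction
  case (trig_cos k)
  have "(LINT y|torus. u y \<bullet> (- sin (frequency k \<bullet> (x - y)) *\<^sub>R frequency k))
     = (LINT y|torus. (u y \<bullet> frequency k) * cos (frequency k \<bullet> y + (- (frequency k \<bullet> x) - pi / 2)))"
  proof (rule Bochner_Integration.integral_cong[OF refl])
    fix y
    have "- sin (frequency k \<bullet> (x - y)) = cos (frequency k \<bullet> y + (- (frequency k \<bullet> x) - pi / 2))"
      using sin_cos_eq[of "frequency k \<bullet> (y - x)"] cos_minus[of "pi / 2 - frequency k \<bullet> (y - x)"]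
        sin_minus[of "frequency k \<bullet> (y - x)"]
      by (simp add: inner_diff_right algebra_simps)
    then show "u y \<bullet> (- sin (frequency k \<bullet> (x - y)) *\<^sub>R frequency k)
      = (u y \<bullet> frequency k) * cos (frequency k \<bullet> y + (- (frequency k \<bullet> x) - pi / 2))" by simp
  qed
  then show ?case using div by (simp add: weakly_div_free_def)
next
  case (trig_add f f' g g')
  then show ?case
    using trig_pair_grad_integrable[OF trig_add.hyps(1) u] trig_pair_grad_integrable[OF trig_add.hyps(2) u]
    by (simp add: inner_add_right)
qed simp

lemma cubic_le: 
  fixes a b :: real assumes "0 \<le> a" "0 \<le> b" shows "a\<^sup>2 * b \<le> a ^ 3 + b ^ 3"
proof (cases "a \<le> b")
  case True
  then have "a\<^sup>2 * b \<le> b\<^sup>2 * b" using assms by (intro mult_right_mono power_mono) auto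
  then show ?thesis using assms by (simp add: power3_eq_cube power2_eq_square add_increasing)
next
  case False
  then have "a\<^sup>2 * b \<le> a\<^sup>2 * a" using assms by (intro mult_left_mono) auto
  then show ?thesis using assms by (simp add: power3_eq_cube power2_eq_square add_increasing2)
qed

lemma torus2_cubic_integrable:
  assumes u: "L3_field u" and F: "F \<in> borel_measurable borel"
    and le: "\<And>p. \<bar>F p\<bar> \<le> C * (norm (u (fst p)) ^ 3 + norm (u (snd p)) ^ 3)"
  shows "integrable torus2 (F :: R3 \<times> R3 \<Rightarrow> real)"
proof -
  have i: "integrable torus (\<lambda>x. norm (u x) ^ 3)" using u by (simp add: L3_field_def)
  show ?thesis
    by (rule Bochner_Integration.integrable_bound[OF integrable_mult_right[OF Bochner_Integration.integrable_add[OF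
          torus2_integrable_fst[OF i] torus2_integrable_snd[OF i]], of C]])
       (use torus2_measurable[OF F] le in \<open>auto intro: order_trans[OF le abs_ge_self]\<close>)
qed

text \<open>
  Expanding the product gives six terms.  Two of them depend on \<open>y\<close> only through \<open>k' (x - y)\<close> and
  \<open>u y \<bullet> k' (x - y)\<close>, respectively, and vanish after integration in \<open>y\<close>, because constant fields and \<open>u\<close>
  are weakly divergence-free.  Exchanging \<open>x\<close> and \<open>y\<close>, under which \<open>k'\<close> is odd, disposes of their
  mirror images.  The remaining two are the mixed terms, mirror images of each other with factor 2.
\<close>

lemma increment_flux_eq:
  assumes k: "trig_pair k k'" and div: "weakly_div_free u" and u: "L3_field u"
  shows "increment_flux k' u = - 4 * flux k' u"
proof -
  note tp = trig_pair_properties[OF k]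
  from tp(7) obtain C where C: "\<And>z. norm (k' z) \<le> C" by blast
  have C0: "0 \<le> C" using order_trans[OF norm_ge_zero C] .
  have u2: "L2_field u" using u by (simp add: L3_field_def)
  have [measurable]: "u \<in> borel_measurable borel" "k' \<in> borel_measurable borel"
    using u2 tp by (auto simp: L2_field_def)
  have odd: "k' (y - x) = - k' (x - y)" for x y using tp(4)[of "x - y"] by simp
  \<comment> \<open>every term of the expansion is one of these three or its mirror image\<close>
  define T1 where "T1 p = (u (fst p) \<bullet> k' (fst p - snd p)) * (norm (u (fst p)))\<^sup>2" for p
  define T2 where "T2 p = (u (snd p) \<bullet> k' (fst p - snd p)) * (norm (u (fst p)))\<^sup>2" for p
  define T3 where "T3 p = (u (fst p) \<bullet> u (snd p)) * (u (fst p) \<bullet> k' (fst p - snd p))" for p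
  have bnd: "\<bar>a \<bullet> k' z\<bar> \<le> C * norm a" for a z
  proof -
    have "\<bar>a \<bullet> k' z\<bar> \<le> norm a * norm (k' z)" by (rule Cauchy_Schwarz_ineq2)
    also have "\<dots> \<le> norm a * C" using C by (intro mult_left_mono) auto
    finally show ?thesis by (simp add: mult.commute)
  qed
  have i1: "integrable torus2 T1"
  proof (rule torus2_cubic_integrable[OF u, of _ C])
    show "T1 \<in> borel_measurable borel" unfolding T1_def by measurable
    fix p
    have "\<bar>T1 p\<bar> \<le> (C * norm (u (fst p))) * (norm (u (fst p)))\<^sup>2"
      unfolding T1_def abs_mult by (intro mult_mono bnd) (use C0 in auto)
    also have "\<dots> = C * norm (u (fst p)) ^ 3" by (simp add: power3_eq_cube power2_eq_square)
    also have "\<dots> \<le> C * (norm (u (fst p)) ^ 3 + norm (u (snd p)) ^ 3)"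
      using C0 by (intro mult_left_mono) auto
    finally show "\<bar>T1 p\<bar> \<le> C * (norm (u (fst p)) ^ 3 + norm (u (snd p)) ^ 3)" .
  qed
  have i2: "integrable torus2 T2"
  proof (rule torus2_cubic_integrable[OF u, of _ C])
    show "T2 \<in> borel_measurable borel" unfolding T2_def by measurable
    fix p
    have "\<bar>T2 p\<bar> \<le> (C * norm (u (snd p))) * (norm (u (fst p)))\<^sup>2"
      unfolding T2_def abs_mult by (intro mult_mono bnd) (use C0 in auto)
    also have "\<dots> = C * ((norm (u (fst p)))\<^sup>2 * norm (u (snd p)))" by simp
    also have "\<dots> \<le> C * (norm (u (fst p)) ^ 3 + norm (u (snd p)) ^ 3)"
      using C0 by (intro mult_left_mono cubic_le) auto
    finally show "\<bar>T2 p\<bar> \<le> C * (norm (u (fst p)) ^ 3 + norm (u (snd p)) ^ 3)" .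
  qed
  have i3: "integrable torus2 T3"
  proof (rule torus2_cubic_integrable[OF u, of _ C])
    show "T3 \<in> borel_measurable borel" unfolding T3_def by measurable
    fix p
    have "\<bar>T3 p\<bar> \<le> (norm (u (fst p)) * norm (u (snd p))) * (C * norm (u (fst p)))"
      unfolding T3_def abs_mult by (intro mult_mono bnd Cauchy_Schwarz_ineq2) (use C0 in auto)
    also have "\<dots> = C * ((norm (u (fst p)))\<^sup>2 * norm (u (snd p)))" by (simp add: power2_eq_square)
    also have "\<dots> \<le> C * (norm (u (fst p)) ^ 3 + norm (u (snd p)) ^ 3)"
      using C0 by (intro mult_left_mono cubic_le) auto
    finally show "\<bar>T3 p\<bar> \<le> C * (norm (u (fst p)) ^ 3 + norm (u (snd p)) ^ 3)" .
  qed
  have z1: "(LINT p|torus2. T1 p) = 0"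
  proof -
    have "(LINT p|torus2. T1 p) = (LINT x|torus. LINT y|torus. T1 (x, y))"
      using torus2.integral_fst'[OF i1] by simp
    also have "\<dots> = (LINT x|torus. (LINT y|torus. u x \<bullet> k' (x - y)) * (norm (u x))\<^sup>2)"
      by (simp add: T1_def)
    also have "\<dots> = 0"
      using trig_pair_grad_orthogonal[OF k weakly_div_free_const L2_field_const] by simp
    finally show ?thesis .
  qed
  have z2: "(LINT p|torus2. T2 p) = 0"
  proof -
    have "(LINT p|torus2. T2 p) = (LINT x|torus. LINT y|torus. T2 (x, y))"
      using torus2.integral_fst'[OF i2] by simp
    also have "\<dots> = (LINT x|torus. (LINT y|torus. u y \<bullet> k' (x - y)) * (norm (u x))\<^sup>2)"
      by (simp add: T2_def)
    also have "\<dots> = 0"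
      using trig_pair_grad_orthogonal[OF k div u2] by simp
    finally show ?thesis .
  qed
  note swap = torus2_integral_swap
  have s1: "(LINT p|torus2. T1 (snd p, fst p)) = 0" "integrable torus2 (\<lambda>p. T1 (snd p, fst p))"
    using swap[OF borel_measurable_integrable[OF i1]] z1 torus2.integrable_product_swap[OF i1]
    by (auto simp: case_prod_beta')
  have s2: "(LINT p|torus2. T2 (snd p, fst p)) = 0" "integrable torus2 (\<lambda>p. T2 (snd p, fst p))"
    using swap[OF borel_measurable_integrable[OF i2]] z2 torus2.integrable_product_swap[OF i2]
    by (auto simp: case_prod_beta')
  have s3: "(LINT p|torus2. T3 (snd p, fst p)) = (LINT p|torus2. T3 p)" "integrable torus2 (\<lambda>p. T3 (snd p, fst p))"
    using swap[OF borel_measurable_integrable[OF i3]] torus2.integrable_product_swap[OF i3]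
    by (auto simp: case_prod_beta')
  have "(k' (fst p - snd p) \<bullet> (u (fst p) - u (snd p))) * (norm (u (fst p) - u (snd p)))\<^sup>2
    = T1 p - T2 p - T2 (snd p, fst p) + T1 (snd p, fst p) - 2 * T3 p - 2 * T3 (snd p, fst p)" for p
    unfolding T1_def T2_def T3_def fst_conv snd_conv odd[of "snd p" "fst p"]
    by (simp add: power2_norm_eq_inner inner_diff_left inner_diff_right inner_commute algebra_simps)
  then have "increment_flux k' u = (LINT p|torus2. T1 p - T2 p - T2 (snd p, fst p) + T1 (snd p, fst p) - 2 * T3 p - 2 * T3 (snd p, fst p))"
    unfolding increment_flux_def by simp
  also have "\<dots> = - 4 * (LINT p|torus2. T3 p)"
    using i1 i2 i3 z1 z2 s1 s2 s3 by simp
  finally show ?thesis by (simp add: flux_def T3_def)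
qed

text \<open>
  The phases \<open>0\<close> and \<open>- pi / 2\<close> give the cosine and the sine coefficients.
\<close>

definition mode :: "int ^ 3 \<Rightarrow> real \<Rightarrow> (R3 \<Rightarrow> R3) \<Rightarrow> R3" where
  "mode k \<theta> u = (LINT x|torus. cos (frequency k \<bullet> x + \<theta>) *\<^sub>R u x)"

text \<open>
  The nonlinearity tested with a trigonometric function.  The mode evolves with the projection of this
  vector onto the orthogonal complement of the frequency; the omitted component is the pressure.
\<close>

definition mode_force :: "int ^ 3 \<Rightarrow> real \<Rightarrow> (R3 \<Rightarrow> R3) \<Rightarrow> R3" where
  "mode_force k \<theta> u = (LINT x|torus. (- sin (frequency k \<bullet> x + \<theta>) * (u x \<bullet> frequency k)) *\<^sub>R u x)"

lemma mode_integrable: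
  assumes u: "L2_field u"
  shows "integrable torus (\<lambda>x. cos (frequency k \<bullet> x + \<theta>) *\<^sub>R u x)" (is ?i1)
    and "integrable torus (\<lambda>x. (- sin (frequency k \<bullet> x + \<theta>) * (u x \<bullet> frequency k)) *\<^sub>R u x)" (is ?i2)
    and "norm (mode_force k \<theta> u) \<le> norm (frequency k) * (LINT x|torus. (norm (u x))\<^sup>2)"
proof -
  have [measurable]: "u \<in> borel_measurable borel" and u2: "integrable torus (\<lambda>x. (norm (u x))\<^sup>2)"
    using u by (auto simp: L2_field_def)
  show ?i1
    by (rule Bochner_Integration.integrable_bound[OF L2_field_integrable[OF u]])
       (auto intro: torus_measurable simp: mult_left_le_one_le)
  have b: "norm ((- sin (frequency k \<bullet> x + \<theta>) * (u x \<bullet> frequency k)) *\<^sub>R u x) \<le> norm (frequency k) * (norm (u x))\<^sup>2" for x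
  proof -
    have "norm ((- sin (frequency k \<bullet> x + \<theta>) * (u x \<bullet> frequency k)) *\<^sub>R u x)
       \<le> (1 * (norm (u x) * norm (frequency k))) * norm (u x)"
      unfolding norm_scaleR abs_mult by (intro mult_mono Cauchy_Schwarz_ineq2) auto
    then show ?thesis by (simp add: power2_eq_square mult_ac)
  qed
  show i2: ?i2
    by (rule Bochner_Integration.integrable_bound[OF integrable_mult_right[OF u2, of "norm (frequency k)"]])
       (use b in \<open>auto intro: torus_measurable simp: abs_mult\<close>)
  have "norm (mode_force k \<theta> u) \<le> (LINT x|torus. norm (frequency k) * (norm (u x))\<^sup>2)"
    unfolding mode_force_def
    by (rule order_trans[OF integral_norm_bound integral_mono[OF integrable_norm[OF i2] _ b]]) (use u2 in simp)
  then show "norm (mode_force k \<theta> u) \<le> norm (frequency k) * (LINT x|torus. (norm (u x))\<^sup>2)" by simp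
qed

lemma mode_orthogonal:
  assumes "L2_field u" "weakly_div_free u" shows "mode k \<theta> u \<bullet> frequency k = 0"
proof -
  have "mode k \<theta> u \<bullet> frequency k = (LINT x|torus. (cos (frequency k \<bullet> x + \<theta>) *\<^sub>R u x) \<bullet> frequency k)"
    unfolding mode_def by (rule integral_inner_left[symmetric]) (rule mode_integrable(1)[OF assms(1)])
  then show ?thesis using assms(2) by (simp add: weakly_div_free_def mult.commute)
qed

text \<open>
  This is the addition formula for \<open>cos (\<xi> \<bullet> x - \<xi> \<bullet> y)\<close>.
\<close>

lemma quad_cos:
  assumes u: "L2_field u"
  shows "quad (\<lambda>z. cos (frequency k \<bullet> z)) u = (norm (mode k 0 u))\<^sup>2 + (norm (mode k (- pi / 2) u))\<^sup>2"
proof -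
  let ?c = "\<lambda>\<theta> x. cos (frequency k \<bullet> x + \<theta>)"
  have cc: "cos (frequency k \<bullet> (x - y)) = ?c 0 x * ?c 0 y + ?c (- pi / 2) x * ?c (- pi / 2) y" for x y
    by (simp add: inner_diff_right cos_diff cos_add)
  have u': "integrable torus u" by (rule L2_field_integrable[OF u])
  have "quad (\<lambda>z. cos (frequency k \<bullet> z)) u = (LINT x|torus. LINT y|torus. cos (frequency k \<bullet> (x - y)) * (u x \<bullet> u y))"
    unfolding quad_def using torus2.integral_fst'[OF L2_field_quad(1)[OF trig_intros(1) u]] by simp
  also have "\<dots> = (LINT x|torus. (?c 0 x *\<^sub>R u x) \<bullet> mode k 0 u + (?c (- pi / 2) x *\<^sub>R u x) \<bullet> mode k (- pi / 2) u)"
  proof (rule Bochner_Integration.integral_cong[OF refl])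
    fix x
    have "(LINT y|torus. cos (frequency k \<bullet> (x - y)) * (u x \<bullet> u y))
       = (LINT y|torus. (?c 0 x *\<^sub>R u x) \<bullet> (?c 0 y *\<^sub>R u y) + (?c (- pi / 2) x *\<^sub>R u x) \<bullet> (?c (- pi / 2) y *\<^sub>R u y))"
      unfolding cc by (simp add: algebra_simps)
    also have "\<dots> = (?c 0 x *\<^sub>R u x) \<bullet> mode k 0 u + (?c (- pi / 2) x *\<^sub>R u x) \<bullet> mode k (- pi / 2) u"
      unfolding mode_def using mode_integrable(1)[OF u]
      by (subst Bochner_Integration.integral_add) (simp_all only: integral_inner_right integrable_inner_right)
    finally show "(LINT y|torus. cos (frequency k \<bullet> (x - y)) * (u x \<bullet> u y))
      = (?c 0 x *\<^sub>R u x) \<bullet> mode k 0 u + (?c (- pi / 2) x *\<^sub>R u x) \<bullet> mode k (- pi / 2) u" .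
  qed
  also have "\<dots> = mode k 0 u \<bullet> mode k 0 u + mode k (- pi / 2) u \<bullet> mode k (- pi / 2) u"
    using mode_integrable(1)[OF u, of k]
    by (subst Bochner_Integration.integral_add) (simp_all only: integral_inner_left integrable_inner_left mode_def)
  finally show ?thesis by (simp add: power2_norm_eq_inner)
qed

lemma flux_cos:
  assumes u: "L3_field u"
  shows "flux (\<lambda>z. - sin (frequency k \<bullet> z) *\<^sub>R frequency k) u
     = mode k 0 u \<bullet> mode_force k 0 u + mode k (- pi / 2) u \<bullet> mode_force k (- pi / 2) u"
proof -
  let ?c = "\<lambda>\<theta> x. cos (frequency k \<bullet> x + \<theta>)"
  let ?f = "\<lambda>\<theta> x. (- sin (frequency k \<bullet> x + \<theta>) * (u x \<bullet> frequency k)) *\<^sub>R u x"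
  have u2: "L2_field u" using u by (simp add: L3_field_def)
  have [measurable]: "u \<in> borel_measurable borel" using u2 by (auto simp: L2_field_def)
  have ss: "- sin (frequency k \<bullet> (x - y)) = - sin (frequency k \<bullet> x + 0) * ?c 0 y + - sin (frequency k \<bullet> x + - pi / 2) * ?c (- pi / 2) y" for x y
  proof -
    have "sin (t - pi / 2) = - cos t" "cos (t - pi / 2) = sin t" for t :: real
      by (simp_all add: sin_diff cos_diff)
    then show ?thesis by (simp add: inner_diff_right sin_diff)
  qed
  let ?F = "\<lambda>p. (u (fst p) \<bullet> u (snd p)) * (u (fst p) \<bullet> (- sin (frequency k \<bullet> (fst p - snd p)) *\<^sub>R frequency k))"
  have int: "integrable torus2 ?F"
  proof (rule torus2_cubic_integrable[OF u, of _ "norm (frequency k)"])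
    show "?F \<in> borel_measurable borel" by measurable
    fix p
    have "\<bar>?F p\<bar> \<le> (norm (u (fst p)) * norm (u (snd p))) * (norm (u (fst p)) * (1 * norm (frequency k)))"
      unfolding abs_mult
      by (intro mult_mono Cauchy_Schwarz_ineq2 order_trans[OF Cauchy_Schwarz_ineq2]) (auto simp: mult_left_le_one_le)
    also have "\<dots> = norm (frequency k) * ((norm (u (fst p)))\<^sup>2 * norm (u (snd p)))" by (simp add: power2_eq_square)
    also have "\<dots> \<le> norm (frequency k) * (norm (u (fst p)) ^ 3 + norm (u (snd p)) ^ 3)"
      by (intro mult_left_mono cubic_le) auto
    finally show "\<bar>?F p\<bar> \<le> norm (frequency k) * (norm (u (fst p)) ^ 3 + norm (u (snd p)) ^ 3)" .
  qed
  have "flux (\<lambda>z. - sin (frequency k \<bullet> z) *\<^sub>R frequency k) u = (LINT x|torus. LINT y|torus. ?F (x, y))"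
    unfolding flux_def using torus2.integral_fst'[OF int] by simp
  also have "\<dots> = (LINT x|torus. ?f 0 x \<bullet> mode k 0 u + ?f (- pi / 2) x \<bullet> mode k (- pi / 2) u)"
  proof (rule Bochner_Integration.integral_cong[OF refl])
    fix x
    have "(LINT y|torus. ?F (x, y)) = (LINT y|torus. ?f 0 x \<bullet> (?c 0 y *\<^sub>R u y) + ?f (- pi / 2) x \<bullet> (?c (- pi / 2) y *\<^sub>R u y))"
    proof (rule Bochner_Integration.integral_cong[OF refl])
      fix y
      have "?F (x, y) = (u x \<bullet> u y) * (u x \<bullet> frequency k) * (- sin (frequency k \<bullet> (x - y)))" by simp
      also have "\<dots> = ?f 0 x \<bullet> (?c 0 y *\<^sub>R u y) + ?f (- pi / 2) x \<bullet> (?c (- pi / 2) y *\<^sub>R u y)"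
        unfolding ss by (simp add: algebra_simps)
      finally show "?F (x, y) = ?f 0 x \<bullet> (?c 0 y *\<^sub>R u y) + ?f (- pi / 2) x \<bullet> (?c (- pi / 2) y *\<^sub>R u y)" .
    qed
    also have "\<dots> = ?f 0 x \<bullet> mode k 0 u + ?f (- pi / 2) x \<bullet> mode k (- pi / 2) u"
      unfolding mode_def using mode_integrable(1)[OF u2]
      by (subst Bochner_Integration.integral_add) (simp_all only: integral_inner_right integrable_inner_right)
    finally show "(LINT y|torus. ?F (x, y)) = ?f 0 x \<bullet> mode k 0 u + ?f (- pi / 2) x \<bullet> mode k (- pi / 2) u" .
  qed
  also have "\<dots> = mode_force k 0 u \<bullet> mode k 0 u + mode_force k (- pi / 2) u \<bullet> mode k (- pi / 2) u"
    using mode_integrable(2)[OF u2, of k]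
    by (subst Bochner_Integration.integral_add) (simp_all only: integral_inner_left integrable_inner_left mode_force_def)
  finally show ?thesis by (simp add: inner_commute)
qed

lemma quad_linear:
  assumes u: "L2_field u" and "trig f" "trig g"
  shows "quad (\<lambda>z. f z + g z) u = quad f u + quad g u" "quad (\<lambda>z. c * f z) u = c * quad f u"
  using L2_field_quad(1)[OF assms(2) u] L2_field_quad(1)[OF assms(3) u]
  by (simp_all add: quad_def distrib_right mult.assoc)

lemma flux_linear:
  assumes u: "L3_field u" and f: "trig_pair f f'" and g: "trig_pair g g'"
  shows "flux (\<lambda>z. f' z + g' z) u = flux f' u + flux g' u" "flux (\<lambda>z. c *\<^sub>R f' z) u = c * flux f' u"
proof -
  have int: "integrable torus2 (\<lambda>p. (u (fst p) \<bullet> u (snd p)) * (u (fst p) \<bullet> k' (fst p - snd p)))" if k: "trig_pair k k'" for k k'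
  proof -
    note tp = trig_pair_properties[OF k]
    from tp(7) obtain C where C: "\<And>z. norm (k' z) \<le> C" by blast
    have C0: "0 \<le> C" using order_trans[OF norm_ge_zero C] .
    have [measurable]: "u \<in> borel_measurable borel" "k' \<in> borel_measurable borel"
      using u tp by (auto simp: L2_field_def L3_field_def)
    show ?thesis
    proof (rule torus2_cubic_integrable[OF u, of _ C])
      fix p
      have "\<bar>(u (fst p) \<bullet> u (snd p)) * (u (fst p) \<bullet> k' (fst p - snd p))\<bar>
        \<le> (norm (u (fst p)) * norm (u (snd p))) * (norm (u (fst p)) * C)"
        unfolding abs_mult
        by (intro mult_mono Cauchy_Schwarz_ineq2 order_trans[OF Cauchy_Schwarz_ineq2]) (use C C0 in auto)
      also have "\<dots> = C * ((norm (u (fst p)))\<^sup>2 * norm (u (snd p)))" by (simp add: power2_eq_square)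
      also have "\<dots> \<le> C * (norm (u (fst p)) ^ 3 + norm (u (snd p)) ^ 3)"
        using C0 by (intro mult_left_mono cubic_le) auto
      finally show "\<bar>(u (fst p) \<bullet> u (snd p)) * (u (fst p) \<bullet> k' (fst p - snd p))\<bar>
        \<le> C * (norm (u (fst p)) ^ 3 + norm (u (snd p)) ^ 3)" .
    qed measurable
  qed
  show "flux (\<lambda>z. f' z + g' z) u = flux f' u + flux g' u" "flux (\<lambda>z. c *\<^sub>R f' z) u = c * flux f' u"
    using int[OF f] int[OF g] by (simp_all add: flux_def inner_add_right distrib_left mult.left_commute)
qed

text \<open>
  The increment bound is applied to the shortest translate of \<open>z\<close> by a period, whose square is
  controlled by \<open>cos_gap z\<close>; there remains a moment of the gradient of the kernel.
\<close>

lemma flux_kernel_bound: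
  assumes u: "L3_field u" and div: "weakly_div_free u" and \<gamma>: "0 < \<gamma>" "\<gamma> \<le> 2" and n: "1 \<le> n" and G: "0 \<le> G"
    and inc: "\<And>z. integrable torus (\<lambda>y. norm (u (z + y) - u y) ^ 3)"
       "\<And>z. (LINT y|torus. norm (u (z + y) - u y) ^ 3) \<le> G * norm z powr \<gamma>"
  shows "\<bar>flux (kernel_grad n) u\<bar> \<le> 45 * 8 powr (\<gamma> / 2) * G * real n powr ((1 - \<gamma>) / 2)"
proof -
  have u2: "L2_field u" using u by (simp add: L3_field_def)
  have [measurable]: "u \<in> borel_measurable borel" and per: "torus_periodic u" using u2 by (auto simp: L2_field_def)
  let ?G = "G * 8 powr (\<gamma> / 2)"
  have le: "(LINT y|torus. norm (u (z + y) - u y) ^ 3) \<le> ?G * cos_gap z powr (\<gamma> / 2)" for z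
  proof -
    obtain m where m: "(norm (z + period_vector m))\<^sup>2 \<le> 8 * cos_gap z" using norm_shift_le_cos_gap by blast
    have "u (z + period_vector m + y) = u (z + y)" for y
      using torus_periodic_shift[OF per, of "z + y" m] by (simp add: algebra_simps)
    then have "(LINT y|torus. norm (u (z + y) - u y) ^ 3) \<le> G * norm (z + period_vector m) powr \<gamma>"
      using inc(2)[of "z + period_vector m"] by simp
    also have "norm (z + period_vector m) powr \<gamma> = ((norm (z + period_vector m))\<^sup>2) powr (\<gamma> / 2)"
      unfolding powr_2_norm[symmetric] powr_powr by simp
    also have "\<dots> \<le> (8 * cos_gap z) powr (\<gamma> / 2)" using m \<gamma> by (intro powr_mono2) auto
    also have "\<dots> = 8 powr (\<gamma> / 2) * cos_gap z powr (\<gamma> / 2)" using cos_gap_nonneg by (simp add: powr_mult)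
    finally show ?thesis using G by (simp add: mult_left_mono mult.assoc)
  qed
  have per': "torus_periodic (\<lambda>z. norm (kernel_grad n z))"
    using trig_pair_properties(2)[OF trig_pair_kernel, of n] by (simp add: torus_periodic_def)
  have km: "(\<lambda>z. norm (kernel_grad n z) * (?G * cos_gap z powr (\<gamma> / 2)))
      = (\<lambda>z. ?G * (norm (kernel_grad n z) * cos_gap z powr (\<gamma> / 2)))" by (simp add: fun_eq_iff)
  note B = torus2_increment_bound[of "\<lambda>z. norm (kernel_grad n z)" "\<lambda>w. norm w ^ 3" u "\<lambda>z. ?G * cos_gap z powr (\<gamma> / 2)",
      OF _ _ _ per' per _ _ inc(1) le, unfolded km]
  have i: "integrable torus2 (\<lambda>p. norm (kernel_grad n (fst p - snd p)) * norm (u (fst p) - u (snd p)) ^ 3)"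
    by (rule B(1)) (use integral_kernel_grad(1)[OF n \<gamma>] in auto)
  have "\<bar>increment_flux (kernel_grad n) u\<bar> \<le> (LINT p|torus2. norm (kernel_grad n (fst p - snd p)) * norm (u (fst p) - u (snd p)) ^ 3)"
    unfolding increment_flux_def
  proof (rule integral_abs_bound_integral)
    show le3: "\<bar>(kernel_grad n (fst p - snd p) \<bullet> (u (fst p) - u (snd p))) * (norm (u (fst p) - u (snd p)))\<^sup>2\<bar>
       \<le> norm (kernel_grad n (fst p - snd p)) * norm (u (fst p) - u (snd p)) ^ 3" for p
    proof -
      have "\<bar>(kernel_grad n (fst p - snd p) \<bullet> (u (fst p) - u (snd p))) * (norm (u (fst p) - u (snd p)))\<^sup>2\<bar>
        \<le> (norm (kernel_grad n (fst p - snd p)) * norm (u (fst p) - u (snd p))) * (norm (u (fst p) - u (snd p)))\<^sup>2"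
        unfolding abs_mult by (intro mult_mono Cauchy_Schwarz_ineq2) auto
      then show ?thesis by (simp add: power3_eq_cube power2_eq_square mult_ac)
    qed
    show "integrable torus2 (\<lambda>p. (kernel_grad n (fst p - snd p) \<bullet> (u (fst p) - u (snd p))) * (norm (u (fst p) - u (snd p)))\<^sup>2)"
      by (rule Bochner_Integration.integrable_bound[OF i])
         (use le3 in \<open>auto intro!: torus2_measurable simp: abs_mult\<close>)
  qed (rule i)
  also have "\<dots> \<le> (LINT z|torus. ?G * (norm (kernel_grad n z) * cos_gap z powr (\<gamma> / 2)))"
    by (rule B(2)) (use integral_kernel_grad(1)[OF n \<gamma>] in auto)
  also have "\<dots> = ?G * (LINT z|torus. norm (kernel_grad n z) * cos_gap z powr (\<gamma> / 2))" by simp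
  also have "\<dots> \<le> ?G * (45 * real n powr ((1 - \<gamma>) / 2))"
    using G by (intro mult_left_mono integral_kernel_grad(2)[OF n \<gamma>]) auto
  finally have "\<bar>increment_flux (kernel_grad n) u\<bar> \<le> ?G * (45 * real n powr ((1 - \<gamma>) / 2))" .
  moreover have "\<bar>flux (kernel_grad n) u\<bar> \<le> \<bar>increment_flux (kernel_grad n) u\<bar>"
    unfolding increment_flux_eq[OF trig_pair_kernel div u] by (simp add: abs_mult)
  ultimately show ?thesis by (simp add: mult_ac)
qed

section \<open>Primitives in time and the du Bois-Reymond lemma\<close>

text \<open>
  Densities in time whose primitives are Lipschitz.
\<close>

definition bounded_measurable :: "(real \<Rightarrow> real) \<Rightarrow> bool" where
  "bounded_measurable F \<longleftrightarrow> F \<in> borel_measurable lebesgue \<and> (\<exists>C. \<forall>t. \<bar>F t\<bar> \<le> C)"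

lemma bounded_measurable_integrable:
  assumes "bounded_measurable F" shows "F integrable_on {a..b}" "integrable (lebesgue_on {a<..<b}) F"
proof -
  obtain C where C: "\<And>t. \<bar>F t\<bar> \<le> C" using assms by (auto simp: bounded_measurable_def)
  have m: "F \<in> borel_measurable (lebesgue_on S)" for S
    using assms by (auto simp: bounded_measurable_def intro: measurable_restrict_space1)
  show "F integrable_on {a..b}"
    by (rule measurable_bounded_by_integrable_imp_integrable[where g="\<lambda>_. C", OF m]) (use C in auto)
  interpret finite_measure "lebesgue_on {a<..<b}"
    by (rule finite_measure_lebesgue_on) (auto intro: lmeasurable_interval)
  show "integrable (lebesgue_on {a<..<b}) F"
    by (rule integrable_const_bound[OF _ m, of C]) (use C in auto)
qed

lemma bounded_measurable_lebesgue_integral: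
  assumes "bounded_measurable F"
  shows "(LINT t|lebesgue_on {a<..<b}. F t) = integral {a..b} F"
  using lebesgue_integral_eq_integral[OF bounded_measurable_integrable(2)[OF assms], of a b] integral_open_interval_real[of a b F]
  by simp

lemma bounded_measurable_arith:
  assumes "bounded_measurable F" "bounded_measurable G"
  shows "bounded_measurable (\<lambda>t. F t + G t)" "bounded_measurable (\<lambda>t. F t - G t)"
    "bounded_measurable (\<lambda>t. F t * G t)" 
proof -
  obtain C D where C: "\<And>t. \<bar>F t\<bar> \<le> C" and D: "\<And>t. \<bar>G t\<bar> \<le> D" using assms by (auto simp: bounded_measurable_def)
  have m: "F \<in> borel_measurable lebesgue" "G \<in> borel_measurable lebesgue" using assms by (auto simp: bounded_measurable_def)
  have "\<bar>F t + G t\<bar> \<le> C + D" "\<bar>F t - G t\<bar> \<le> C + D" for t using C[of t] D[of t] by linarith+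
  then show "bounded_measurable (\<lambda>t. F t + G t)" "bounded_measurable (\<lambda>t. F t - G t)"
    using m by (auto simp: bounded_measurable_def intro!: exI[of _ "C + D"])
  have "\<bar>F t * G t\<bar> \<le> C * D" for t
    unfolding abs_mult using C[of t] D[of t] by (intro mult_mono) auto
  then show "bounded_measurable (\<lambda>t. F t * G t)"
    using m by (auto simp: bounded_measurable_def intro!: exI[of _ "C * D"])
qed

lemma bounded_measurable_const: "bounded_measurable (\<lambda>t. c)"
  by (auto simp: bounded_measurable_def)

lemma bounded_measurable_Icc:
  assumes "continuous_on {0..T} f" shows "bounded_measurable (\<lambda>t. if t \<in> {0..T} then f t else (0::real))"
proof -
  have "bounded (f ` {0..T})" by (intro compact_imp_bounded compact_continuous_image assms) auto
  then obtain C where C: "\<And>t. t \<in> {0..T} \<Longrightarrow> \<bar>f t\<bar> \<le> C" unfolding bounded_iff by force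
  have "(\<lambda>t. if t \<in> {0..T} then f t else 0) \<in> borel_measurable lebesgue"
    using continuous_imp_measurable_on_sets_lebesgue[OF assms] by (intro borel_measurable_if_I) auto
  then show ?thesis
    unfolding bounded_measurable_def using C by (auto intro!: exI[of _ "max C 0"] simp: le_max_iff_disj)
qed

lemma primitive_Lipschitz:
  assumes F: "bounded_measurable F" and C: "\<And>t. \<bar>F t\<bar> \<le> C" and st: "0 \<le> s" "s \<le> t"
  shows "\<bar>integral {0..t} F - integral {0..s} F\<bar> \<le> C * (t - s)"
    and "integral {0..t} F - integral {0..s} F = integral {s..t} F"
proof -
  show eq: "integral {0..t} F - integral {0..s} F = integral {s..t} F"
    using Henstock_Kurzweil_Integration.integral_combine[OF st bounded_measurable_integrable(1)[OF F]] by simp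
  have "norm (integral {s..t} F) \<le> integral {s..t} (\<lambda>_. C)"
    using bounded_measurable_integrable(1)[OF F] C by (intro integral_norm_bound_integral) auto
  then show "\<bar>integral {0..t} F - integral {0..s} F\<bar> \<le> C * (t - s)"
    using st by (simp add: eq mult.commute)
qed

lemma primitive_continuous:
  assumes F: "bounded_measurable F" shows "continuous_on {0..T} (\<lambda>t. integral {0..t} F)"
  by (rule indefinite_integral_continuous_1) (rule bounded_measurable_integrable(1)[OF F])

text \<open>
  The derivative is 0 everywhere.
\<close>

lemma constant_if_square_modulus:
  fixes D :: "real \<Rightarrow> real"
  assumes le: "\<And>s t. 0 \<le> s \<Longrightarrow> s \<le> t \<Longrightarrow> t \<le> T \<Longrightarrow> \<bar>D t - D s\<bar> \<le> K * (t - s)\<^sup>2" and t: "t \<in> {0..T}"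
  shows "D t = D 0"
proof -
  have le': "\<bar>D t - D s\<bar> \<le> K * (t - s)\<^sup>2" if "s \<in> {0..T}" "t \<in> {0..T}" for s t
    using that le[of s t] le[of t s] by (cases "s \<le> t") (auto simp: power2_commute abs_minus_commute)
  have "\<exists>c. \<forall>x\<in>{0..T}. D x = c"
  proof (rule has_field_derivative_zero_constant)
    fix x assume x: "x \<in> {0..T}"
    have "((\<lambda>y. (D y - D x) / (y - x)) \<longlongrightarrow> 0) (at x within {0..T})"
    proof (rule Lim_null_comparison)
      show "\<forall>\<^sub>F y in at x within {0..T}. norm ((D y - D x) / (y - x)) \<le> \<bar>K\<bar> * \<bar>y - x\<bar>"
        unfolding eventually_at_filter
      proof (intro always_eventually allI impI)
        fix y assume y: "y \<noteq> x" "y \<in> {0..T}"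
        have "\<bar>D y - D x\<bar> \<le> K * (y - x)\<^sup>2" using le' x y by auto
        also have "\<dots> \<le> \<bar>K\<bar> * (y - x)\<^sup>2" by (intro mult_right_mono) auto
        also have "\<dots> = \<bar>K\<bar> * \<bar>y - x\<bar> * \<bar>y - x\<bar>" by (simp add: power2_eq_square)
        finally show "norm ((D y - D x) / (y - x)) \<le> \<bar>K\<bar> * \<bar>y - x\<bar>"
          using y by (simp add: pos_divide_le_eq)
      qed
      show "((\<lambda>y. \<bar>K\<bar> * \<bar>y - x\<bar>) \<longlongrightarrow> 0) (at x within {0..T})"
        by (auto intro!: tendsto_eq_intros)
    qed
    then show "(D has_field_derivative 0) (at x within {0..T})" by (simp add: has_field_derivative_iff)
  qed simp
  then show ?thesis using t by auto
qed

text \<open>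
  The product rule for Lipschitz functions given by densities.  Over an interval of length \<open>t - s\<close> the two
  sides change by amounts that differ by \<open>O((t - s)\<^sup>2)\<close>, hence their difference is constant.
\<close>

lemma primitive_product:
  fixes c1 c2 :: real
  assumes F1: "bounded_measurable F1" and F2: "bounded_measurable F2" and t: "t \<in> {0..T}"
  defines "P1 \<equiv> \<lambda>t. c1 + integral {0..t} F1" and "P2 \<equiv> \<lambda>t. c2 + integral {0..t} F2"
  shows "P1 t * P2 t = c1 * c2 + integral {0..t} (\<lambda>r. P1 r * F2 r + P2 r * F1 r)"
proof -
  obtain B1 B2 where B: "\<And>t. \<bar>F1 t\<bar> \<le> B1" "\<And>t. \<bar>F2 t\<bar> \<le> B2" using F1 F2 by (auto simp: bounded_measurable_def)
  have B0: "0 \<le> B1" "0 \<le> B2" using B[of 0] by linarith+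
  define H where "H r = P1 r * F2 r + P2 r * F1 r" for r
  have cP: "continuous_on {0..T} P1" "continuous_on {0..T} P2"
    unfolding P1_def P2_def by (intro continuous_intros primitive_continuous F1 F2)+
  define H' where "H' r = (if r \<in> {0..T} then P1 r else 0) * F2 r + (if r \<in> {0..T} then P2 r else 0) * F1 r" for r
  have bH': "bounded_measurable H'"
    unfolding H'_def by (intro bounded_measurable_arith bounded_measurable_Icc cP F1 F2)
  have Hi: "H integrable_on {a..b}" if "0 \<le> a" "b \<le> T" for a b
    by (rule integrable_eq[OF bounded_measurable_integrable(1)[OF bH']]) (use that in \<open>auto simp: H_def H'_def\<close>)
  define D where "D t = P1 t * P2 t - integral {0..t} H" for t
  have "\<bar>D t - D s\<bar> \<le> (2 * B1 * B2) * (t - s)\<^sup>2" if st: "0 \<le> s" "s \<le> t" "t \<le> T" for s t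
  proof -
    have HH: "integral {0..t} H - integral {0..s} H = integral {s..t} H"
      using Henstock_Kurzweil_Integration.integral_combine[OF st(1,2) Hi] st by simp
    have d1: "P1 t - P1 s = integral {s..t} F1" and d2: "P2 t - P2 s = integral {s..t} F2"
      unfolding P1_def P2_def using primitive_Lipschitz(2)[OF F1 B(1) st(1,2)] primitive_Lipschitz(2)[OF F2 B(2) st(1,2)] by simp_all
    note i1 = bounded_measurable_integrable(1)[OF F1, of s t] and i2 = bounded_measurable_integrable(1)[OF F2, of s t]
    have "P1 t * P2 t - P1 s * P2 s = P1 t * (P2 t - P2 s) + P2 s * (P1 t - P1 s)" by (simp add: algebra_simps)
    also have "\<dots> = integral {s..t} (\<lambda>r. P1 t * F2 r + P2 s * F1 r)"
      unfolding d1 d2 using i1 i2 by (subst Henstock_Kurzweil_Integration.integral_add) (auto intro: integrable_on_mult_right)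
    finally have "D t - D s = integral {s..t} (\<lambda>r. P1 t * F2 r + P2 s * F1 r) - integral {s..t} H"
      unfolding D_def HH[symmetric] by simp
    also have "\<dots> = integral {s..t} (\<lambda>r. (P1 t * F2 r + P2 s * F1 r) - H r)"
      using i1 i2 Hi st by (intro Henstock_Kurzweil_Integration.integral_diff[symmetric]) (auto intro!: integrable_add integrable_on_mult_right)
    finally have eq: "D t - D s = integral {s..t} (\<lambda>r. (P1 t * F2 r + P2 s * F1 r) - H r)" .
    have "norm (integral {s..t} (\<lambda>r. (P1 t * F2 r + P2 s * F1 r) - H r)) \<le> integral {s..t} (\<lambda>_. 2 * B1 * B2 * (t - s))"
    proof (rule integral_norm_bound_integral)
      show "(\<lambda>r. (P1 t * F2 r + P2 s * F1 r) - H r) integrable_on {s..t}"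
        using i1 i2 Hi st by (auto intro!: integrable_diff integrable_add integrable_on_mult_right)
      fix r assume r: "r \<in> {s..t}"
      have 1: "\<bar>P1 t - P1 r\<bar> \<le> B1 * (t - s)"
      proof -
        have "\<bar>P1 t - P1 r\<bar> \<le> B1 * (t - r)"
          unfolding P1_def using primitive_Lipschitz(1)[OF F1 B(1), of r t] r st by simp
        also have "\<dots> \<le> B1 * (t - s)" using r B0 by (intro mult_left_mono) auto
        finally show ?thesis .
      qed
      have 2: "\<bar>P2 s - P2 r\<bar> \<le> B2 * (t - s)"
      proof -
        have "\<bar>P2 r - P2 s\<bar> \<le> B2 * (r - s)"
          unfolding P2_def using primitive_Lipschitz(1)[OF F2 B(2), of s r] r st by simp
        also have "\<dots> \<le> B2 * (t - s)" using r B0 by (intro mult_left_mono) auto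
        finally show ?thesis by (simp add: abs_minus_commute)
      qed
      have "(P1 t * F2 r + P2 s * F1 r) - H r = (P1 t - P1 r) * F2 r + (P2 s - P2 r) * F1 r"
        by (simp add: H_def algebra_simps)
      also have "\<bar>\<dots>\<bar> \<le> \<bar>P1 t - P1 r\<bar> * \<bar>F2 r\<bar> + \<bar>P2 s - P2 r\<bar> * \<bar>F1 r\<bar>"
        by (rule order_trans[OF abs_triangle_ineq]) (simp add: abs_mult)
      also have "\<dots> \<le> (B1 * (t - s)) * B2 + (B2 * (t - s)) * B1"
        using 1 2 B B0 st by (intro add_mono mult_mono) auto
      finally show "norm ((P1 t * F2 r + P2 s * F1 r) - H r) \<le> 2 * B1 * B2 * (t - s)"
        by (simp add: algebra_simps)
    qed (rule integrable_const_ivl)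
    then show ?thesis using st by (simp add: eq power2_eq_square algebra_simps)
  qed
  from constant_if_square_modulus[of T D, OF this t] have "D t = D 0" .
  then show ?thesis by (simp add: D_def P1_def P2_def H_def[abs_def])
qed

text \<open>
  Almost every point is a Lebesgue point of \<open>b\<close>.
\<close>

lemma zero_of_interval_integrals:
  assumes b: "bounded_measurable b" and 0: "\<And>c d. 0 < c \<Longrightarrow> c < d \<Longrightarrow> d < T \<Longrightarrow> integral {c..d} b = 0"
  shows "AE t in lebesgue_on {0<..<T}. b t = 0"
proof -
  have "b integrable_on cbox c d" for c d
    using bounded_measurable_integrable(1)[OF b] by simp
  from integrable_ccontinuous_explicit[OF this] obtain N where N: "negligible N"
    "\<And>x e. x \<notin> N \<Longrightarrow> 0 < e \<Longrightarrow> \<exists>d>0. \<forall>h. 0 < h \<and> h < d \<longrightarrow>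
       norm (integral (cbox x (x + h *\<^sub>R One)) b /\<^sub>R h ^ DIM(real) - b x) < e" by blast
  have "b x = 0" if x: "x \<notin> N" "x \<in> {0<..<T}" for x
  proof (rule ccontr)
    assume "b x \<noteq> 0"
    then obtain d where d: "d > 0" "\<And>h. 0 < h \<and> h < d \<Longrightarrow> norm (integral {x..x + h} b /\<^sub>R h - b x) < \<bar>b x\<bar>"
      using N(2)[OF x(1), of "\<bar>b x\<bar>"] by auto
    define h where "h = min (d / 2) ((T - x) / 2)"
    have h: "0 < h" "h < d" "x + h < T" using d x by (auto simp: h_def min_def field_simps)
    then have "integral {x..x + h} b = 0" using x by (intro 0) auto
    then show False using d(2)[of h] h by simp
  qed
  then have "AE x in lebesgue. x \<in> {0<..<T} \<longrightarrow> b x = 0"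
    using N(1) by (intro AE_I[of _ _ N]) (auto simp: negligible_iff_null_sets null_sets_def)
  then show ?thesis by (subst AE_restrict_space_iff) auto
qed

lemma bump_antiderivative: "\<exists>h. \<forall>x. (h has_real_derivative bump c d n x) (at x)"
proof -
  have "isCont (bump c d n) x" for x
    using C_k_bump[of 0 c d n] by (simp add: continuous_on_eq_continuous_at)
  then have "\<exists>h. \<forall>x. -\<infinity> < ereal x \<longrightarrow> ereal x < \<infinity> \<longrightarrow> (h has_vector_derivative bump c d n x) (at x)"
    by (intro einterval_antiderivative) auto
  then show ?thesis by (auto simp: has_real_derivative_iff_has_vector_derivative)
qed

text \<open>
  The antiderivatives of bumps that vanish at \<open>T\<close> are admissible, and their value at 0 is minus the
  integral of the bump.  The product rule moves the derivative from \<open>\<eta>\<close> to the primitive of \<open>F\<close>, so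
  that \<open>a - a0\<close> minus this primitive is orthogonal to all bumps, hence to all indicators of intervals.
\<close>

lemma du_Bois_Reymond:
  assumes a: "bounded_measurable a" and F: "bounded_measurable F"
    and weak: "\<And>\<eta> \<eta>' S. smooth \<eta> \<Longrightarrow> (\<And>t. (\<eta> has_real_derivative \<eta>' t) (at t)) \<Longrightarrow> S < T \<Longrightarrow>
      (\<And>t. S \<le> t \<Longrightarrow> \<eta> t = 0) \<Longrightarrow> (LINT t|lebesgue_on {0<..<T}. a t * \<eta>' t + F t * \<eta> t) = - a0 * \<eta> 0"
  shows "AE t in lebesgue_on {0<..<T}. a t = a0 + integral {0..t} F"
proof -
  define P where "P t = (if t \<in> {0..T} then 0 + integral {0..t} F else 0)" for t
  have bP: "bounded_measurable P"
    unfolding P_def by (intro bounded_measurable_Icc continuous_intros primitive_continuous F)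
  define b where "b t = a t - (a0 + P t)" for t
  have bb: "bounded_measurable b"
    unfolding b_def by (intro bounded_measurable_arith a bP bounded_measurable_const)
  have bumpi: "bounded_measurable (bump c d n)" for c d n
    unfolding bounded_measurable_def
    using C_k_bump[of 0 c d n] bump_bounds[of c d n]
    by (auto intro!: exI[of _ 1] borel_measurable_continuous_onI measurable_completion)
  \<comment> \<open>\<open>b\<close> is orthogonal to all bumps\<close>
  have bump0: "integral {0..T} (\<lambda>t. b t * bump c d n t) = 0" if cd: "0 < c" "c < d" "d < T" for c d n
  proof -
    let ?g = "bump c d n"
    obtain h where h: "\<And>x. (h has_real_derivative ?g x) (at x)" using bump_antiderivative by blast
    define \<eta> where "\<eta> t = h t - h T" for t
    have D\<eta>: "(\<eta> has_real_derivative ?g t) (at t)" for t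
      unfolding \<eta>_def by (rule derivative_eq_intros h refl | simp)+
    have sm: "smooth \<eta>" by (rule smooth_antiderivative[OF C_k_bump D\<eta>])
    have ftc: "\<eta> t = \<eta> s + integral {s..t} ?g" if "s \<le> t" for s t
    proof -
      have "(?g has_integral \<eta> t - \<eta> s) {s..t}"
        using that by (intro fundamental_theorem_of_calculus)
          (auto intro: D\<eta>[THEN has_field_derivative_at_within] simp flip: has_real_derivative_iff_has_vector_derivative)
      then show ?thesis by (simp add: integral_unique)
    qed
    have vanish: "\<eta> t = 0" if "d \<le> t" for t
    proof -
      have "integral {r..s} ?g = integral {r..s} (\<lambda>_. 0)" if "d \<le> r" for r s
        using that by (intro Henstock_Kurzweil_Integration.integral_cong) (auto simp: bump_eq_0)
      then have 0: "integral {r..s} ?g = 0" if "d \<le> r" for r s using that by simp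
      have T: "\<eta> T = 0" by (simp add: \<eta>_def)
      show ?thesis
      proof (cases "t \<le> T")
        case True
        show ?thesis using ftc[OF True] 0[OF that, of T] T by linarith
      next
        case False
        then show ?thesis using ftc[of T t] 0[of T t] cd T by linarith
      qed
    qed
    define \<eta>' where "\<eta>' t = (if t \<in> {0..T} then \<eta> 0 + integral {0..t} ?g else 0)" for t
    have b\<eta>': "bounded_measurable \<eta>'"
      unfolding \<eta>'_def by (intro bounded_measurable_Icc continuous_intros primitive_continuous bumpi)
    have \<eta>': "\<eta>' t = \<eta> t" if "t \<in> {0..T}" for t using ftc[of 0 t] that by (simp add: \<eta>'_def)
    have "- a0 * \<eta> 0 = (LINT t|lebesgue_on {0<..<T}. a t * ?g t + F t * \<eta> t)"
      using weak[OF sm D\<eta> cd(3) vanish] by simp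
    also have "\<dots> = (LINT t|lebesgue_on {0<..<T}. a t * ?g t + F t * \<eta>' t)"
      by (rule Bochner_Integration.integral_cong) (auto simp: \<eta>')
    also have "\<dots> = integral {0..T} (\<lambda>t. a t * ?g t + F t * \<eta>' t)"
      by (intro bounded_measurable_lebesgue_integral bounded_measurable_arith a F b\<eta>' bumpi)
    also have "\<dots> = integral {0..T} (\<lambda>t. a t * ?g t) + integral {0..T} (\<lambda>t. F t * \<eta>' t)"
      by (intro Henstock_Kurzweil_Integration.integral_add bounded_measurable_integrable bounded_measurable_arith a F b\<eta>' bumpi)
    finally have 1: "- a0 * \<eta> 0 = integral {0..T} (\<lambda>t. a t * ?g t) + integral {0..T} (\<lambda>t. F t * \<eta>' t)" .
    have "(0 + integral {0..T} F) * (\<eta> 0 + integral {0..T} ?g)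
       = 0 * \<eta> 0 + integral {0..T} (\<lambda>r. (0 + integral {0..r} F) * ?g r + (\<eta> 0 + integral {0..r} ?g) * F r)"
      by (rule primitive_product[OF F bumpi, of T T]) (use cd in auto)
    also have "\<dots> = integral {0..T} (\<lambda>r. P r * ?g r + F r * \<eta>' r)"
      by (simp, rule Henstock_Kurzweil_Integration.integral_cong) (auto simp: P_def \<eta>'_def)
    also have "\<dots> = integral {0..T} (\<lambda>t. P t * ?g t) + integral {0..T} (\<lambda>t. F t * \<eta>' t)"
      by (intro Henstock_Kurzweil_Integration.integral_add bounded_measurable_integrable bounded_measurable_arith bP F b\<eta>' bumpi)
    also have "\<eta> 0 + integral {0..T} ?g = 0" using ftc[of 0 T] vanish[of T] cd by simp
    finally have 2: "integral {0..T} (\<lambda>t. P t * ?g t) + integral {0..T} (\<lambda>t. F t * \<eta>' t) = 0" by simp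
    have 3: "\<eta> 0 = - integral {0..T} ?g" using ftc[of 0 T] vanish[of T] cd by simp
    have "integral {0..T} (\<lambda>t. b t * ?g t) = integral {0..T} (\<lambda>t. a t * ?g t - (a0 * ?g t + P t * ?g t))"
      by (simp add: b_def algebra_simps)
    also have "\<dots> = integral {0..T} (\<lambda>t. a t * ?g t) - (integral {0..T} (\<lambda>t. a0 * ?g t) + integral {0..T} (\<lambda>t. P t * ?g t))"
    proof -
      note i = bounded_measurable_integrable(1)[OF bounded_measurable_arith(3)[OF _ bumpi[of c d n]], of _ 0 T]
      show ?thesis
        using i[OF a] i[OF bP] i[OF bounded_measurable_const[of a0]]
        by (simp only: Henstock_Kurzweil_Integration.integral_diff Henstock_Kurzweil_Integration.integral_add integrable_add)
    qed
    also have "\<dots> = 0" using 1 2 3 by simp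
    finally show ?thesis .
  qed
  have int0: "integral {c..d} b = 0" if cd: "0 < c" "c < d" "d < T" for c d
  proof -
    obtain C where C: "\<And>t. \<bar>b t\<bar> \<le> C" using bb by (auto simp: bounded_measurable_def)
    have "(\<lambda>n. integral {0..T} (\<lambda>t. b t * bump c d n t)) \<longlonglongrightarrow> integral {0..T} (\<lambda>t. b t * indicator {c<..<d} t)"
    proof (rule dominated_convergence(2)[where h="\<lambda>_. C"])
      show "(\<lambda>t. b t * bump c d n t) integrable_on {0..T}" for n
        by (intro bounded_measurable_integrable bounded_measurable_arith bb bumpi)
      show "norm (b t * bump c d n t) \<le> C" for n t
      proof -
        have "\<bar>b t\<bar> * \<bar>bump c d n t\<bar> \<le> C * 1"
          using C[of t] bump_bounds[of c d n t] by (intro mult_mono) auto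
        then show ?thesis by (simp add: abs_mult)
      qed
      show "(\<lambda>n. b t * bump c d n t) \<longlonglongrightarrow> b t * indicator {c<..<d} t" for t
        by (intro tendsto_intros bump_tendsto)
    qed (rule integrable_const_ivl)
    then have "(\<lambda>n. 0) \<longlonglongrightarrow> integral {0..T} (\<lambda>t. b t * indicator {c<..<d} t)"
      by (simp only: bump0[OF cd])
    from LIMSEQ_unique[OF this tendsto_const]
    have "integral {0..T} (\<lambda>t. b t * indicator {c<..<d} t) = 0" .
    moreover have "(\<lambda>t. b t * indicator {c<..<d} t) = (\<lambda>t. if t \<in> {c<..<d} then b t else 0)" by (auto simp: indicator_def)
    ultimately have "integral {c<..<d} b = 0"
      using cd integral_restrict_Int[of "{0..T}" "{c<..<d}" b] by (simp add: Int_absorb2 subset_eq)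
    then show ?thesis by (simp add: integral_open_interval_real)
  qed
  have "AE t in lebesgue_on {0<..<T}. b t = 0" by (rule zero_of_interval_integrals[OF bb int0])
  moreover have "AE t in lebesgue_on {0<..<T}. t \<in> {0<..<T}"
    by (rule AE_I2) auto
  ultimately show ?thesis by eventually_elim (auto simp: b_def P_def)
qed

section \<open>Evolution of the Fourier modes and of the energy\<close>

text \<open>
  The projection of a basis vector to the divergence-free directions at a frequency.  At frequency 0 the
  convention \<open>x / 0 = 0\<close> yields the basis vector itself, as it should.
\<close>

definition projected_axis :: "int ^ 3 \<Rightarrow> 3 \<Rightarrow> R3" where
  "projected_axis k j = axis j 1 - (frequency k $ j / (frequency k \<bullet> frequency k)) *\<^sub>R frequency k"

lemma projected_axis_orthogonal: "projected_axis k j \<bullet> frequency k = 0"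
  by (cases "frequency k = 0") (simp_all add: projected_axis_def inner_diff_left inner_axis inner_commute[of "axis j 1"])

lemma inner_projected_axis: "a \<bullet> frequency k = 0 \<Longrightarrow> a \<bullet> projected_axis k j = a $ j"
  by (simp add: projected_axis_def inner_diff_right inner_axis)

text \<open>
  The projection is symmetric, and \<open>a\<close> is fixed by it.
\<close>

lemma sum_projected_axis:
  assumes "a \<bullet> frequency k = 0"
  shows "(\<Sum>j\<in>UNIV. a $ j * (b \<bullet> projected_axis k j)) = a \<bullet> b"
proof -
  have "a $ j * (b \<bullet> projected_axis k j)
      = a $ j * b $ j - a $ j * frequency k $ j * ((b \<bullet> frequency k) / (frequency k \<bullet> frequency k))" for j
    by (simp add: projected_axis_def inner_diff_right inner_axis right_diff_distrib)
  then have "(\<Sum>j\<in>UNIV. a $ j * (b \<bullet> projected_axis k j))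
      = (\<Sum>j\<in>UNIV. a $ j * b $ j) - (\<Sum>j\<in>UNIV. a $ j * frequency k $ j) * ((b \<bullet> frequency k) / (frequency k \<bullet> frequency k))"
    by (simp only: sum_subtractf sum_distrib_right)
  also have "(\<Sum>j\<in>UNIV. a $ j * frequency k $ j) = 0" using assms by (simp add: inner_vec_def)
  finally show ?thesis by (simp add: inner_vec_def)
qed

text \<open>
  The divergence is \<open>- \<eta> t * sin (\<xi> \<bullet> x + \<theta>) * (P \<bullet> \<xi>)\<close>.
\<close>

lemma test_field_mode:
  assumes \<eta>: "smooth \<eta>" and S: "S < T" "\<And>t. S \<le> t \<Longrightarrow> \<eta> t = 0" and P: "P \<bullet> frequency k = 0"
  shows "test_field T (\<lambda>t x. \<eta> t *\<^sub>R (cos (frequency k \<bullet> x + \<theta>) *\<^sub>R P))"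
    and "partial j (\<lambda>x. \<eta> t *\<^sub>R (cos (frequency k \<bullet> x + \<theta>) *\<^sub>R P)) x $ i
       = \<eta> t * (- sin (frequency k \<bullet> x + \<theta>) * frequency k $ j * P $ i)"
proof -
  have D: "((\<lambda>x. \<eta> t *\<^sub>R (cos (frequency k \<bullet> x + \<theta>) *\<^sub>R P)) has_derivative
     (\<lambda>h. \<eta> t *\<^sub>R ((- sin (frequency k \<bullet> x + \<theta>) * (frequency k \<bullet> h)) *\<^sub>R P))) (at x)" for t x
    by (auto intro!: derivative_eq_intros simp: mult_ac)
  show par: "partial j (\<lambda>x. \<eta> t *\<^sub>R (cos (frequency k \<bullet> x + \<theta>) *\<^sub>R P)) x $ i
       = \<eta> t * (- sin (frequency k \<bullet> x + \<theta>) * frequency k $ j * P $ i)" for t x i j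
    unfolding partial_def frechet_derivative_at[OF D, symmetric] by (simp add: inner_axis)
  have "C_k m (\<lambda>p :: real \<times> R3. \<eta> (fst p + 0) *\<^sub>R (cos (frequency k \<bullet> snd p + \<theta>) *\<^sub>R P))" for m
  proof (intro C_k_scaleR C_k_const)
    show "C_k m (\<lambda>p :: real \<times> R3. \<eta> (fst p + 0))"
      by (rule C_k_compose_linear[OF bounded_linear_fst]) (use \<eta> in \<open>simp add: smooth_def\<close>)
    show "C_k m (\<lambda>p :: real \<times> R3. cos (frequency k \<bullet> snd p + \<theta>))"
      by (rule C_k_compose_linear[OF _ C_k_cos])
         (rule bounded_linear_compose[OF bounded_linear_inner_right bounded_linear_snd])
  qed
  then have "smooth (\<lambda>(t, x). \<eta> t *\<^sub>R (cos (frequency k \<bullet> x + \<theta>) *\<^sub>R P))"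
    by (simp add: smooth_def case_prod_beta')
  moreover have "torus_periodic (\<lambda>x. \<eta> t *\<^sub>R (cos (frequency k \<bullet> x + \<theta>) *\<^sub>R P))" for t
    by (simp add: torus_periodic_def cos_frequency_periodic)
  moreover have "div_free (\<lambda>x. \<eta> t *\<^sub>R (cos (frequency k \<bullet> x + \<theta>) *\<^sub>R P))" for t
  proof -
    have "(\<Sum>i\<in>UNIV. \<eta> t * (- sin (frequency k \<bullet> x + \<theta>) * frequency k $ i * P $ i))
       = \<eta> t * (- sin (frequency k \<bullet> x + \<theta>) * (P \<bullet> frequency k))" for x
      unfolding inner_vec_def[of P "frequency k"] sum_distrib_left by (intro sum.cong) (simp_all add: mult_ac)
    then show ?thesis unfolding div_free_def par using P by simp
  qed
  ultimately show "test_field T (\<lambda>t x. \<eta> t *\<^sub>R (cos (frequency k \<bullet> x + \<theta>) *\<^sub>R P))"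
    unfolding test_field_def using S by auto
qed

text \<open>
  A weak Euler solution after removal of a null set of irregular times, at which \<open>u\<close> is set to 0: then
  the estimates hold at every time, and \<open>u\<close> is jointly Borel measurable.  The exponent \<open>\<gamma>\<close> of the cubic
  increments is limited by 2 because the kernel moments of order at most 2 in \<open>cos_gap\<close> are used.
\<close>

locale onsager =
  fixes T \<gamma> M :: real and u :: "real \<Rightarrow> R3 \<Rightarrow> R3" and u0 :: "R3 \<Rightarrow> R3" and G :: "real \<Rightarrow> real"
  assumes T: "0 < T" and \<gamma>: "1 < \<gamma>" "\<gamma> \<le> 2"
    and measurable_u: "(\<lambda>p. u (fst p) (snd p)) \<in> borel_measurable borel"
    and H: "H_field (u t)" and H0: "H_field u0"
    and L3: "L3_field (u t)"
    and M: "(LINT x|torus. (norm (u t x))\<^sup>2) \<le> M"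
    and G: "0 \<le> G t" "integrable (lebesgue_on {0<..<T}) G"
    and inc: "integrable torus (\<lambda>y. norm (u t (z + y) - u t y) ^ 3)"
      "(LINT y|torus. norm (u t (z + y) - u t y) ^ 3) \<le> G t * norm z powr \<gamma>"
    and weak: "test_field T \<phi> \<Longrightarrow>
      (LINT t|lebesgue_on {0<..<T}. LINT x|torus. u t x \<bullet> vector_derivative (\<lambda>s. \<phi> s x) (at t) +
           (\<Sum>i\<in>UNIV. \<Sum>j\<in>UNIV. u t x $ i * u t x $ j * partial j (\<phi> t) x $ i))
        = - (LINT x|torus. u0 x \<bullet> \<phi> 0 x)"
begin

lemma L2: "L2_field (u t)" and L20: "L2_field u0" and div: "weakly_div_free (u t)" and div0: "weakly_div_free u0"
  using H[of t] H0 H_field_weak_div_free by (auto simp: H_field_def weakly_div_free_def)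

definition force :: "int ^ 3 \<Rightarrow> real \<Rightarrow> R3 \<Rightarrow> real \<Rightarrow> real" where
  "force k \<theta> P t = mode_force k \<theta> (u t) \<bullet> P"

lemma parametric_integral_measurable:
  fixes f :: "real \<Rightarrow> R3 \<Rightarrow> 'b::{banach, second_countable_topology}"
  assumes "(\<lambda>p. f (fst p) (snd p)) \<in> borel_measurable borel"
  shows "(\<lambda>t::real. LINT x|torus. f t x) \<in> borel_measurable lebesgue"
proof -
  have "(\<lambda>p. (fst p, snd p)) \<in> measurable (lebesgue \<Otimes>\<^sub>M torus) (borel \<Otimes>\<^sub>M borel)"
    by (intro measurable_Pair measurable_compose[OF measurable_fst] measurable_compose[OF measurable_snd measurable_torus_ident]) 
       (auto intro: measurable_completion)
  from measurable_compose[OF this, of "\<lambda>p. f (fst p) (snd p)" borel]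
  have "(\<lambda>(t, x). f t x) \<in> borel_measurable (lebesgue \<Otimes>\<^sub>M torus)"
    using assms by (simp add: borel_prod case_prod_beta')
  from torus.borel_measurable_lebesgue_integral[OF this] show ?thesis by simp
qed

lemma mode_bound: "norm (mode k \<theta> (u t)) \<le> measure torus period_cube + M"
proof -
  have u2: "integrable torus (\<lambda>x. (norm (u t x))\<^sup>2)" using L2[of t] by (simp add: L2_field_def)
  have le: "norm (cos (frequency k \<bullet> x + \<theta>) *\<^sub>R u t x) \<le> 1 + (norm (u t x))\<^sup>2" for x
  proof -
    have "norm (cos (frequency k \<bullet> x + \<theta>) *\<^sub>R u t x) \<le> norm (u t x)" by (simp add: mult_left_le_one_le)
    also have "\<dots> \<le> 1 + (norm (u t x))\<^sup>2"
    proof -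
      have "2 * norm (u t x) \<le> 1 + (norm (u t x))\<^sup>2" using sum_squares_bound[of 1 "norm (u t x)"] by simp
      then show ?thesis using norm_ge_zero[of "u t x"] by linarith
    qed
    finally show ?thesis .
  qed
  have "norm (mode k \<theta> (u t)) \<le> (LINT x|torus. 1 + (norm (u t x))\<^sup>2)"
    unfolding mode_def
    by (rule order_trans[OF integral_norm_bound integral_mono[OF integrable_norm[OF mode_integrable(1)[OF L2]] _ le]])
       (use u2 in simp)
  also have "\<dots> = measure torus period_cube + (LINT x|torus. (norm (u t x))\<^sup>2)"
    using u2 by simp
  finally show ?thesis using M[of t] by simp
qed

lemma mode_bounded_measurable: "bounded_measurable (\<lambda>t. mode k \<theta> (u t) \<bullet> P)"
proof -
  have [measurable]: "(\<lambda>p. u (fst p) (snd p)) \<in> borel_measurable borel" by (rule measurable_u)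
  have "(\<lambda>p. cos (frequency k \<bullet> snd p + \<theta>) *\<^sub>R u (fst p) (snd p)) \<in> borel_measurable (borel :: (real \<times> R3) measure)"
    by measurable
  from parametric_integral_measurable[OF this]
  have "(\<lambda>t. mode k \<theta> (u t) \<bullet> P) \<in> borel_measurable lebesgue" by (simp add: mode_def)
  moreover have "\<bar>mode k \<theta> (u t) \<bullet> P\<bar> \<le> (measure torus period_cube + M) * norm P" for t
    by (rule order_trans[OF Cauchy_Schwarz_ineq2 mult_right_mono[OF mode_bound]]) simp
  ultimately show ?thesis by (auto simp: bounded_measurable_def)
qed

lemma force_bounded_measurable: "bounded_measurable (force k \<theta> P)"
proof -
  have [measurable]: "(\<lambda>p. u (fst p) (snd p)) \<in> borel_measurable borel" by (rule measurable_u)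
  have "(\<lambda>p. (- sin (frequency k \<bullet> snd p + \<theta>) * (u (fst p) (snd p) \<bullet> frequency k)) *\<^sub>R u (fst p) (snd p)) \<in> borel_measurable (borel :: (real \<times> R3) measure)"
    by measurable
  from parametric_integral_measurable[OF this]
  have "force k \<theta> P \<in> borel_measurable lebesgue" by (simp add: force_def[abs_def] mode_force_def)
  moreover have "\<bar>force k \<theta> P t\<bar> \<le> norm (frequency k) * M * norm P" for t
    unfolding force_def
    by (rule order_trans[OF Cauchy_Schwarz_ineq2 mult_right_mono[OF order_trans[OF mode_integrable(3)[OF L2]]]])
       (auto intro: mult_left_mono M)
  ultimately show ?thesis by (auto simp: bounded_measurable_def)
qed

text \<open>
  The weak formulation with the test fields \<open>\<eta> t * cos (\<xi> \<bullet> x + \<theta>) P\<close> is the weak form, in time, of an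
  ordinary differential equation for the mode.
\<close>

lemma mode_evolution:
  assumes P: "P \<bullet> frequency k = 0"
  shows "AE t in lebesgue_on {0<..<T}. mode k \<theta> (u t) \<bullet> P = mode k \<theta> u0 \<bullet> P + integral {0..t} (force k \<theta> P)"
proof (rule du_Bois_Reymond[OF mode_bounded_measurable force_bounded_measurable])
  fix \<eta> \<eta>' :: "real \<Rightarrow> real" and S
  assume \<eta>: "smooth \<eta>" and D: "\<And>t. (\<eta> has_real_derivative \<eta>' t) (at t)" and S: "S < T" "\<And>t. S \<le> t \<Longrightarrow> \<eta> t = 0"
  let ?c = "\<lambda>x. cos (frequency k \<bullet> x + \<theta>)" and ?s = "\<lambda>x. sin (frequency k \<bullet> x + \<theta>)"
  let ?\<phi> = "\<lambda>t x. \<eta> t *\<^sub>R (?c x *\<^sub>R P)"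
  note tf = test_field_mode[OF \<eta> S P, where \<theta>=\<theta>]
  have vd: "vector_derivative (\<lambda>s. ?\<phi> s x) (at t) = \<eta>' t *\<^sub>R (?c x *\<^sub>R P)" for t x
    by (rule vector_derivative_at)
       (use has_vector_derivative_scaleR[OF D[of t] has_vector_derivative_const[of "?c x *\<^sub>R P"]] in simp)
  have inner: "(LINT x|torus. u t x \<bullet> vector_derivative (\<lambda>s. ?\<phi> s x) (at t) +
           (\<Sum>i\<in>UNIV. \<Sum>j\<in>UNIV. u t x $ i * u t x $ j * partial j (?\<phi> t) x $ i))
       = (mode k \<theta> (u t) \<bullet> P) * \<eta>' t + force k \<theta> P t * \<eta> t" for t
  proof -
    have "u t x \<bullet> vector_derivative (\<lambda>s. ?\<phi> s x) (at t) +
           (\<Sum>i\<in>UNIV. \<Sum>j\<in>UNIV. u t x $ i * u t x $ j * partial j (?\<phi> t) x $ i)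
       = ((?c x *\<^sub>R u t x) \<bullet> P) * \<eta>' t + (((- ?s x * (u t x \<bullet> frequency k)) *\<^sub>R u t x) \<bullet> P) * \<eta> t" for x
    proof -
      have "(\<Sum>i\<in>UNIV. \<Sum>j\<in>UNIV. u t x $ i * u t x $ j * partial j (?\<phi> t) x $ i)
         = (\<Sum>i\<in>UNIV. \<Sum>j\<in>UNIV. (u t x $ i * P $ i) * (u t x $ j * frequency k $ j)) * (- ?s x * \<eta> t)"
      proof -
        have t2: "partial j (?\<phi> t) x $ i = \<eta> t * (- ?s x * frequency k $ j * P $ i)" for i j by (rule tf(2))
        show ?thesis unfolding sum_distrib_right by (intro sum.cong refl) (simp only: t2 mult_ac)
      qed
      also have "\<dots> = (u t x \<bullet> P) * (u t x \<bullet> frequency k) * (- ?s x * \<eta> t)"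
        by (simp add: inner_vec_def sum_product)
      finally have sm: "(\<Sum>i\<in>UNIV. \<Sum>j\<in>UNIV. u t x $ i * u t x $ j * partial j (?\<phi> t) x $ i)
         = (u t x \<bullet> P) * (u t x \<bullet> frequency k) * (- ?s x * \<eta> t)" .
      show ?thesis unfolding sm vd by (simp add: mult_ac)
    qed
    then have "(LINT x|torus. u t x \<bullet> vector_derivative (\<lambda>s. ?\<phi> s x) (at t) +
           (\<Sum>i\<in>UNIV. \<Sum>j\<in>UNIV. u t x $ i * u t x $ j * partial j (?\<phi> t) x $ i))
       = (LINT x|torus. ((?c x *\<^sub>R u t x) \<bullet> P) * \<eta>' t + (((- ?s x * (u t x \<bullet> frequency k)) *\<^sub>R u t x) \<bullet> P) * \<eta> t)"
      by simp
    also have "\<dots> = (LINT x|torus. (?c x *\<^sub>R u t x) \<bullet> P) * \<eta>' t + (LINT x|torus. ((- ?s x * (u t x \<bullet> frequency k)) *\<^sub>R u t x) \<bullet> P) * \<eta> t"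
    proof -
      have "integrable torus (\<lambda>x. (?c x *\<^sub>R u t x) \<bullet> P)" "integrable torus (\<lambda>x. ((- ?s x * (u t x \<bullet> frequency k)) *\<^sub>R u t x) \<bullet> P)"
        by (intro integrable_inner_left mode_integrable L2)+
      then show ?thesis
        by (subst Bochner_Integration.integral_add) (simp_all only: integrable_mult_left integral_mult_left_zero)
    qed
    also have "\<dots> = (mode k \<theta> (u t) \<bullet> P) * \<eta>' t + force k \<theta> P t * \<eta> t"
      unfolding mode_def force_def mode_force_def
      by (simp only: integral_inner_left[OF mode_integrable(1)[OF L2]] integral_inner_left[OF mode_integrable(2)[OF L2]])
    finally show ?thesis .
  qed
  have "(LINT t|lebesgue_on {0<..<T}. (mode k \<theta> (u t) \<bullet> P) * \<eta>' t + force k \<theta> P t * \<eta> t) = - (LINT x|torus. u0 x \<bullet> ?\<phi> 0 x)"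
    using weak[OF tf(1)] unfolding inner .
  also have "(LINT x|torus. u0 x \<bullet> ?\<phi> 0 x) = (LINT x|torus. \<eta> 0 * ((?c x *\<^sub>R u0 x) \<bullet> P))"
    by (simp add: mult_ac)
  also have "\<dots> = \<eta> 0 * (mode k \<theta> u0 \<bullet> P)"
    unfolding mode_def by (simp only: integral_mult_right_zero integral_inner_left[OF mode_integrable(1)[OF L20]])
  finally show "(LINT t|lebesgue_on {0<..<T}. (mode k \<theta> (u t) \<bullet> P) * \<eta>' t + force k \<theta> P t * \<eta> t) = - (mode k \<theta> u0 \<bullet> P) * \<eta> 0"
    by simp
qed

text \<open>
  The Lipschitz representative, in time, of a component of a mode.
\<close>

definition path :: "int ^ 3 \<Rightarrow> real \<Rightarrow> 3 \<Rightarrow> real \<Rightarrow> real" where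
  "path k \<theta> j t = mode k \<theta> u0 $ j + integral {0..t} (force k \<theta> (projected_axis k j))"

text \<open>
  The times at which all modes, of which there are countably many, agree with their representatives.
\<close>

definition good :: "real set" where
  "good = {t \<in> {0<..<T}. \<forall>k. \<forall>\<theta>\<in>{0, - pi / 2}. \<forall>j. mode k \<theta> (u t) $ j = path k \<theta> j t}"

lemma AE_good: "AE t in lebesgue_on {0<..<T}. t \<in> good"
proof -
  have "AE t in lebesgue_on {0<..<T}. mode k \<theta> (u t) $ j = path k \<theta> j t" for k \<theta> j
    using mode_evolution[OF projected_axis_orthogonal, of k \<theta> j]
    by eventually_elim (simp add: path_def inner_projected_axis[OF mode_orthogonal] L2 L20 div div0)
  then have "AE t in lebesgue_on {0<..<T}. \<forall>k. \<forall>j. mode k 0 (u t) $ j = path k 0 j t \<and> mode k (- pi / 2) (u t) $ j = path k (- pi / 2) j t"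
    by (simp add: AE_all_countable)
  moreover have "AE t in lebesgue_on {0<..<T}. t \<in> {0<..<T}" by (rule AE_I2) auto
  ultimately show ?thesis by eventually_elim (auto simp: good_def)
qed

text \<open>
  The solution together with the initial datum, which is prescribed as the value at time 0.
\<close>

definition curve :: "real \<Rightarrow> R3 \<Rightarrow> R3" where "curve t = (if t = 0 then u0 else u t)"

lemma curve_H: "H_field (curve t)" using H H0 by (simp add: curve_def)

lemma curve_L2: "L2_field (curve t)" using curve_H by (simp add: H_field_def)

lemma good_range: "t \<in> good \<Longrightarrow> 0 < t \<and> t < T" by (auto simp: good_def)

lemma curve_good: "t \<in> good \<Longrightarrow> curve t = u t" using good_range by (auto simp: curve_def)

lemma curve_mode:
  assumes "t \<in> insert 0 good" "\<theta> \<in> {0, - pi / 2}" shows "mode k \<theta> (curve t) $ j = path k \<theta> j t"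
  using assms by (auto simp: curve_def good_def path_def)

lemma path_continuous: "continuous_on {0..T} (path k \<theta> j)"
  unfolding path_def by (intro continuous_intros primitive_continuous force_bounded_measurable)

text \<open>
  For a single cosine, \<open>quad\<close> is the sum of the squares of the modes, and the product rule produces the
  scalar product of mode and force.  The projection in the evolution of the mode can be dropped there
  since the mode is orthogonal to the frequency.
\<close>

lemma quad_flux_identity:
  assumes "trig_pair f f'"
  shows "\<exists>R. bounded_measurable R \<and> (\<forall>t\<in>good. quad f (u t) - quad f u0 = integral {0..t} R) \<and>
    (\<forall>s\<in>good. R s = 2 * flux f' (u s))"
  using assms
proof induction
  case (trig_cos k)
  define r where "r \<theta> j s = 2 * ((if s \<in> {0..T} then path k \<theta> j s else 0) * force k \<theta> (projected_axis k j) s)" for \<theta> j s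
  have r: "bounded_measurable (r \<theta> j)" for \<theta> j
    unfolding r_def by (intro bounded_measurable_arith bounded_measurable_const bounded_measurable_Icc path_continuous force_bounded_measurable)
  define q where "q \<theta> s = r \<theta> 1 s + r \<theta> 2 s + r \<theta> 3 s" for \<theta> s
  have q: "bounded_measurable (q \<theta>)" for \<theta>
    unfolding q_def by (intro bounded_measurable_arith r)
  have sq: "(path k \<theta> j t)\<^sup>2 = (path k \<theta> j 0)\<^sup>2 + integral {0..t} (r \<theta> j)" if "t \<in> {0..T}" for \<theta> j t
  proof -
    have "(path k \<theta> j t) * (path k \<theta> j t) = mode k \<theta> u0 $ j * mode k \<theta> u0 $ j +
       integral {0..t} (\<lambda>s. path k \<theta> j s * force k \<theta> (projected_axis k j) s + path k \<theta> j s * force k \<theta> (projected_axis k j) s)"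
      unfolding path_def by (rule primitive_product[OF force_bounded_measurable force_bounded_measurable that])
    also have "integral {0..t} (\<lambda>s. path k \<theta> j s * force k \<theta> (projected_axis k j) s + path k \<theta> j s * force k \<theta> (projected_axis k j) s)
       = integral {0..t} (r \<theta> j)"
      using that by (intro Henstock_Kurzweil_Integration.integral_cong) (auto simp: r_def)
    finally show ?thesis by (simp add: power2_eq_square path_def)
  qed
  have nsq: "(norm (mode k \<theta> (u t)))\<^sup>2 - (norm (mode k \<theta> u0))\<^sup>2 = integral {0..t} (q \<theta>)"
    if t: "t \<in> good" and \<theta>: "\<theta> \<in> {0, - pi / 2}" for t \<theta>
  proof -
    have t': "t \<in> {0..T}" using good_range[OF t] by auto
    have m: "mode k \<theta> (u t) $ j = path k \<theta> j t" "mode k \<theta> u0 $ j = path k \<theta> j 0" for j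
      using curve_mode[where t=t and \<theta>=\<theta> and k=k and j=j] curve_mode[where t=0 and \<theta>=\<theta> and k=k and j=j] t \<theta> curve_good[OF t] by (auto simp: curve_def)
    have ns: "(norm a)\<^sup>2 = (a $ 1)\<^sup>2 + (a $ 2)\<^sup>2 + (a $ 3)\<^sup>2" for a :: R3
      unfolding power2_norm_eq_inner inner_vec_def by (simp add: sum_3 power2_eq_square)
    have "integral {0..t} (q \<theta>) = integral {0..t} (r \<theta> 1) + integral {0..t} (r \<theta> 2) + integral {0..t} (r \<theta> 3)"
      unfolding q_def using bounded_measurable_integrable(1)[OF r]
      by (simp add: Henstock_Kurzweil_Integration.integral_add integrable_add)
    then show ?thesis unfolding ns m using sq[OF t'] by simp
  qed
  have qf: "q \<theta> s = 2 * (mode k \<theta> (u s) \<bullet> mode_force k \<theta> (u s))" if s: "s \<in> good" and \<theta>: "\<theta> \<in> {0, - pi / 2}" for s \<theta>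
  proof -
    have m: "mode k \<theta> (u s) $ j = path k \<theta> j s" for j using s \<theta> by (auto simp: good_def)
    have "q \<theta> s = 2 * (\<Sum>j\<in>UNIV. mode k \<theta> (u s) $ j * (mode_force k \<theta> (u s) \<bullet> projected_axis k j))"
      using good_range[OF s] by (simp add: q_def r_def m sum_3 force_def)
    then show ?thesis using sum_projected_axis[OF mode_orthogonal[OF L2 div]] by simp
  qed
  show ?case
  proof (intro exI[of _ "\<lambda>s. q 0 s + q (- pi / 2) s"] conjI ballI)
    show "bounded_measurable (\<lambda>s. q 0 s + q (- pi / 2) s)" by (intro bounded_measurable_arith q)
    fix t assume t: "t \<in> good"
    have "integral {0..t} (\<lambda>s. q 0 s + q (- pi / 2) s) = integral {0..t} (q 0) + integral {0..t} (q (- pi / 2))"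
      by (intro Henstock_Kurzweil_Integration.integral_add bounded_measurable_integrable q)
    then show "quad (\<lambda>z. cos (frequency k \<bullet> z)) (u t) - quad (\<lambda>z. cos (frequency k \<bullet> z)) u0
       = integral {0..t} (\<lambda>s. q 0 s + q (- pi / 2) s)"
      unfolding quad_cos[OF L2] quad_cos[OF L20] using nsq[OF t, of 0] nsq[OF t, of "- pi / 2"] by simp
    show "q 0 t + q (- pi / 2) t = 2 * flux (\<lambda>z. - sin (frequency k \<bullet> z) *\<^sub>R frequency k) (u t)"
      unfolding flux_cos[OF L3] using qf[OF t, of 0] qf[OF t, of "- pi / 2"] by simp
  qed
next
  case (trig_add f f' g g')
  then obtain R S where R: "bounded_measurable R" "\<forall>t\<in>good. quad f (u t) - quad f u0 = integral {0..t} R" "\<forall>s\<in>good. R s = 2 * flux f' (u s)"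
    and S: "bounded_measurable S" "\<forall>t\<in>good. quad g (u t) - quad g u0 = integral {0..t} S" "\<forall>s\<in>good. S s = 2 * flux g' (u s)"
    by blast
  have t: "trig f" "trig g" using trig_add by (auto simp: trig_def)
  show ?case
  proof (intro exI[of _ "\<lambda>s. R s + S s"] conjI ballI)
    show "bounded_measurable (\<lambda>s. R s + S s)" by (intro bounded_measurable_arith R S)
    fix s assume s: "s \<in> good"
    have "integral {0..s} (\<lambda>s. R s + S s) = integral {0..s} R + integral {0..s} S"
      by (intro Henstock_Kurzweil_Integration.integral_add bounded_measurable_integrable R S)
    then show "quad (\<lambda>z. f z + g z) (u s) - quad (\<lambda>z. f z + g z) u0 = integral {0..s} (\<lambda>s. R s + S s)"
      using R(2)[rule_format, OF s] S(2)[rule_format, OF s] by (simp add: quad_linear(1)[OF L2 t] quad_linear(1)[OF L20 t])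
    show "R s + S s = 2 * flux (\<lambda>z. f' z + g' z) (u s)"
      using R(3) S(3) s by (simp add: flux_linear(1)[OF L3 trig_add.hyps])
  qed
next
  case (trig_scale f f' c)
  then obtain R where R: "bounded_measurable R" "\<forall>t\<in>good. quad f (u t) - quad f u0 = integral {0..t} R" "\<forall>s\<in>good. R s = 2 * flux f' (u s)"
    by blast
  have t: "trig f" using trig_scale by (auto simp: trig_def)
  show ?case
  proof (intro exI[of _ "\<lambda>s. c * R s"] conjI ballI)
    show "bounded_measurable (\<lambda>s. c * R s)" by (intro bounded_measurable_arith bounded_measurable_const R)
    fix s assume s: "s \<in> good"
    show "quad (\<lambda>z. c * f z) (u s) - quad (\<lambda>z. c * f z) u0 = integral {0..s} (\<lambda>s. c * R s)"
      using R(2) s by (simp add: quad_linear(2)[OF L2 t t] quad_linear(2)[OF L20 t t] flip: right_diff_distrib)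
    show "c * R s = 2 * flux (\<lambda>z. c *\<^sub>R f' z) (u s)"
      using R(3) s by (simp add: flux_linear(2)[OF L3 trig_scale.hyps trig_scale.hyps])
  qed
qed

text \<open>
  A bound for the time integral of the flux of \<open>kernel n\<close>.
\<close>

definition drift :: "nat \<Rightarrow> real" where
  "drift n = 2 * (45 * 8 powr (\<gamma> / 2) * real n powr ((1 - \<gamma>) / 2)) * (LINT t|lebesgue_on {0<..<T}. G t)"

lemma drift_tendsto_0: "drift \<longlonglongrightarrow> 0"
proof -
  have "(\<lambda>n. real n powr ((1 - \<gamma>) / 2)) \<longlonglongrightarrow> 0"
    using \<gamma> by (intro tendsto_neg_powr filterlim_real_sequentially) auto
  then have "(\<lambda>n. 2 * (45 * 8 powr (\<gamma> / 2) * real n powr ((1 - \<gamma>) / 2)) * (LINT t|lebesgue_on {0<..<T}. G t))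
     \<longlonglongrightarrow> 2 * (45 * 8 powr (\<gamma> / 2) * 0) * (LINT t|lebesgue_on {0<..<T}. G t)"
    by (intro tendsto_intros)
  then show ?thesis by (simp add: drift_def[abs_def])
qed

lemma quad_kernel_drift:
  assumes t: "t \<in> insert 0 good" and n: "1 \<le> n"
  shows "\<bar>quad (kernel n) (curve t) - quad (kernel n) u0\<bar> \<le> drift n"
proof (cases "t = 0")
  case True
  have "0 \<le> (LINT t|lebesgue_on {0<..<T}. G t)" using G(1) by (intro Bochner_Integration.integral_nonneg) auto
  then show ?thesis using True by (simp add: curve_def drift_def)
next
  case False
  then have t: "t \<in> good" using t by auto
  obtain R where R: "bounded_measurable R" "\<forall>t\<in>good. quad (kernel n) (u t) - quad (kernel n) u0 = integral {0..t} R"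
    "\<forall>s\<in>good. R s = 2 * flux (kernel_grad n) (u s)"
    using quad_flux_identity[OF trig_pair_kernel] by blast
  define R' where "R' s = indicator {..t} s * R s" for s
  have R': "bounded_measurable R'"
    unfolding R'_def using R(1)
    by (intro bounded_measurable_arith) (auto simp: bounded_measurable_def indicator_def intro!: exI[of _ 1] measurable_completion)
  have "integral {0..t} R = integral {0..t} R'"
    by (intro Henstock_Kurzweil_Integration.integral_cong) (auto simp: R'_def)
  also have "\<dots> = integral {0..T} R'"
  proof -
    have "integral {0..t} R' + integral {t..T} R' = integral {0..T} R'"
      using good_range[OF t] by (intro Henstock_Kurzweil_Integration.integral_combine bounded_measurable_integrable R') auto
    moreover have "integral {t..T} R' = 0"
    proof -
      have "integral {t..T} R' = integral {t..T} (\<lambda>_. 0)"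
        by (rule integral_spike[of "{t}"]) (auto simp: R'_def)
      then show ?thesis by simp
    qed
    ultimately show ?thesis by simp
  qed
  also have "\<dots> = (LINT s|lebesgue_on {0<..<T}. R' s)"
    by (rule bounded_measurable_lebesgue_integral[OF R', symmetric])
  finally have eq: "quad (kernel n) (u t) - quad (kernel n) u0 = (LINT s|lebesgue_on {0<..<T}. R' s)"
    using R(2) t by simp
  let ?B = "2 * (45 * 8 powr (\<gamma> / 2) * real n powr ((1 - \<gamma>) / 2))"
  have "\<bar>LINT s|lebesgue_on {0<..<T}. R' s\<bar> \<le> (LINT s|lebesgue_on {0<..<T}. \<bar>R' s\<bar>)"
    by (rule integral_abs_bound)
  also have "\<dots> \<le> (LINT s|lebesgue_on {0<..<T}. ?B * G s)"
  proof (rule integral_mono_AE)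
    show "integrable (lebesgue_on {0<..<T}) (\<lambda>s. \<bar>R' s\<bar>)"
      using bounded_measurable_integrable(2)[OF R'] by (rule integrable_abs)
    show "integrable (lebesgue_on {0<..<T}) (\<lambda>s. ?B * G s)" using G(2) by simp
    show "AE s in lebesgue_on {0<..<T}. \<bar>R' s\<bar> \<le> ?B * G s"
      using AE_good
    proof eventually_elim
      case (elim s)
      have "\<bar>R' s\<bar> \<le> \<bar>R s\<bar>" by (auto simp: R'_def indicator_def)
      also have "\<dots> = 2 * \<bar>flux (kernel_grad n) (u s)\<bar>" using R(3) elim by (simp add: abs_mult)
      also have "\<dots> \<le> 2 * (45 * 8 powr (\<gamma> / 2) * G s * real n powr ((1 - \<gamma>) / 2))"
        using \<gamma> by (intro mult_left_mono flux_kernel_bound[OF L3 div _ \<gamma>(2) n G(1) inc]) auto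
      finally show ?case by (simp add: mult_ac)
    qed
  qed
  also have "\<dots> = drift n" by (simp add: drift_def)
  finally show ?thesis using eq curve_good[OF t] by simp
qed

text \<open>
  Energy differs from \<open>quad (kernel n)\<close> by half of the defect, which tends to 0 at each time separately,
  while \<open>quad (kernel n)\<close> drifts by at most \<open>drift n\<close>.
\<close>

lemma energy_constant:
  assumes t: "t \<in> insert 0 good" 
  shows "(LINT x|torus. (norm (curve t x))\<^sup>2) = (LINT x|torus. (norm (u0 x))\<^sup>2)" (is "?E = ?F")
proof -
  have le: "\<bar>?E - ?F\<bar> \<le> (defect (kernel n) (curve t) + defect (kernel n) u0) / 2 + drift n" if n: "1 \<le> n" for n
  proof -
    have "?E - ?F = (defect (kernel n) (curve t) - defect (kernel n) u0) / 2 + (quad (kernel n) (curve t) - quad (kernel n) u0)"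
      using L2_field_quad(3)[OF trig_kernel curve_L2, of n t] L2_field_quad(3)[OF trig_kernel L20, of n]
      by (simp add: integral_kernel field_simps)
    moreover have "0 \<le> defect (kernel n) (curve t)" "0 \<le> defect (kernel n) u0"
      by (rule defect_nonneg[OF kernel_nonneg])+
    ultimately show ?thesis using quad_kernel_drift[OF t n] unfolding abs_le_iff by (simp add: field_simps)
  qed
  have "(\<lambda>n. (defect (kernel n) (curve t) + defect (kernel n) u0) / 2 + drift n) \<longlonglongrightarrow> (0 + 0) / 2 + 0"
    by (intro tendsto_intros H_field_defect_tendsto_0 curve_H H0 drift_tendsto_0) auto
  then have "\<bar>?E - ?F\<bar> \<le> 0"
    using le by (intro LIMSEQ_le_const[of _ 0 "\<bar>?E - ?F\<bar>"]) (auto intro!: exI[of _ 1])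
  then show ?thesis by simp
qed

text \<open>
  As the energy and, up to the drift, \<open>quad\<close> are the same as at time 0, so is the defect: the smallness of
  the initial defect is propagated uniformly in time.
\<close>

lemma uniform_defect:
  assumes "t \<in> insert 0 good" "1 \<le> n"
  shows "defect (kernel n) (curve t) \<le> defect (kernel n) u0 + 2 * drift n"
  using L2_field_quad(3)[OF trig_kernel curve_L2, of n t] L2_field_quad(3)[OF trig_kernel L20, of n]
    energy_constant[OF assms(1)] quad_kernel_drift[OF assms] by (simp add: integral_kernel)

lemma mode_diff:
  assumes "L2_field f" "L2_field g" shows "mode k \<theta> (\<lambda>x. f x - g x) = mode k \<theta> f - mode k \<theta> g"
  unfolding mode_def using mode_integrable(1)[OF assms(1)] mode_integrable(1)[OF assms(2)]
  by (simp add: scaleR_diff_right)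

text \<open>
  For a single cosine this is a sum of squares of differences of Lipschitz functions of time.
\<close>

lemma quad_difference:
  assumes "trig f"
  shows "\<exists>K. \<forall>s\<in>insert 0 good. \<forall>t\<in>insert 0 good. \<bar>quad f (\<lambda>x. curve t x - curve s x)\<bar> \<le> K * (t - s)\<^sup>2"
  using assms
proof (induction rule: trig_induct)
  case (cos k)
  have "\<exists>C. \<forall>t. \<bar>force k \<theta> (projected_axis k j) t\<bar> \<le> C" for \<theta> j
    using force_bounded_measurable by (auto simp: bounded_measurable_def)
  then obtain C where C: "\<And>\<theta> j t. \<bar>force k \<theta> (projected_axis k j) t\<bar> \<le> C \<theta> j" by metis
  have path: "(path k \<theta> j t - path k \<theta> j s)\<^sup>2 \<le> (C \<theta> j)\<^sup>2 * (t - s)\<^sup>2" if "s \<in> insert 0 good" "t \<in> insert 0 good" for \<theta> j s t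
  proof -
    have L: "\<bar>path k \<theta> j t - path k \<theta> j s\<bar> \<le> C \<theta> j * (t - s)" if "s \<in> insert 0 good" "s \<le> t" for s t
    proof -
      have "0 \<le> s" using that(1) good_range[of s] by auto
      from primitive_Lipschitz(1)[OF force_bounded_measurable C this that(2)] show ?thesis by (simp add: path_def)
    qed
    have "\<bar>path k \<theta> j t - path k \<theta> j s\<bar> \<le> C \<theta> j * \<bar>t - s\<bar>"
    proof (cases "s \<le> t")
      case True
      then show ?thesis using L[OF that(1) True] by simp
    next
      case False
      then show ?thesis using L[OF that(2), of s] by (simp add: abs_minus_commute)
    qed
    from power_mono[OF this, of 2] show ?thesis by (simp add: power_mult_distrib)
  qed
  define K where "K = (\<Sum>j\<in>UNIV. (C 0 j)\<^sup>2 + (C (- pi / 2) j)\<^sup>2)"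
  show ?case
  proof (intro exI[of _ K] ballI)
    fix s t assume st: "s \<in> insert 0 good" "t \<in> insert 0 good"
    have m: "(norm (mode k \<theta> (\<lambda>x. curve t x - curve s x)))\<^sup>2 \<le> (\<Sum>j\<in>UNIV. (C \<theta> j)\<^sup>2 * (t - s)\<^sup>2)"
      if \<theta>: "\<theta> \<in> {0, - pi / 2}" for \<theta>
    proof -
      have "(norm (mode k \<theta> (\<lambda>x. curve t x - curve s x)))\<^sup>2 = (\<Sum>j\<in>UNIV. (mode k \<theta> (curve t) $ j - mode k \<theta> (curve s) $ j)\<^sup>2)"
        unfolding mode_diff[OF curve_L2 curve_L2] power2_norm_eq_inner inner_vec_def by (simp add: power2_eq_square)
      also have "\<dots> \<le> (\<Sum>j\<in>UNIV. (C \<theta> j)\<^sup>2 * (t - s)\<^sup>2)"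
        unfolding curve_mode[OF st(1) \<theta>] curve_mode[OF st(2) \<theta>] by (intro sum_mono path st)
      finally show ?thesis .
    qed
    have "quad (\<lambda>z. cos (frequency k \<bullet> z)) (\<lambda>x. curve t x - curve s x)
       = (norm (mode k 0 (\<lambda>x. curve t x - curve s x)))\<^sup>2 + (norm (mode k (- pi / 2) (\<lambda>x. curve t x - curve s x)))\<^sup>2"
      by (rule quad_cos[OF L2_field_diff[OF curve_L2 curve_L2]])
    then show "\<bar>quad (\<lambda>z. cos (frequency k \<bullet> z)) (\<lambda>x. curve t x - curve s x)\<bar> \<le> K * (t - s)\<^sup>2"
      using m[of 0] m[of "- pi / 2"] by (simp add: K_def sum.distrib sum_distrib_right distrib_right)
  qed
next
  case (add f g)
  from add.IH(1) obtain K where K: "\<forall>s\<in>insert 0 good. \<forall>t\<in>insert 0 good. \<bar>quad f (\<lambda>x. curve t x - curve s x)\<bar> \<le> K * (t - s)\<^sup>2" ..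
  from add.IH(2) obtain L where L: "\<forall>s\<in>insert 0 good. \<forall>t\<in>insert 0 good. \<bar>quad g (\<lambda>x. curve t x - curve s x)\<bar> \<le> L * (t - s)\<^sup>2" ..
  show ?case
  proof (intro exI[of _ "K + L"] ballI)
    fix s t assume st: "s \<in> insert 0 good" "t \<in> insert 0 good"
    show "\<bar>quad (\<lambda>z. f z + g z) (\<lambda>x. curve t x - curve s x)\<bar> \<le> (K + L) * (t - s)\<^sup>2"
      unfolding quad_linear(1)[OF L2_field_diff[OF curve_L2 curve_L2] add.hyps(1,2)]
      using K[rule_format, OF st] L[rule_format, OF st] by (simp add: distrib_right abs_le_iff)
  qed
next
  case (scale f c)
  from scale.IH obtain K where K: "\<forall>s\<in>insert 0 good. \<forall>t\<in>insert 0 good. \<bar>quad f (\<lambda>x. curve t x - curve s x)\<bar> \<le> K * (t - s)\<^sup>2" ..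
  show ?case
  proof (intro exI[of _ "\<bar>c\<bar> * K"] ballI)
    fix s t assume st: "s \<in> insert 0 good" "t \<in> insert 0 good"
    show "\<bar>quad (\<lambda>z. c * f z) (\<lambda>x. curve t x - curve s x)\<bar> \<le> \<bar>c\<bar> * K * (t - s)\<^sup>2"
      unfolding quad_linear(2)[OF L2_field_diff[OF curve_L2 curve_L2] scale.hyps(1) scale.hyps(1)] abs_mult
      using K[rule_format, OF st] by (simp add: mult_left_mono mult.assoc)
  qed
qed

text \<open>
  The squared norm of a difference is half of its defect plus its \<open>quad\<close>.  The defect is small uniformly
  in time when \<open>n\<close> is large; for this fixed \<open>n\<close> the second part involves finitely many modes and is
  quadratically small in the time difference.
\<close>

lemma curve_uniformly_continuous:
  assumes \<epsilon>: "0 < \<epsilon>"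
  shows "\<exists>\<delta>>0. \<forall>s\<in>insert 0 good. \<forall>t\<in>insert 0 good. \<bar>t - s\<bar> < \<delta> \<longrightarrow>
    (LINT x|torus. (norm (curve t x - curve s x))\<^sup>2) < \<epsilon>"
proof -
  have "(\<lambda>n. 2 * (defect (kernel n) u0 + 2 * drift n)) \<longlonglongrightarrow> 2 * (0 + 2 * 0)"
    by (intro tendsto_intros H_field_defect_tendsto_0 H0 drift_tendsto_0)
  then have "eventually (\<lambda>n. 2 * (defect (kernel n) u0 + 2 * drift n) < \<epsilon> / 2) sequentially"
    using \<epsilon> by (intro order_tendstoD) auto
  then obtain n where n: "1 \<le> n" "2 * (defect (kernel n) u0 + 2 * drift n) < \<epsilon> / 2"
    using eventually_conj[OF _ eventually_ge_at_top[of 1]] by (metis (mono_tags, lifting) eventually_sequentially order_refl)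
  from quad_difference[OF trig_kernel] obtain K where
    K: "\<forall>s\<in>insert 0 good. \<forall>t\<in>insert 0 good. \<bar>quad (kernel n) (\<lambda>x. curve t x - curve s x)\<bar> \<le> K * (t - s)\<^sup>2" ..
  define \<delta> where "\<delta> = sqrt (\<epsilon> / (2 * (\<bar>K\<bar> + 1)))"
  have \<delta>: "0 < \<delta>" using \<epsilon> by (simp add: \<delta>_def)
  show ?thesis
  proof (intro exI[of _ \<delta>] conjI \<delta> ballI impI)
    fix s t assume st: "s \<in> insert 0 good" "t \<in> insert 0 good" and d: "\<bar>t - s\<bar> < \<delta>"
    let ?d = "\<lambda>x. curve t x - curve s x"
    have "(LINT x|torus. (norm (?d x))\<^sup>2) = defect (kernel n) ?d / 2 + quad (kernel n) ?d"
      using L2_field_quad(3)[OF trig_kernel L2_field_diff[OF curve_L2 curve_L2], of n t s] by (simp add: integral_kernel diff_divide_distrib)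
    moreover have "defect (kernel n) ?d \<le> 2 * defect (kernel n) (curve t) + 2 * defect (kernel n) (curve s)"
      using defect_add_le[OF trig_kernel kernel_nonneg curve_L2 L2_field_uminus[OF curve_L2], of n t s]
      by (simp add: defect_uminus)
    moreover have "quad (kernel n) ?d < \<epsilon> / 2"
    proof -
      have "(t - s)\<^sup>2 < \<delta>\<^sup>2" using d abs_square_less_1 power_strict_mono[of "\<bar>t - s\<bar>" \<delta> 2] by simp
      also have "\<dots> = \<epsilon> / (2 * (\<bar>K\<bar> + 1))" using \<epsilon> by (simp add: \<delta>_def)
      finally have *: "(t - s)\<^sup>2 < \<epsilon> / (2 * (\<bar>K\<bar> + 1))" .
      have "quad (kernel n) ?d \<le> K * (t - s)\<^sup>2" using K[rule_format, OF st] by simp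
      also have "\<dots> \<le> (\<bar>K\<bar> + 1) * (t - s)\<^sup>2" by (intro mult_right_mono) auto
      also have "\<dots> < (\<bar>K\<bar> + 1) * (\<epsilon> / (2 * (\<bar>K\<bar> + 1)))" using * by (intro mult_strict_left_mono) auto
      also have "\<dots> = \<epsilon> / 2" by (simp add: field_simps)
      finally show ?thesis .
    qed
    moreover have "L < \<epsilon>" if "L = D / 2 + q" "D \<le> 2 * a + 2 * b" "q < \<epsilon> / 2" "b \<le> c" "a \<le> c" "2 * c < \<epsilon> / 2"
      for L D q a b c :: real using that by linarith
    ultimately show "(LINT x|torus. (norm (?d x))\<^sup>2) < \<epsilon>"
      using uniform_defect[OF st(1) n(1)] uniform_defect[OF st(2) n(1)] n(2) by blast
  qed
qed

end

section \<open>Continuous extension in \<open>L\<^sup>2\<close>\<close>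

lemma L2_field_integrable_square: "L2_field f \<Longrightarrow> integrable torus (\<lambda>x. (norm (f x))\<^sup>2)"
  by (simp add: L2_field_def)

lemma L2_norm_add_le:
  assumes "L2_field f" "L2_field g"
  shows "(LINT x|torus. (norm (f x + g x))\<^sup>2) \<le> 2 * (LINT x|torus. (norm (f x))\<^sup>2) + 2 * (LINT x|torus. (norm (g x))\<^sup>2)"
proof -
  have "(LINT x|torus. (norm (f x + g x))\<^sup>2) \<le> (LINT x|torus. 2 * (norm (f x))\<^sup>2 + 2 * (norm (g x))\<^sup>2)"
    using L2_field_integrable_square[OF L2_field_add[OF assms]] L2_field_integrable_square[OF assms(1)] L2_field_integrable_square[OF assms(2)]
    by (intro integral_mono norm_add_square_le) auto
  then show ?thesis using L2_field_integrable_square[OF assms(1)] L2_field_integrable_square[OF assms(2)] by simp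
qed

text \<open>
  The \<open>L\<^sup>1\<close> norms of successive differences are summable, hence the sequence converges almost
  everywhere, and Fatou's lemma bounds the distance to the limit.
\<close>

lemma L2_complete:
  fixes f :: "nat \<Rightarrow> R3 \<Rightarrow> R3"
  assumes f: "\<And>n. L2_field (f n)" and cauchy: "\<And>n m. n \<le> m \<Longrightarrow> (LINT x|torus. (norm (f m x - f n x))\<^sup>2) \<le> (1 / 4) ^ n"
  obtains g where "L2_field g" "\<And>n. (LINT x|torus. (norm (g x - f n x))\<^sup>2) \<le> (1 / 4) ^ n"
proof -
  have [measurable]: "f n \<in> borel_measurable borel" for n using f by (simp add: L2_field_def)
  define g where "g x = lim (\<lambda>n. f n x)" for x
  have gm [measurable]: "g \<in> borel_measurable borel" unfolding g_def by measurable
  have gp: "torus_periodic g" using f by (simp add: L2_field_def torus_periodic_def g_def)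
  have fd: "L2_field (\<lambda>x. f m x - f n x)" for m n by (intro L2_field_diff f)
  define V where "V = measure torus period_cube"
  have V: "0 \<le> V" by (simp add: V_def)
  have "AE x in torus. (\<Sum>n. ennreal (norm (f (Suc n) x - f n x))) \<noteq> \<infinity>"
  proof (rule nn_integral_PInf_AE)
    show "(\<lambda>x. \<Sum>n. ennreal (norm (f (Suc n) x - f n x))) \<in> borel_measurable torus"
      by (rule torus_measurable) measurable
    have "(\<integral>\<^sup>+x. (\<Sum>n. ennreal (norm (f (Suc n) x - f n x))) \<partial>torus)
        = (\<Sum>n. \<integral>\<^sup>+x. ennreal (norm (f (Suc n) x - f n x)) \<partial>torus)"
      by (intro nn_integral_suminf torus_measurable) measurable
    also have "\<dots> \<le> (\<Sum>n. ennreal ((1 / 2) ^ n * (V + 1)))"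
    proof (rule suminf_le)
      fix n
      have "(LINT x|torus. (norm (f (Suc n) x - f n x))\<^sup>2) \<le> ((1 / 2) ^ n)\<^sup>2"
        using cauchy[of n "Suc n"] by (simp add: power2_eq_square flip: power_mult_distrib)
      then have "(LINT x|torus. norm (f (Suc n) x - f n x)) \<le> (1 / 2) ^ n * (V + 1)"
        unfolding V_def by (intro integral_norm_le[OF fd]) auto
      then show "(\<integral>\<^sup>+x. ennreal (norm (f (Suc n) x - f n x)) \<partial>torus) \<le> ennreal ((1 / 2) ^ n * (V + 1))"
        using L2_field_integrable[OF fd] by (subst nn_integral_eq_integral) (auto intro: ennreal_leI)
    qed auto
    also have "\<dots> = ennreal (\<Sum>n. (1 / 2) ^ n * (V + 1))"
      using V by (intro suminf_ennreal2) (auto intro!: summable_mult2 summable_geometric)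
    finally show "(\<integral>\<^sup>+x. (\<Sum>n. ennreal (norm (f (Suc n) x - f n x))) \<partial>torus) \<noteq> \<infinity>"
      by (auto simp: top_unique)
  qed
  then have conv: "AE x in torus. (\<lambda>n. f n x) \<longlonglongrightarrow> g x"
  proof eventually_elim
    case (elim x)
    have "summable (\<lambda>n. norm (f (Suc n) x - f n x))"
      using elim by (intro summable_suminf_not_top) (auto simp: top_unique)
    then have "summable (\<lambda>n. f (Suc n) x - f n x)" by (rule summable_norm_cancel)
    then have "convergent (\<lambda>n. \<Sum>i<n. f (Suc i) x - f i x)" by (simp add: summable_iff_convergent)
    then have "convergent (\<lambda>n. f n x - f 0 x)" by (simp add: sum_lessThan_telescope[of "\<lambda>i. f i x"])
    then have "convergent (\<lambda>n. (f n x - f 0 x) + f 0 x)" by (intro convergent_add convergent_const)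
    then show ?case by (simp add: g_def convergent_LIMSEQ_iff)
  qed
  have bound: "(\<integral>\<^sup>+x. ennreal ((norm (g x - f n x))\<^sup>2) \<partial>torus) \<le> ennreal ((1 / 4) ^ n)" for n
  proof -
    have "(\<integral>\<^sup>+x. ennreal ((norm (g x - f n x))\<^sup>2) \<partial>torus)
       = (\<integral>\<^sup>+x. liminf (\<lambda>m. ennreal ((norm (f m x - f n x))\<^sup>2)) \<partial>torus)"
    proof (rule nn_integral_cong_AE, use conv in eventually_elim)
      case (elim x)
      then have "(\<lambda>m. ennreal ((norm (f m x - f n x))\<^sup>2)) \<longlonglongrightarrow> ennreal ((norm (g x - f n x))\<^sup>2)"
        by (intro tendsto_intros)
      from lim_imp_Liminf[OF sequentially_bot this] show ?case by (rule sym)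
    qed
    also have "\<dots> \<le> liminf (\<lambda>m. \<integral>\<^sup>+x. ennreal ((norm (f m x - f n x))\<^sup>2) \<partial>torus)"
      by (intro nn_integral_liminf torus_measurable) measurable
    also have "\<dots> \<le> liminf (\<lambda>m. ennreal ((1 / 4) ^ n))"
    proof (rule Liminf_mono, rule eventually_sequentiallyI[of n])
      fix m assume "n \<le> m"
      then show "(\<integral>\<^sup>+x. ennreal ((norm (f m x - f n x))\<^sup>2) \<partial>torus) \<le> ennreal ((1 / 4) ^ n)"
        using cauchy L2_field_integrable_square[OF fd[of m n]]
        by (subst nn_integral_eq_integral) (auto intro: ennreal_leI)
    qed
    also have "\<dots> = ennreal ((1 / 4) ^ n)" by (simp add: Liminf_const)
    finally show ?thesis .
  qed
  have gd: "integrable torus (\<lambda>x. (norm (g x - f n x))\<^sup>2)" for n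
  proof (rule integrableI_bounded)
    show "(\<lambda>x. (norm (g x - f n x))\<^sup>2) \<in> borel_measurable torus" by (rule torus_measurable) measurable
    show "(\<integral>\<^sup>+x. ennreal (norm ((norm (g x - f n x))\<^sup>2)) \<partial>torus) < \<infinity>"
      using le_less_trans[OF bound[of n]] by simp
  qed
  have "L2_field (\<lambda>x. g x - f 0 x)"
    using gd[of 0] gp f[of 0] by (auto simp: L2_field_def torus_periodic_def)
  from L2_field_add[OF this f[of 0]] have "L2_field g" by simp
  moreover have "(LINT x|torus. (norm (g x - f n x))\<^sup>2) \<le> (1 / 4) ^ n" for n
    using bound[of n] nn_integral_eq_integral[OF gd[of n]] by simp
  ultimately show ?thesis using that by blast
qed

text \<open>
  The points of \<open>D\<close> that approximate \<open>t\<close> are chosen so close that the values satisfy the geometric Cauchy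
  condition of \<open>L2_complete\<close>.
\<close>

lemma L2_extension_point:
  fixes U :: "real \<Rightarrow> R3 \<Rightarrow> R3"
  assumes U: "\<And>s. s \<in> D \<Longrightarrow> L2_field (U s)"
    and uc: "\<And>\<epsilon>. 0 < \<epsilon> \<Longrightarrow> \<exists>\<delta>>0. \<forall>s\<in>D. \<forall>t\<in>D. \<bar>t - s\<bar> < \<delta> \<longrightarrow> (LINT x|torus. (norm (U t x - U s x))\<^sup>2) < \<epsilon>"
    and dense: "\<And>\<delta>. 0 < \<delta> \<Longrightarrow> \<exists>s\<in>D. \<bar>s - t\<bar> < \<delta>"
  shows "\<exists>g. L2_field g \<and> (\<forall>\<epsilon>>0. \<exists>s\<in>D. \<bar>s - t\<bar> < \<epsilon> \<and> (LINT x|torus. (norm (g x - U s x))\<^sup>2) < \<epsilon>)"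
proof -
  have "\<exists>\<delta>>0. \<forall>s\<in>D. \<forall>t\<in>D. \<bar>t - s\<bar> < \<delta> \<longrightarrow> (LINT x|torus. (norm (U t x - U s x))\<^sup>2) < (1 / 4) ^ n" for n
    by (rule uc) simp
  then have "\<forall>n. \<exists>\<delta>. 0 < \<delta> \<and> (\<forall>s\<in>D. \<forall>t\<in>D. \<bar>t - s\<bar> < \<delta> \<longrightarrow> (LINT x|torus. (norm (U t x - U s x))\<^sup>2) < (1 / 4) ^ n)" ..
  from choice[OF this] obtain \<delta> where *: "\<forall>n. 0 < \<delta> n \<and> (\<forall>s\<in>D. \<forall>t\<in>D. \<bar>t - s\<bar> < \<delta> n \<longrightarrow> (LINT x|torus. (norm (U t x - U s x))\<^sup>2) < (1 / 4) ^ n)" ..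
  have \<delta>: "0 < \<delta> n" "s \<in> D \<Longrightarrow> t \<in> D \<Longrightarrow> \<bar>t - s\<bar> < \<delta> n \<Longrightarrow> (LINT x|torus. (norm (U t x - U s x))\<^sup>2) < (1 / 4) ^ n" for n s t
    using * by blast+
  \<comment> \<open>the minimum makes \<open>d\<close> decreasing, the second entry makes it tend to 0\<close>
  define d where "d n = Min ((\<lambda>i. min (\<delta> i / 2) (1 / real (Suc i))) ` {..n})" for n
  have d: "0 < d n" for n unfolding d_def using \<delta>(1) by (subst Min_gr_iff) auto
  have dle: "d m \<le> \<delta> n / 2" "d m \<le> 1 / real (Suc n)" if "n \<le> m" for n m
  proof -
    have "d m \<le> min (\<delta> n / 2) (1 / real (Suc n))" unfolding d_def using that by (intro Min_le) auto
    then show "d m \<le> \<delta> n / 2" "d m \<le> 1 / real (Suc n)" by auto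
  qed
  have "\<forall>n. \<exists>s. s \<in> D \<and> \<bar>s - t\<bar> < d n" using dense d by blast
  from choice[OF this] obtain s where s: "\<And>n. s n \<in> D" "\<And>n. \<bar>s n - t\<bar> < d n" by blast
  have "(LINT x|torus. (norm (U (s m) x - U (s n) x))\<^sup>2) \<le> (1 / 4) ^ n" if "n \<le> m" for n m
  proof -
    have "\<bar>s m - s n\<bar> < \<delta> n" using s(2)[of m] s(2)[of n] dle(1)[OF that] dle(1)[of n n] by linarith
    then show ?thesis using \<delta>(2)[OF s(1) s(1)] less_imp_le by blast
  qed
  from L2_complete[OF U[OF s(1)] this] obtain g where g: "L2_field g" "\<And>n. (LINT x|torus. (norm (g x - U (s n) x))\<^sup>2) \<le> (1 / 4) ^ n" by blast
  have "\<exists>s\<in>D. \<bar>s - t\<bar> < \<epsilon> \<and> (LINT x|torus. (norm (g x - U s x))\<^sup>2) < \<epsilon>" if \<epsilon>: "0 < \<epsilon>" for \<epsilon>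
  proof -
    have "(\<lambda>n. (1 / 4 :: real) ^ n) \<longlonglongrightarrow> 0" "(\<lambda>n. 1 / real (Suc n)) \<longlonglongrightarrow> 0"
      by real_asymp+
    then have "eventually (\<lambda>n. (1 / 4) ^ n < \<epsilon> \<and> 1 / real (Suc n) < \<epsilon>) sequentially"
      using \<epsilon> by (intro eventually_conj order_tendstoD)
    then obtain n where n: "(1 / 4) ^ n < \<epsilon>" "1 / real (Suc n) < \<epsilon>" by (auto simp: eventually_sequentially)
    show ?thesis
      using s(1)[of n] s(2)[of n] dle(2)[of n n] g(2)[of n] n by (intro bexI[of _ "s n"] conjI) linarith+
  qed
  with g(1) show ?thesis by blast
qed

lemma L2_uniform_extension:
  fixes U :: "real \<Rightarrow> R3 \<Rightarrow> R3"
  assumes U: "\<And>s. s \<in> D \<Longrightarrow> L2_field (U s)"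
    and uc: "\<And>\<epsilon>. 0 < \<epsilon> \<Longrightarrow> \<exists>\<delta>>0. \<forall>s\<in>D. \<forall>t\<in>D. \<bar>t - s\<bar> < \<delta> \<longrightarrow> (LINT x|torus. (norm (U t x - U s x))\<^sup>2) < \<epsilon>"
    and dense: "\<And>t \<delta>. t \<in> I \<Longrightarrow> 0 < \<delta> \<Longrightarrow> \<exists>s\<in>D. \<bar>s - t\<bar> < \<delta>"
  obtains W where "\<And>t. t \<in> D \<Longrightarrow> W t = U t" "\<And>t. t \<in> I \<Longrightarrow> L2_field (W t)"
    "\<And>t \<epsilon>. t \<in> I \<Longrightarrow> 0 < \<epsilon> \<Longrightarrow> \<exists>s\<in>D. \<bar>s - t\<bar> < \<epsilon> \<and> (LINT x|torus. (norm (W t x - U s x))\<^sup>2) < \<epsilon>"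
    "\<And>\<epsilon>. 0 < \<epsilon> \<Longrightarrow> \<exists>\<delta>>0. \<forall>s\<in>I. \<forall>t\<in>I. \<bar>t - s\<bar> < \<delta> \<longrightarrow> (LINT x|torus. (norm (W t x - W s x))\<^sup>2) < \<epsilon>"
proof -
  have "\<forall>t\<in>I. \<exists>g. L2_field g \<and> (\<forall>\<epsilon>>0. \<exists>s\<in>D. \<bar>s - t\<bar> < \<epsilon> \<and> (LINT x|torus. (norm (g x - U s x))\<^sup>2) < \<epsilon>)"
    using L2_extension_point[OF U uc dense] by blast
  from bchoice[OF this] obtain g where g: "\<And>t. t \<in> I \<Longrightarrow> L2_field (g t)"
    "\<And>t \<epsilon>. t \<in> I \<Longrightarrow> 0 < \<epsilon> \<Longrightarrow> \<exists>s\<in>D. \<bar>s - t\<bar> < \<epsilon> \<and> (LINT x|torus. (norm (g t x - U s x))\<^sup>2) < \<epsilon>" by blast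
  define W where "W t = (if t \<in> D then U t else g t)" for t
  have WL: "L2_field (W t)" if "t \<in> I" for t using U g(1) that by (simp add: W_def)
  have WA: "\<exists>s\<in>D. \<bar>s - t\<bar> < \<epsilon> \<and> (LINT x|torus. (norm (W t x - U s x))\<^sup>2) < \<epsilon>" if "t \<in> I" "0 < \<epsilon>" for t \<epsilon>
    using g(2)[OF that] that by (cases "t \<in> D") (auto simp: W_def intro!: bexI[of _ t])
  have "\<exists>\<delta>>0. \<forall>s\<in>I. \<forall>t\<in>I. \<bar>t - s\<bar> < \<delta> \<longrightarrow> (LINT x|torus. (norm (W t x - W s x))\<^sup>2) < \<epsilon>" if \<epsilon>: "0 < \<epsilon>" for \<epsilon>
  proof -
    obtain \<delta> where \<delta>: "0 < \<delta>" "\<And>s t. s \<in> D \<Longrightarrow> t \<in> D \<Longrightarrow> \<bar>t - s\<bar> < \<delta> \<Longrightarrow> (LINT x|torus. (norm (U t x - U s x))\<^sup>2) < \<epsilon> / 12"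
      using uc[of "\<epsilon> / 12"] \<epsilon> by auto
    show ?thesis
    proof (intro exI[of _ "\<delta> / 3"] conjI ballI impI)
      show "0 < \<delta> / 3" using \<delta> by simp
      fix s t assume st: "s \<in> I" "t \<in> I" "\<bar>t - s\<bar> < \<delta> / 3"
      have e: "0 < min (\<delta> / 3) (\<epsilon> / 12)" using \<delta> \<epsilon> by simp
      obtain s' where s': "s' \<in> D" "\<bar>s' - s\<bar> < min (\<delta> / 3) (\<epsilon> / 12)" "(LINT x|torus. (norm (W s x - U s' x))\<^sup>2) < min (\<delta> / 3) (\<epsilon> / 12)"
        using WA[OF st(1) e] by blast
      obtain t' where t': "t' \<in> D" "\<bar>t' - t\<bar> < min (\<delta> / 3) (\<epsilon> / 12)" "(LINT x|torus. (norm (W t x - U t' x))\<^sup>2) < min (\<delta> / 3) (\<epsilon> / 12)"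
        using WA[OF st(2) e] by blast
      have "\<bar>t' - s'\<bar> < \<delta>" using s'(2) t'(2) st(3) by linarith
      then have 2: "(LINT x|torus. (norm (U t' x - U s' x))\<^sup>2) < \<epsilon> / 12" by (rule \<delta>(2)[OF s'(1) t'(1)])
      have L: "L2_field (\<lambda>x. W t x - U t' x)" "L2_field (\<lambda>x. U t' x - U s' x)" "L2_field (\<lambda>x. U s' x - W s x)"
        using WL st U s'(1) t'(1) by (auto intro: L2_field_diff)
      have 3: "(LINT x|torus. (norm (U s' x - W s x))\<^sup>2) < \<epsilon> / 12" using s'(3) by (simp add: norm_minus_commute)
      have 1: "(LINT x|torus. (norm (W t x - U t' x))\<^sup>2) < \<epsilon> / 12" using t'(3) by simp
      have "(LINT x|torus. (norm (W t x - W s x))\<^sup>2)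
          = (LINT x|torus. (norm ((W t x - U t' x) + ((U t' x - U s' x) + (U s' x - W s x))))\<^sup>2)" by simp
      also have "\<dots> \<le> 2 * (LINT x|torus. (norm (W t x - U t' x))\<^sup>2) + 2 * (LINT x|torus. (norm ((U t' x - U s' x) + (U s' x - W s x)))\<^sup>2)"
        by (rule L2_norm_add_le[OF L(1) L2_field_add[OF L(2,3)]])
      also have "\<dots> \<le> 2 * (LINT x|torus. (norm (W t x - U t' x))\<^sup>2) + 2 * (2 * (LINT x|torus. (norm (U t' x - U s' x))\<^sup>2) + 2 * (LINT x|torus. (norm (U s' x - W s x))\<^sup>2))"
        by (intro add_left_mono mult_left_mono L2_norm_add_le L) auto
      also have "\<dots> < 2 * (\<epsilon> / 12) + 2 * (2 * (\<epsilon> / 12) + 2 * (\<epsilon> / 12))"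
        by (intro add_strict_mono mult_strict_left_mono 1 2 3) auto
      also have "\<dots> \<le> \<epsilon>" using \<epsilon> by simp
      finally show "(LINT x|torus. (norm (W t x - W s x))\<^sup>2) < \<epsilon>" .
    qed
  qed
  note UC = this
  show ?thesis
  proof (rule that[of W])
    show "W t = U t" if "t \<in> D" for t using that by (simp add: W_def)
  qed (fact WL WA UC)+
qed

text \<open>
  Squared norms of fields at small distance are compared by
  \<open>(norm a)\<^sup>2 \<le> (1 + \<eta>) * (norm b)\<^sup>2 + (1 + 1 / \<eta>) * (norm (a - b))\<^sup>2\<close>.
\<close>

lemma L2_norm_limit:
  assumes f: "L2_field f" and approx: "\<And>\<epsilon>. 0 < \<epsilon> \<Longrightarrow> \<exists>g. L2_field g \<and> (LINT x|torus. (norm (g x))\<^sup>2) = E \<and> (LINT x|torus. (norm (f x - g x))\<^sup>2) < \<epsilon>"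
  shows "(LINT x|torus. (norm (f x))\<^sup>2) = E"
proof -
  \<comment> \<open>expand \<open>0 \<le> (norm (\<eta> *\<^sub>R b - (a - b)))\<^sup>2 / \<eta>\<close>\<close>
  have young: "(norm a)\<^sup>2 \<le> (1 + \<eta>) * (norm b)\<^sup>2 + (1 + 1 / \<eta>) * (norm (a - b))\<^sup>2" if "0 < \<eta>" for a b :: R3 and \<eta> :: real
  proof -
    have "0 \<le> (norm (\<eta> *\<^sub>R b - (a - b)))\<^sup>2 / \<eta>" using that by simp
    also have "\<dots> = (\<eta>\<^sup>2 * (b \<bullet> b) - 2 * \<eta> * (b \<bullet> (a - b)) + (a - b) \<bullet> (a - b)) / \<eta>"
      unfolding power2_norm_eq_inner by (simp add: inner_diff_left inner_diff_right inner_commute power2_eq_square algebra_simps)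
    also have "\<dots> = \<eta> * (b \<bullet> b) - 2 * (b \<bullet> (a - b)) + ((a - b) \<bullet> (a - b)) / \<eta>"
      using that by (simp add: field_simps power2_eq_square)
    finally have "2 * (b \<bullet> (a - b)) \<le> \<eta> * (b \<bullet> b) + ((a - b) \<bullet> (a - b)) / \<eta>" by simp
    moreover have "a \<bullet> a = b \<bullet> b + 2 * (b \<bullet> (a - b)) + (a - b) \<bullet> (a - b)"
      by (simp add: inner_diff_left inner_diff_right inner_commute)
    ultimately show ?thesis
      unfolding power2_norm_eq_inner by (simp add: distrib_right)
  qed
  have int: "(LINT x|torus. (norm (a x))\<^sup>2) \<le> (1 + \<eta>) * (LINT x|torus. (norm (b x))\<^sup>2) + (1 + 1 / \<eta>) * (LINT x|torus. (norm (a x - b x))\<^sup>2)"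
    if "0 < \<eta>" "L2_field a" "L2_field b" for a b \<eta>
  proof -
    note i = L2_field_integrable_square[OF that(2)] L2_field_integrable_square[OF that(3)] L2_field_integrable_square[OF L2_field_diff[OF that(2,3)]]
    have "(LINT x|torus. (norm (a x))\<^sup>2) \<le> (LINT x|torus. (1 + \<eta>) * (norm (b x))\<^sup>2 + (1 + 1 / \<eta>) * (norm (a x - b x))\<^sup>2)"
      using i by (intro integral_mono young that) auto
    then show ?thesis using i by simp
  qed
  let ?F = "LINT x|torus. (norm (f x))\<^sup>2"
  obtain g0 :: "R3 \<Rightarrow> R3" where "(LINT x|torus. (norm (g0 x))\<^sup>2) = E" using approx[OF zero_less_one] by blast
  then have E0: "0 \<le> E" by (auto intro!: Bochner_Integration.integral_nonneg)
  have F0: "0 \<le> ?F" by (auto intro!: Bochner_Integration.integral_nonneg)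
  have both: "?F \<le> (1 + \<eta>) * E \<and> E \<le> (1 + \<eta>) * ?F" if \<eta>: "0 < \<eta>" for \<eta>
  proof -
    have "?F \<le> (1 + \<eta>) * E + e \<and> E \<le> (1 + \<eta>) * ?F + e" if e: "0 < e" for e
    proof -
      have "0 < e / (1 + 1 / \<eta>)" using e \<eta> by (simp add: add_pos_pos)
      then obtain g where g: "L2_field g" "(LINT x|torus. (norm (g x))\<^sup>2) = E" "(LINT x|torus. (norm (f x - g x))\<^sup>2) < e / (1 + 1 / \<eta>)"
        using approx by blast
      have "(1 + 1 / \<eta>) * (LINT x|torus. (norm (f x - g x))\<^sup>2) \<le> (1 + 1 / \<eta>) * (e / (1 + 1 / \<eta>))"
        using g(3) \<eta> by (intro mult_left_mono) auto
      also have "\<dots> = e"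
      proof -
        have "1 + 1 / \<eta> \<noteq> 0" using \<eta> by (smt (verit) divide_pos_pos)
        then show ?thesis by simp
      qed
      finally have "(1 + 1 / \<eta>) * (LINT x|torus. (norm (f x - g x))\<^sup>2) \<le> e" .
      then show ?thesis
        using int[OF \<eta> f g(1)] int[OF \<eta> g(1) f] g(2) by (simp add: norm_minus_commute)
    qed
    then show ?thesis by (meson field_le_epsilon)
  qed
  have aux: "(1 + e / (A + 1)) * A \<le> A + e" if "0 < e" "0 \<le> A" for A e :: real
    using that by (simp add: field_simps)
  have "?F \<le> E"
  proof (rule field_le_epsilon)
    fix e :: real assume "0 < e"
    have "?F \<le> (1 + e / (E + 1)) * E" using both[of "e / (E + 1)"] \<open>0 < e\<close> E0 by simp
    also have "\<dots> \<le> E + e" by (rule aux[OF \<open>0 < e\<close> E0])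
    finally show "?F \<le> E + e" .
  qed
  moreover have "E \<le> ?F"
  proof (rule field_le_epsilon)
    fix e :: real assume "0 < e"
    have "E \<le> (1 + e / (?F + 1)) * ?F" using both[of "e / (?F + 1)"] \<open>0 < e\<close> F0 by simp
    also have "\<dots> \<le> ?F + e" by (rule aux[OF \<open>0 < e\<close> F0])
    finally show "E \<le> ?F + e" .
  qed
  ultimately show ?thesis by simp
qed

lemma L2_field_Lp_torus: "L2_field f \<Longrightarrow> f \<in> Lp_torus 2"
  by (auto simp: L2_field_def Lp_torus_def powr_2_norm intro: torus_measurable)

text \<open>
  The scalar product with \<open>\<psi>\<close> is bounded by \<open>(norm a)\<^sup>2 / \<eta> + \<eta> * (norm b)\<^sup>2\<close>, where \<open>\<eta>\<close> is chosen
  small first.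
\<close>

lemma strongly_continuous_imp_weakly_continuous:
  assumes L: "\<And>t. t \<in> {0..T} \<Longrightarrow> L2_field (W t)"
    and uc: "\<And>\<epsilon>. 0 < \<epsilon> \<Longrightarrow> \<exists>\<delta>>0. \<forall>s\<in>{0..T}. \<forall>t\<in>{0..T}. \<bar>t - s\<bar> < \<delta> \<longrightarrow> (LINT x|torus. (norm (W t x - W s x))\<^sup>2) < \<epsilon>"
  shows "weakly_continuous_L2 T W"
  unfolding weakly_continuous_L2_def
proof (intro conjI ballI)
  show "W t \<in> Lp_torus 2" if "t \<in> {0..T}" for t using L2_field_Lp_torus[OF L[OF that]] .
  fix \<psi> assume "\<psi> \<in> Lp_torus 2"
  then have [measurable]: "\<psi> \<in> borel_measurable torus" and \<psi>: "integrable torus (\<lambda>x. (norm (\<psi> x))\<^sup>2)"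
    by (auto simp: Lp_torus_def powr_2_norm)
  define P where "P = (LINT x|torus. (norm (\<psi> x))\<^sup>2)"
  have P: "0 \<le> P" unfolding P_def by (auto intro: Bochner_Integration.integral_nonneg)
  have cs: "\<bar>a \<bullet> b\<bar> \<le> (norm a)\<^sup>2 / \<eta> + \<eta> * (norm b)\<^sup>2" if "0 < \<eta>" for a b :: R3 and \<eta> :: real
  proof -
    define r where "r = sqrt \<eta>"
    have r: "0 < r" "\<eta> = r\<^sup>2" using that by (auto simp: r_def)
    have "2 * (norm a * norm b) = 2 * (norm a / r) * (r * norm b)" using r by simp
    also have "\<dots> \<le> (norm a / r)\<^sup>2 + (r * norm b)\<^sup>2" by (rule sum_squares_bound)
    also have "\<dots> = (norm a)\<^sup>2 / \<eta> + \<eta> * (norm b)\<^sup>2"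
      using r by (simp add: power_divide power_mult_distrib)
    finally have "2 * (norm a * norm b) \<le> (norm a)\<^sup>2 / \<eta> + \<eta> * (norm b)\<^sup>2" .
    then show ?thesis using Cauchy_Schwarz_ineq2[of a b] mult_nonneg_nonneg[OF norm_ge_zero[of a] norm_ge_zero[of b]] by linarith
  qed
  have int: "integrable torus (\<lambda>x. f x \<bullet> \<psi> x)"
    and le: "\<bar>LINT x|torus. f x \<bullet> \<psi> x\<bar> \<le> (LINT x|torus. (norm (f x))\<^sup>2) / \<eta> + \<eta> * P"
    if f: "L2_field f" and \<eta>: "0 < \<eta>" for f \<eta>
  proof -
    have [measurable]: "f \<in> borel_measurable torus" using f by (auto simp: L2_field_def intro: torus_measurable)
    have i: "integrable torus (\<lambda>x. (norm (f x))\<^sup>2 / \<eta> + \<eta> * (norm (\<psi> x))\<^sup>2)"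
      using L2_field_integrable_square[OF f] \<psi> by simp
    show "integrable torus (\<lambda>x. f x \<bullet> \<psi> x)"
      by (rule Bochner_Integration.integrable_bound[OF i]) (use order_trans[OF cs[OF \<eta>] abs_ge_self] in auto)
    then have "\<bar>LINT x|torus. f x \<bullet> \<psi> x\<bar> \<le> (LINT x|torus. (norm (f x))\<^sup>2 / \<eta> + \<eta> * (norm (\<psi> x))\<^sup>2)"
      by (rule integral_abs_bound_integral[OF _ i cs[OF \<eta>]])
    also have "\<dots> = (LINT x|torus. (norm (f x))\<^sup>2) / \<eta> + \<eta> * P"
      using L2_field_integrable_square[OF f] \<psi> by (simp add: P_def)
    finally show "\<bar>LINT x|torus. f x \<bullet> \<psi> x\<bar> \<le> (LINT x|torus. (norm (f x))\<^sup>2) / \<eta> + \<eta> * P" .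
  qed
  show "continuous_on {0..T} (\<lambda>t. LINT x|torus. W t x \<bullet> \<psi> x)"
    unfolding continuous_on_iff dist_real_def
  proof (intro ballI allI impI)
    fix s e :: real assume s: "s \<in> {0..T}" and e: "0 < e"
    define \<eta> where "\<eta> = e / (2 * (P + 1))"
    have \<eta>: "0 < \<eta>" using e P by (simp add: \<eta>_def)
    have \<eta>P: "\<eta> * P \<le> e / 2"
    proof -
      have "\<eta> * P \<le> \<eta> * (P + 1)" using \<eta> by (intro mult_left_mono) auto
      also have "\<dots> = e / 2" using P by (simp add: \<eta>_def field_simps)
      finally show ?thesis .
    qed
    obtain \<delta> where \<delta>: "0 < \<delta>" "\<And>s t. s \<in> {0..T} \<Longrightarrow> t \<in> {0..T} \<Longrightarrow> \<bar>t - s\<bar> < \<delta> \<Longrightarrow> (LINT x|torus. (norm (W t x - W s x))\<^sup>2) < e / 2 * \<eta>"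
      using uc[of "e / 2 * \<eta>"] e \<eta> by auto
    show "\<exists>d>0. \<forall>t\<in>{0..T}. \<bar>t - s\<bar> < d \<longrightarrow> \<bar>(LINT x|torus. W t x \<bullet> \<psi> x) - (LINT x|torus. W s x \<bullet> \<psi> x)\<bar> < e"
    proof (intro exI[of _ \<delta>] conjI ballI impI \<delta>(1))
      fix t assume t: "t \<in> {0..T}" "\<bar>t - s\<bar> < \<delta>"
      have "(LINT x|torus. W t x \<bullet> \<psi> x) - (LINT x|torus. W s x \<bullet> \<psi> x) = (LINT x|torus. (W t x - W s x) \<bullet> \<psi> x)"
        using int[OF L[OF t(1)] \<eta>] int[OF L[OF s] \<eta>] by (simp add: inner_diff_left)
      also have "\<bar>\<dots>\<bar> \<le> (LINT x|torus. (norm (W t x - W s x))\<^sup>2) / \<eta> + \<eta> * P"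
        by (rule le[OF L2_field_diff[OF L[OF t(1)] L[OF s]] \<eta>])
      also have "\<dots> < e / 2 + e / 2"
      proof (rule add_less_le_mono[OF _ \<eta>P])
        show "(LINT x|torus. (norm (W t x - W s x))\<^sup>2) / \<eta> < e / 2"
          using \<delta>(2)[OF s t] \<eta> by (simp add: pos_divide_less_eq)
      qed
      finally show "\<bar>(LINT x|torus. W t x \<bullet> \<psi> x) - (LINT x|torus. W s x \<bullet> \<psi> x)\<bar> < e" by simp
    qed
  qed
qed

section \<open>Interpolation and measurable representatives\<close>

lemma lebesgue_on_measurable_AE:
  fixes f g :: "'a::euclidean_space \<Rightarrow> 'b::euclidean_space"
  assumes S: "S \<in> sets lebesgue" and f: "f \<in> borel_measurable (lebesgue_on S)" and eq: "AE x in lebesgue_on S. f x = g x"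
  shows "g \<in> borel_measurable (lebesgue_on S)"
proof -
  have "(\<lambda>x. if x \<in> S then f x else 0) \<in> borel_measurable lebesgue" using borel_measurable_if_I[OF f S] .
  moreover have "AE x in lebesgue. (if x \<in> S then f x else 0) = (if x \<in> S then g x else 0)"
    using eq S by (subst (asm) AE_restrict_space_iff) auto
  ultimately have "(\<lambda>x. if x \<in> S then g x else 0) \<in> borel_measurable lebesgue" by (rule borel_measurable_AE)
  then show ?thesis using S borel_measurable_if_D by blast
qed

text \<open>
  By completeness of the measure either both functions are measurable or neither is, and in the latter
  case both integrals have the default value 0.
\<close>

lemma lebesgue_on_integral_cong_AE:
  fixes f g :: "'a::euclidean_space \<Rightarrow> 'b::euclidean_space"
  assumes S: "S \<in> sets lebesgue" and eq: "AE x in lebesgue_on S. f x = g x"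
  shows "(LINT x|lebesgue_on S. f x) = (LINT x|lebesgue_on S. g x)"
proof (cases "f \<in> borel_measurable (lebesgue_on S)")
  case True
  with lebesgue_on_measurable_AE[OF S True eq] eq show ?thesis by (intro integral_cong_AE) auto
next
  case False
  have eq': "AE x in lebesgue_on S. g x = f x" using eq by eventually_elim simp
  have "g \<notin> borel_measurable (lebesgue_on S)" using lebesgue_on_measurable_AE[OF S _ eq'] False by blast
  with False have "\<not> integrable (lebesgue_on S) f" "\<not> integrable (lebesgue_on S) g" by auto
  then show ?thesis by (simp add: not_integrable_integral_eq)
qed

lemma torus_cong_AE:
  fixes f g :: "R3 \<Rightarrow> 'b::euclidean_space"
  assumes "AE x in torus. f x = g x"
  shows "(LINT x|torus. f x) = (LINT x|torus. g x)"
  unfolding torus_def by (rule lebesgue_on_integral_cong_AE[OF _ assms[unfolded torus_def]]) auto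

text \<open>
  The infimum that defines the seminorm is itself an admissible constant.
\<close>

lemma besov_increment:
  assumes "w \<in> besov \<beta> p"
  shows "Lp_norm p (\<lambda>x. w (x + h) - w x) \<le> besov_norm \<beta> p w * norm h powr \<beta>"
proof (cases "h = 0")
  case True then show ?thesis by (simp add: Lp_norm_def)
next
  case False
  let ?L = "Lp_norm p (\<lambda>x. w (x + h) - w x)"
  have h: "0 < norm h powr \<beta>" using False by simp
  have "?L / norm h powr \<beta> \<le> besov_seminorm \<beta> p w"
    unfolding besov_seminorm_def
  proof (rule cInf_greatest)
    show "{c. besov_bound \<beta> p w c} \<noteq> {}" using assms by (auto simp: besov_def)
    fix c assume "c \<in> {c. besov_bound \<beta> p w c}"
    then have "?L \<le> c * norm h powr \<beta>" by (simp add: besov_bound_def)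
    then show "?L / norm h powr \<beta> \<le> c" using h by (simp add: pos_divide_le_eq)
  qed
  also have "\<dots> \<le> besov_norm \<beta> p w" by (simp add: besov_norm_def Lp_norm_def)
  finally show ?thesis using h by (simp add: pos_divide_le_eq)
qed

lemma besov_norm_nonneg: "w \<in> besov \<beta> p \<Longrightarrow> 0 \<le> besov_norm \<beta> p w"
proof -
  assume w: "w \<in> besov \<beta> p"
  have "0 \<le> besov_seminorm \<beta> p w"
    unfolding besov_seminorm_def
    by (rule cInf_greatest) (use w in \<open>auto simp: besov_def besov_bound_def\<close>)
  then show ?thesis by (simp add: besov_norm_def Lp_norm_def)
qed

lemma powr_add_le:
  fixes a b p :: real assumes "0 \<le> a" "0 \<le> b" "0 < p"
  shows "(a + b) powr p \<le> 2 powr p * (a powr p + b powr p)"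
proof -
  have "(a + b) powr p \<le> (2 * max a b) powr p" using assms by (intro powr_mono2) auto
  also have "\<dots> = 2 powr p * max a b powr p" using assms by (simp add: powr_mult)
  also have "max a b powr p \<le> a powr p + b powr p" by (auto simp: max_def)
  finally show ?thesis by (simp add: mult_left_mono)
qed

lemma increment_powr_integrable:
  fixes g :: "R3 \<Rightarrow> R3"
  assumes [measurable]: "g \<in> borel_measurable borel" and per: "torus_periodic g" and p: "0 < p"
    and int: "integrable torus (\<lambda>x. norm (g x) powr p)"
  shows "integrable torus (\<lambda>x. norm (g (x + h) - g x) powr p)"
proof -
  have per': "torus_periodic (\<lambda>x. norm (g x) powr p)" using per by (simp add: torus_periodic_def)
  have int2: "integrable torus (\<lambda>x. norm (g (x + h)) powr p)"
    using torus_integral_shift(2)[OF _ per', of h] int by simp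
  show ?thesis
  proof (rule Bochner_Integration.integrable_bound[OF integrable_mult_right[OF Bochner_Integration.integrable_add[OF int2 int], of "2 powr p"]])
    show "(\<lambda>x. norm (g (x + h) - g x) powr p) \<in> borel_measurable torus" by (rule torus_measurable) measurable
    have "norm (g (x + h) - g x) powr p \<le> 2 powr p * (norm (g (x + h)) powr p + norm (g x) powr p)" for x
    proof -
      have "norm (g (x + h) - g x) powr p \<le> (norm (g (x + h)) + norm (g x)) powr p"
        using p by (intro powr_mono2 norm_triangle_ineq4) auto
      also have "\<dots> \<le> 2 powr p * (norm (g (x + h)) powr p + norm (g x) powr p)"
        using p by (intro powr_add_le) auto
      finally show ?thesis .
    qed
    then show "AE x in torus. norm (norm (g (x + h) - g x) powr p) \<le> norm (2 powr p * (norm (g (x + h)) powr p + norm (g x) powr p))"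
      by simp
  qed
qed

lemma AE_torus_increment:
  assumes "AE x in torus. w x = g x" "torus_periodic w" "torus_periodic g"
  shows "AE x in torus. w (x + h) - w x = g (x + h) - (g x :: R3)"
proof -
  have 1: "AE x in lborel. w x = g x"
    by (rule AE_torus_periodic[OF assms(1)]) (use assms(2,3) in \<open>simp add: torus_periodic_def\<close>)
  then have "AE x in lborel. w (x + h) = g (x + h)" by (rule AE_lborel_translate)
  with 1 have "AE x in lborel. w (x + h) - w x = g (x + h) - g x" by eventually_elim simp
  then show ?thesis by (rule AE_lborel_imp_torus)
qed

lemma besov_increment_borel:
  fixes g :: "R3 \<Rightarrow> R3"
  assumes w: "w \<in> besov \<beta> p" and p: "0 < p" and g: "g \<in> borel_measurable borel" "torus_periodic g" "AE x in torus. w x = g x"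
  shows "integrable torus (\<lambda>x. norm (g x) powr p)"
    and "integrable torus (\<lambda>x. norm (g (x + h) - g x) powr p)"
    and "(LINT x|torus. norm (g (x + h) - g x) powr p) \<le> (besov_norm \<beta> p w * norm h powr \<beta>) powr p"
proof -
  have wp: "torus_periodic w" "w \<in> borel_measurable torus" "integrable torus (\<lambda>x. norm (w x) powr p)"
    using w by (auto simp: besov_def Lp_torus_def)
  have gm: "g \<in> borel_measurable torus" using g(1) by (rule torus_measurable)
  show gi: "integrable torus (\<lambda>x. norm (g x) powr p)"
  proof -
    have "AE x in torus. norm (w x) powr p = norm (g x) powr p" using g(3) by eventually_elim simp
    then have "integrable torus (\<lambda>x. norm (w x) powr p) \<longleftrightarrow> integrable torus (\<lambda>x. norm (g x) powr p)"
      using wp(2) gm by (intro integrable_cong_AE) auto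
    then show ?thesis using wp(3) by simp
  qed
  show "integrable torus (\<lambda>x. norm (g (x + h) - g x) powr p)"
    by (rule increment_powr_integrable[OF g(1,2) p gi])
  let ?X = "LINT x|torus. norm (g (x + h) - g x) powr p"
  have X0: "0 \<le> ?X" by (rule Bochner_Integration.integral_nonneg) simp
  have "?X = (LINT x|torus. norm (w (x + h) - w x) powr p)"
    by (rule torus_cong_AE) (use AE_torus_increment[OF g(3) wp(1) g(2), of h] in eventually_elim, simp)
  then have "?X powr (1 / p) \<le> besov_norm \<beta> p w * norm h powr \<beta>"
    using besov_increment[OF w, of h] by (simp add: Lp_norm_def)
  then have "(?X powr (1 / p)) powr p \<le> (besov_norm \<beta> p w * norm h powr \<beta>) powr p"
    using p by (intro powr_mono2) auto
  moreover have "(?X powr (1 / p)) powr p = ?X" using p X0 by (simp add: powr_powr)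
  ultimately show "?X \<le> (besov_norm \<beta> p w * norm h powr \<beta>) powr p" by simp
qed

text \<open>
  For every threshold \<open>l > 0\<close>, \<open>r ^ 3 \<le> l * r\<^sup>2 + l powr (3 - p) * r powr p\<close>: the first term dominates for
  \<open>r \<le> l\<close>, the second one for \<open>r > l\<close>.  The choice \<open>l = Y powr (p / (p - 2))\<close> balances the two integrals.
\<close>

lemma cube_interpolation:
  fixes d :: "R3 \<Rightarrow> R3"
  assumes d: "d \<in> borel_measurable torus" and p: "3 < p"
    and i2: "integrable torus (\<lambda>x. (norm (d x))\<^sup>2)" and ip: "integrable torus (\<lambda>x. norm (d x) powr p)"
    and A: "(LINT x|torus. (norm (d x))\<^sup>2) \<le> A" and Y: "(LINT x|torus. norm (d x) powr p) \<le> Y powr p" "0 \<le> Y"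
  shows "integrable torus (\<lambda>x. norm (d x) ^ 3)" and "(LINT x|torus. norm (d x) ^ 3) \<le> (A + 1) * Y powr (p / (p - 2))"
proof -
  have pw: "r ^ 3 \<le> l * r\<^sup>2 + l powr (3 - p) * r powr p" if "0 \<le> r" "0 < l" for r l :: real
  proof (cases "r \<le> l")
    case True
    have "r ^ 3 = r * r\<^sup>2" by (simp add: power3_eq_cube power2_eq_square)
    also have "\<dots> \<le> l * r\<^sup>2" using True by (intro mult_right_mono) auto
    finally show ?thesis by (simp add: add_increasing2)
  next
    case False
    then have r: "0 < r" using that by simp
    have "l powr (p - 3) \<le> r powr (p - 3)" using False that p by (intro powr_mono2) auto
    then have "l powr (3 - p) * (l powr (p - 3) * r powr 3) \<le> l powr (3 - p) * (r powr (p - 3) * r powr 3)"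
      by (intro mult_left_mono mult_right_mono) auto
    moreover have "l powr (3 - p) * (l powr (p - 3) * r powr 3) = r ^ 3"
      using that r by (simp flip: powr_add mult.assoc)
    moreover have "r powr (p - 3) * r powr 3 = r powr p" by (simp flip: powr_add)
    ultimately have "r ^ 3 \<le> l powr (3 - p) * r powr p" by simp
    then show ?thesis using that by (simp add: add_increasing)
  qed
  have i: "integrable torus (\<lambda>x. l * (norm (d x))\<^sup>2 + l powr (3 - p) * norm (d x) powr p)" for l
    using i2 ip by simp
  show i3: "integrable torus (\<lambda>x. norm (d x) ^ 3)"
    by (rule Bochner_Integration.integrable_bound[OF i[of 1]])
       (use d order_trans[OF pw[of "norm (d _)" 1] abs_ge_self] in auto)
  have A0: "0 \<le> A" using order_trans[OF _ A, of 0] by (auto intro: Bochner_Integration.integral_nonneg)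
  have le: "(LINT x|torus. norm (d x) ^ 3) \<le> l * A + l powr (3 - p) * Y powr p" if l: "0 < l" for l
  proof -
    have "(LINT x|torus. norm (d x) ^ 3) \<le> (LINT x|torus. l * (norm (d x))\<^sup>2 + l powr (3 - p) * norm (d x) powr p)"
      using l by (intro integral_mono i3 i pw) auto
    also have "\<dots> = l * (LINT x|torus. (norm (d x))\<^sup>2) + l powr (3 - p) * (LINT x|torus. norm (d x) powr p)"
      using i2 ip by simp
    also have "\<dots> \<le> l * A + l powr (3 - p) * Y powr p"
      using l A Y by (intro add_mono mult_left_mono) auto
    finally show ?thesis .
  qed
  show "(LINT x|torus. norm (d x) ^ 3) \<le> (A + 1) * Y powr (p / (p - 2))"
  proof (cases "Y = 0")
    case True
    have "(LINT x|torus. norm (d x) ^ 3) \<le> 0"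
    proof (rule field_le_epsilon)
      fix e :: real assume e: "0 < e"
      have "(LINT x|torus. norm (d x) ^ 3) \<le> e / (A + 1) * A" using le[of "e / (A + 1)"] e A0 True by simp
      also have "\<dots> \<le> e" using e A0 by (simp add: field_simps)
      finally show "(LINT x|torus. norm (d x) ^ 3) \<le> 0 + e" by simp
    qed
    then show ?thesis using True by simp
  next
    case False
    then have Y0: "0 < Y" using Y by simp
    define l where "l = Y powr (p / (p - 2))"
    have "l powr (3 - p) * Y powr p = Y powr (p / (p - 2) * (3 - p) + p)" by (simp add: l_def powr_powr powr_add)
    also have "p / (p - 2) * (3 - p) + p = p / (p - 2)" using p by (simp add: field_simps)
    finally have "l powr (3 - p) * Y powr p = l" by (simp add: l_def)
    then show ?thesis using le[of l] Y0 by (simp add: l_def algebra_simps)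
  qed
qed

lemma H_field_zero: "H_field (\<lambda>x. 0)"
  unfolding H_field_def
proof (intro conjI allI impI)
  show "L2_field (\<lambda>x. 0)" by (rule L2_field_const)
  show "\<exists>\<psi>. smooth \<psi> \<and> torus_periodic \<psi> \<and> div_free \<psi> \<and> (LINT x|torus. (norm ((0::R3) - \<psi> x))\<^sup>2) < \<epsilon>" if "0 < \<epsilon>" for \<epsilon>
    using that by (intro exI[of _ "\<lambda>x. 0"]) (auto simp: smooth_def C_k_const torus_periodic_def div_free_def partial_def)
qed

text \<open>
  A Borel representative on the product of the time interval and the cube is extended periodically; the
  sections of the exceptional null set are null for almost every time.
\<close>

lemma ex_borel_spacetime:
  fixes v :: "real \<Rightarrow> R3 \<Rightarrow> R3"
  assumes "(\<lambda>(t, x). v t x) \<in> borel_measurable (lebesgue_on ({0<..<T} \<times> period_cube))"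
  obtains u where "(\<lambda>p. u (fst p) (snd p)) \<in> borel_measurable borel" "\<And>t. torus_periodic (u t)"
    "AE t in lborel. t \<in> {0<..<T} \<longrightarrow> (AE x in torus. v t x = u t x)"
proof -
  let ?S = "{0<..<T} \<times> period_cube"
  have Sb: "?S \<in> sets borel" by (intro borel_Times) auto
  then have S: "?S \<in> sets lebesgue" by auto
  let ?f = "\<lambda>p. if p \<in> ?S then v (fst p) (snd p) else 0"
  have m: "?f \<in> borel_measurable lebesgue"
    using borel_measurable_if_I[OF assms S] unfolding case_prod_beta' .
  have "\<exists>g. g \<in> borel_measurable lborel \<and> (AE p in lborel. ?f p $ i = g p)" for i
  proof -
    have "(\<lambda>y::R3. y $ i) \<in> borel_measurable borel" by simp
    from completion_ex_borel_measurable_real[OF measurable_compose[OF m this]]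
    show ?thesis by blast
  qed
  then have "\<forall>i. \<exists>g. g \<in> borel_measurable lborel \<and> (AE p in lborel. ?f p $ i = g p)" ..
  from choice[OF this] obtain g where g: "\<And>i. g i \<in> borel_measurable lborel" "\<And>i. AE p in lborel. ?f p $ i = g i p" by blast
  define u where "u t x = (\<chi> i. g i (t, wrap x))" for t x
  have "AE p in lborel. \<forall>i. ?f p $ i = g i p" using g(2) by (simp add: AE_all_countable)
  then have "AE p in lborel \<Otimes>\<^sub>M lborel. \<forall>i. ?f p $ i = g i p" unfolding lborel_prod .
  then have "AE t in lborel. AE x in lborel. \<forall>i. ?f (t, x) $ i = g i (t, x)"
    by (rule lborel_pair.AE_pair)
  then have "AE t in lborel. t \<in> {0<..<T} \<longrightarrow> (AE x in torus. v t x = u t x)"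
  proof eventually_elim
    case (elim t)
    show ?case
    proof
      assume t: "t \<in> {0<..<T}"
      show "AE x in torus. v t x = u t x"
        unfolding AE_torus_iff using elim AE_period_cube_iff
      proof eventually_elim
        case (elim x)
        show ?case
        proof
          assume x: "x \<in> period_cube"
          then have wr: "wrap x = x" using elim(2) by (simp add: wrap_fundamental)
          show "v t x = u t x" unfolding u_def wr using elim(1) t x by (simp add: vec_eq_iff)
        qed
      qed
    qed
  qed
  moreover have "(\<lambda>p. u (fst p) (snd p)) \<in> borel_measurable borel"
  proof (rule borel_measurable_vec_R3)
    fix i
    have [measurable]: "g i \<in> borel_measurable borel" using g(1)[of i] by simp
    show "(\<lambda>p. u (fst p) (snd p) $ i) \<in> borel_measurable borel" unfolding u_def by simp
  qed
  moreover have "torus_periodic (u t)" for t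
    unfolding u_def by (rule torus_periodic_comp_wrap)
  ultimately show ?thesis using that by blast
qed

text \<open>
  With \<open>p = 2 / (1 - \<alpha>)\<close> the interpolation exponent \<open>p / (p - 2)\<close> is \<open>1 / \<alpha>\<close>, the exponent of
  integrability in time.  The condition \<open>1 / 3 < \<alpha>\<close> is \<open>p > 3\<close>.  Lowering the exponent of \<open>norm z\<close> from
  \<open>\<beta> / \<alpha>\<close> to \<open>\<gamma>\<close> costs a constant for bounded \<open>z\<close>; larger \<open>z\<close> are first shortened by a period.
\<close>

lemma besov_cubic_increment:
  fixes g :: "R3 \<Rightarrow> R3"
  assumes \<alpha>: "1 / 3 < \<alpha>" "\<alpha> < 1" "\<alpha> < \<beta>" "\<beta> < 1"
    and w: "w \<in> besov \<beta> (2 / (1 - \<alpha>))" and g: "L2_field g" "AE x in torus. w x = g x"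
    and M: "(LINT x|torus. (norm (g x))\<^sup>2) \<le> M"
  defines "\<gamma> \<equiv> min (\<beta> / \<alpha>) 2"
  shows "L3_field g" and "integrable torus (\<lambda>y. norm (g (z + y) - g y) ^ 3)"
    and "(LINT y|torus. norm (g (z + y) - g y) ^ 3)
      \<le> (4 * M + 1) * 7 powr (\<beta> / \<alpha> - \<gamma>) * besov_norm \<beta> (2 / (1 - \<alpha>)) w powr (1 / \<alpha>) * norm z powr \<gamma>"
proof -
  define p where "p = 2 / (1 - \<alpha>)"
  define N where "N = besov_norm \<beta> p w"
  have p: "3 < p" using \<alpha> by (simp add: p_def field_simps)
  have pq: "p / (p - 2) = 1 / \<alpha>"
  proof -
    have e: "p - 2 = 2 * \<alpha> / (1 - \<alpha>)" using \<alpha> by (simp add: p_def field_simps)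
    have "p / (p - 2) = (2 / (1 - \<alpha>)) / (2 * \<alpha> / (1 - \<alpha>))" unfolding e by (simp only: p_def)
    also have "\<dots> = 1 / \<alpha>"
    proof -
      have cancel: "(2 / c) / (2 * \<alpha> / c) = 1 / \<alpha>" if "c \<noteq> 0" for c using that \<alpha> by (simp add: field_simps)
      show ?thesis by (rule cancel) (use \<alpha> in simp)
    qed
    finally show ?thesis .
  qed
  have w': "w \<in> besov \<beta> p" using w by (simp add: p_def)
  have N: "0 \<le> N" unfolding N_def by (rule besov_norm_nonneg[OF w'])
  have gb: "g \<in> borel_measurable borel" "torus_periodic g" and i2: "integrable torus (\<lambda>x. (norm (g x))\<^sup>2)"
    using g(1) by (auto simp: L2_field_def)
  note B = besov_increment_borel[OF w' _ gb g(2)]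
  have gm: "g \<in> borel_measurable torus" using gb(1) by (rule torus_measurable)
  show "L3_field g"
  proof -
    let ?I = "LINT x|torus. norm (g x) powr p"
    have "0 \<le> ?I" by (rule Bochner_Integration.integral_nonneg) simp
    then have "?I \<le> (?I powr (1 / p)) powr p" using p by (simp add: powr_powr)
    from cube_interpolation(1)[OF gm p i2 B(1) M this] p g(1) show ?thesis by (simp add: L3_field_def)
  qed
  have M0: "0 \<le> M" using order_trans[OF _ M, of 0] by (auto intro: Bochner_Integration.integral_nonneg)
  have cubic: "integrable torus (\<lambda>y. norm (g (z + y) - g y) ^ 3) \<and>
     (LINT y|torus. norm (g (z + y) - g y) ^ 3) \<le> (4 * M + 1) * (N * norm z powr \<beta>) powr (1 / \<alpha>)" for z
  proof -
    have [measurable]: "g \<in> borel_measurable borel" by (rule gb)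
    let ?d = "\<lambda>y. g (z + y) - g y"
    have dm: "?d \<in> borel_measurable torus" by (rule torus_measurable) measurable
    have per2: "torus_periodic (\<lambda>x. (norm (g x))\<^sup>2)" using gb(2) by (simp add: torus_periodic_def)
    have shift: "(LINT y|torus. (norm (g (y + z)))\<^sup>2) = (LINT y|torus. (norm (g y))\<^sup>2)"
      "integrable torus (\<lambda>y. (norm (g (y + z)))\<^sup>2)"
      using torus_integral_shift[OF _ per2, of z] i2 by auto
    have ib: "integrable torus (\<lambda>y. 2 * (norm (g (y + z)))\<^sup>2 + 2 * (norm (g y))\<^sup>2)" using shift i2 by simp
    have id: "integrable torus (\<lambda>y. (norm (?d y))\<^sup>2)"
      by (rule Bochner_Integration.integrable_bound[OF ib])
         (use dm norm_diff_square_le[of "g (_ + z)" "g _"] in \<open>auto simp: add.commute\<close>)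
    have "(LINT y|torus. (norm (?d y))\<^sup>2) \<le> (LINT y|torus. 2 * (norm (g (y + z)))\<^sup>2 + 2 * (norm (g y))\<^sup>2)"
      using norm_diff_square_le[of "g (_ + z)" "g _"] by (intro integral_mono id ib) (simp add: add.commute)
    also have "\<dots> \<le> 4 * M" using shift i2 M by simp
    finally have d2: "(LINT y|torus. (norm (?d y))\<^sup>2) \<le> 4 * M" .
    have ip: "integrable torus (\<lambda>y. norm (?d y) powr p)" using B(2)[of z] p by (simp add: add.commute)
    have dp: "(LINT y|torus. norm (?d y) powr p) \<le> (N * norm z powr \<beta>) powr p"
      using B(3)[of z] p by (simp add: add.commute N_def)
    have Y: "0 \<le> N * norm z powr \<beta>" using N by simp
    show ?thesis
      using cube_interpolation[OF dm p id ip d2 dp Y] by (simp add: pq)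
  qed
  then show "integrable torus (\<lambda>y. norm (g (z + y) - g y) ^ 3)" by blast
  have small: "(LINT y|torus. norm (g (z + y) - g y) ^ 3) \<le> (4 * M + 1) * 7 powr (\<beta> / \<alpha> - \<gamma>) * N powr (1 / \<alpha>) * norm z powr \<gamma>"
    if z: "norm z \<le> 7" for z
  proof -
    have "(N * norm z powr \<beta>) powr (1 / \<alpha>) = N powr (1 / \<alpha>) * norm z powr (\<beta> / \<alpha>)"
      using N by (simp add: powr_mult powr_powr)
    also have "norm z powr (\<beta> / \<alpha>) = norm z powr (\<beta> / \<alpha> - \<gamma>) * norm z powr \<gamma>"
      by (simp flip: powr_add)
    also have "N powr (1 / \<alpha>) * \<dots> \<le> N powr (1 / \<alpha>) * (7 powr (\<beta> / \<alpha> - \<gamma>) * norm z powr \<gamma>)"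
      using z by (intro mult_left_mono mult_right_mono powr_mono2) (auto simp: \<gamma>_def)
    finally have "(N * norm z powr \<beta>) powr (1 / \<alpha>) \<le> N powr (1 / \<alpha>) * (7 powr (\<beta> / \<alpha> - \<gamma>) * norm z powr \<gamma>)" .
    then have "(4 * M + 1) * (N * norm z powr \<beta>) powr (1 / \<alpha>) \<le> (4 * M + 1) * (N powr (1 / \<alpha>) * (7 powr (\<beta> / \<alpha> - \<gamma>) * norm z powr \<gamma>))"
      using M0 by (intro mult_left_mono) auto
    with cubic[of z] show ?thesis by (simp add: mult_ac)
  qed
  have "(LINT y|torus. norm (g (z + y) - g y) ^ 3) \<le> (4 * M + 1) * 7 powr (\<beta> / \<alpha> - \<gamma>) * N powr (1 / \<alpha>) * norm z powr \<gamma>"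
  proof (cases "norm z \<le> 7")
    case False
    obtain m where m: "(norm (z + period_vector m))\<^sup>2 \<le> 8 * cos_gap z" using norm_shift_le_cos_gap by blast
    have "cos_gap z \<le> (\<Sum>i\<in>(UNIV :: 3 set). 2)"
      unfolding cos_gap_def
    proof (rule sum_mono)
      show "1 - cos (z $ i) \<le> 2" for i using cos_ge_minus_one[of "z $ i"] by linarith
    qed
    then have "(norm (z + period_vector m))\<^sup>2 \<le> 7\<^sup>2" using m by simp
    then have m7: "norm (z + period_vector m) \<le> 7" by (rule power2_le_imp_le) simp
    have "g (z + period_vector m + y) = g (z + y)" for y
      using torus_periodic_shift[OF gb(2), of "z + y" m] by (simp add: algebra_simps)
    then have "(LINT y|torus. norm (g (z + y) - g y) ^ 3) \<le> (4 * M + 1) * 7 powr (\<beta> / \<alpha> - \<gamma>) * N powr (1 / \<alpha>) * norm (z + period_vector m) powr \<gamma>"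
      using small[OF m7] by simp
    also have "\<dots> \<le> (4 * M + 1) * 7 powr (\<beta> / \<alpha> - \<gamma>) * N powr (1 / \<alpha>) * norm z powr \<gamma>"
      using False m7 M0 \<alpha> by (intro mult_left_mono powr_mono2) (auto simp: \<gamma>_def)
    finally show ?thesis .
  qed (rule small)
  then show "(LINT y|torus. norm (g (z + y) - g y) ^ 3)
      \<le> (4 * M + 1) * 7 powr (\<beta> / \<alpha> - \<gamma>) * besov_norm \<beta> (2 / (1 - \<alpha>)) w powr (1 / \<alpha>) * norm z powr \<gamma>"
    by (simp add: N_def p_def)
qed

text \<open>
  A set of full measure meets every nonempty open interval.
\<close>

lemma AE_interval_dense:
  assumes AE: "AE t in lebesgue_on {0<..<T}. t \<in> D" and t: "t \<in> {0..T}" and T: "0 < T" and \<delta>: "0 < \<delta>"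
  shows "\<exists>s\<in>D. \<bar>s - t\<bar> < (\<delta> :: real)"
proof (rule ccontr)
  assume no: "\<not> (\<exists>s\<in>D. \<bar>s - t\<bar> < \<delta>)"
  let ?a = "max 0 (t - \<delta>)" and ?b = "min T (t + \<delta>)"
  have ab: "?a < ?b" using t T \<delta> by auto
  have "AE s in lebesgue. s \<in> {0<..<T} \<longrightarrow> s \<in> D" using AE by (subst (asm) AE_restrict_space_iff) auto
  then have "AE s in lebesgue. s \<notin> {?a<..<?b}"
  proof eventually_elim
    case (elim s)
    show ?case
    proof
      assume s: "s \<in> {?a<..<?b}"
      then have "s \<in> D" "\<bar>s - t\<bar> < \<delta>" using elim by auto
      with no show False by blast
    qed
  qed
  then have "negligible {?a<..<?b}"
    by (simp add: negligible_iff_null_sets AE_iff_null_sets)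
  then show False using ab open_not_negligible[of "{?a<..<?b}"] by auto
qed

section \<open>Conservation of energy\<close>

theorem theorem1:
  fixes T \<alpha> \<beta> :: real and v0 :: "R3 \<Rightarrow> R3" and v :: "real \<Rightarrow> R3 \<Rightarrow> R3"
  assumes "T > 0"
    and "v0 \<in> H_space"
    and "weak_euler_solution T v0 v"
    and "1 / 3 < \<alpha>" and "\<alpha> < 1"
    and "\<alpha> < \<beta>" and "\<beta> < 1"
    and "in_Lq_time (1 / \<alpha>) T (besov \<beta> (2 / (1 - \<alpha>))) (besov_norm \<beta> (2 / (1 - \<alpha>))) v"
  shows "conserves_energy T v0 v"
proof -
  let ?p = "2 / (1 - \<alpha>)"
  define \<gamma> where "\<gamma> = min (\<beta> / \<alpha>) 2"
  have \<gamma>: "1 < \<gamma>" "\<gamma> \<le> 2" using assms by (auto simp: \<gamma>_def)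
  note weak = assms(3)[unfolded weak_euler_solution_def in_Linf_time_def]
  obtain C where C: "AE t in lebesgue_on {0<..<T}. Lp_norm 2 (v t) \<le> C" using weak by blast
  have vm: "(\<lambda>(t, x). v t x) \<in> borel_measurable (lebesgue_on ({0<..<T} \<times> period_cube))" using weak by blast
  obtain u' where u': "(\<lambda>p. u' (fst p) (snd p)) \<in> borel_measurable borel" "\<And>t. torus_periodic (u' t)"
    "AE t in lborel. t \<in> {0<..<T} \<longrightarrow> (AE x in torus. v t x = u' t x)" using ex_borel_spacetime[OF vm] by blast
  define ok where "ok t \<longleftrightarrow> v t \<in> H_space \<and> Lp_norm 2 (v t) \<le> C \<and> v t \<in> besov \<beta> ?p \<and> (AE x in torus. v t x = u' t x)" for t
  have lb: "AE t in lborel. t \<in> {0<..<T} \<longrightarrow> P t" if "AE t in lebesgue_on {0<..<T}. P t" for P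
    using that by (subst (asm) AE_restrict_space_iff) (auto simp: AE_completion_iff)
  have "AE t in lborel. t \<in> {0<..<T} \<longrightarrow> ok t"
  proof -
    have "AE t in lebesgue_on {0<..<T}. v t \<in> H_space" using weak by blast
    from lb[OF this] have 1: "AE t in lborel. t \<in> {0<..<T} \<longrightarrow> v t \<in> H_space" .
    have "AE t in lebesgue_on {0<..<T}. v t \<in> besov \<beta> ?p" using assms(8) by (simp add: in_Lq_time_def)
    from lb[OF this] have 2: "AE t in lborel. t \<in> {0<..<T} \<longrightarrow> v t \<in> besov \<beta> ?p" .
    from 1 2 lb[OF C] u'(3) show ?thesis by eventually_elim (simp add: ok_def)
  qed
  then obtain N where N: "{t \<in> space lborel. \<not> (t \<in> {0<..<T} \<longrightarrow> ok t)} \<subseteq> N" "emeasure lborel N = 0" "N \<in> sets lborel"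
    by (rule AE_E)
  \<comment> \<open>removing a Borel null set keeps the solution Borel measurable\<close>
  define A where "A = {0<..<T} - N"
  have A: "A \<in> sets borel" using N(3) by (auto simp: A_def)
  have Aok: "ok t" if "t \<in> A" for t using that N(1) by (auto simp: A_def)
  have AE_A: "AE t in lebesgue_on {0<..<T}. t \<in> A"
  proof -
    have "AE t in lborel. t \<notin> N" using N by (intro AE_not_in) auto
    then have "AE t in lebesgue. t \<notin> N" by (rule AE_completion)
    then show ?thesis by (subst AE_restrict_space_iff) (auto simp: A_def elim: eventually_mono)
  qed
  define u where "u t x = (if t \<in> A then u' t x else 0)" for t x
  have slice: "u' t \<in> borel_measurable borel" for t
    using measurable_compose[OF _ u'(1), of "\<lambda>x. (t, x)" borel] by (simp add: borel_measurable_Pair)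
  have u'H: "H_field (u' t)" if "t \<in> A" for t
    using Aok[OF that] by (intro H_space_imp_H_field[OF _ slice u'(2)]) (auto simp: ok_def)
  define M where "M = C\<^sup>2"
  have u'M: "(LINT x|torus. (norm (u' t x))\<^sup>2) \<le> M" if "t \<in> A" for t
  proof -
    have "(LINT x|torus. (norm (u' t x))\<^sup>2) = (LINT x|torus. (norm (v t x))\<^sup>2)"
      by (rule torus_cong_AE) (use Aok[OF that] in \<open>auto simp: ok_def elim: eventually_mono\<close>)
    moreover have "sqrt (LINT x|torus. (norm (v t x))\<^sup>2) \<le> C" using Aok[OF that] by (simp add: ok_def Lp_norm_2)
    ultimately show ?thesis by (simp add: M_def sqrt_le_D)
  qed
  have u'L2: "L2_field (u' t)" if "t \<in> A" for t using u'H[OF that] by (simp add: H_field_def)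
  note cubic = besov_cubic_increment[OF assms(4-7) _ u'L2 _ u'M, folded \<gamma>_def]
  have Av: "v t \<in> besov \<beta> ?p" "AE x in torus. v t x = u' t x" if "t \<in> A" for t using Aok[OF that] by (auto simp: ok_def)
  define K where "K = (4 * M + 1) * 7 powr (\<beta> / \<alpha> - \<gamma>)"
  have K: "0 \<le> K" by (simp add: K_def M_def)
  define G where "G t = indicator A t *\<^sub>R (K * besov_norm \<beta> ?p (v t) powr (1 / \<alpha>))" for t
  have v0: "v0 \<in> borel_measurable torus" "torus_periodic v0" using assms(2) by (auto simp: H_space_def Lp_torus_def)
  obtain u0 where u0: "u0 \<in> borel_measurable borel" "torus_periodic u0" "AE x in torus. v0 x = u0 x"
    using ex_borel_periodic[OF v0] by blast
  interpret onsager T \<gamma> M u u0 G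
  proof
    show "0 < T" "1 < \<gamma>" "\<gamma> \<le> 2" by (fact assms(1) \<gamma>)+
    have [measurable]: "(\<lambda>p. u' (fst p) (snd p)) \<in> borel_measurable borel" "A \<in> sets borel" by (fact u'(1) A)+
    have "(\<lambda>p. indicator A (fst p) *\<^sub>R u' (fst p) (snd p)) \<in> borel_measurable (borel :: (real \<times> R3) measure)"
      by measurable
    moreover have "(\<lambda>p. indicator A (fst p) *\<^sub>R u' (fst p) (snd p)) = (\<lambda>p. u (fst p) (snd p))"
      by (auto simp: u_def indicator_def)
    ultimately show "(\<lambda>p. u (fst p) (snd p)) \<in> borel_measurable borel" by simp
    show "H_field u0" by (rule H_space_imp_H_field[OF assms(2) u0])
    show "H_field (u t)" for t
      using u'H H_field_zero by (cases "t \<in> A") (simp_all add: u_def[abs_def])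
    show "L3_field (u t)" for t
    proof (cases "t \<in> A")
      case True
      then show ?thesis using cubic(1)[OF Av(1)[OF True] True Av(2)[OF True] True] by (simp add: u_def[abs_def])
    next
      case False
      then show ?thesis using L2_field_const[of 0] by (simp add: u_def[abs_def] L3_field_def)
    qed
    show "(LINT x|torus. (norm (u t x))\<^sup>2) \<le> M" for t
      using u'M by (cases "t \<in> A") (simp_all add: u_def M_def)
    show "0 \<le> G t" for t using K by (simp add: G_def)
    show "integrable (lebesgue_on {0<..<T}) G"
      unfolding G_def
    proof (rule integrable_mult_indicator)
      show "A \<in> sets (lebesgue_on {0<..<T})" using A by (auto simp: sets_restrict_space_iff A_def)
      show "integrable (lebesgue_on {0<..<T}) (\<lambda>t. K * besov_norm \<beta> ?p (v t) powr (1 / \<alpha>))"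
        using assms(8) by (simp add: in_Lq_time_def)
    qed
    show "integrable torus (\<lambda>y. norm (u t (z + y) - u t y) ^ 3)" for t z
    proof (cases "t \<in> A")
      case True
      then show ?thesis using cubic(2)[OF Av(1)[OF True] True Av(2)[OF True] True] by (simp add: u_def)
    next
      case False
      then show ?thesis by (simp add: u_def)
    qed
    show "(LINT y|torus. norm (u t (z + y) - u t y) ^ 3) \<le> G t * norm z powr \<gamma>" for t z
    proof (cases "t \<in> A")
      case True
      then show ?thesis using cubic(3)[OF Av(1)[OF True] True Av(2)[OF True] True] by (simp add: u_def G_def K_def)
    next
      case False
      then show ?thesis by (simp add: u_def G_def)
    qed
    fix \<phi> assume \<phi>: "test_field T \<phi>"
    let ?F = "\<lambda>w t x. w t x \<bullet> vector_derivative (\<lambda>s. \<phi> s x) (at t) +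
           (\<Sum>i\<in>UNIV. \<Sum>j\<in>UNIV. w t x $ i * w t x $ j * partial j (\<phi> t) x $ i)"
    have "(LINT t|lebesgue_on {0<..<T}. LINT x|torus. ?F u t x) = (LINT t|lebesgue_on {0<..<T}. LINT x|torus. ?F v t x)"
    proof (rule lebesgue_on_integral_cong_AE)
      show "AE t in lebesgue_on {0<..<T}. (LINT x|torus. ?F u t x) = (LINT x|torus. ?F v t x)"
        using AE_A
      proof eventually_elim
        case (elim t)
        then have "AE x in torus. v t x = u' t x" using Aok by (simp add: ok_def)
        then show ?case
          by (intro torus_cong_AE, eventually_elim) (use elim in \<open>simp add: u_def\<close>)
      qed
    qed auto
    also have "\<dots> = - (LINT x|torus. v0 x \<bullet> \<phi> 0 x)" using weak \<phi> by blast
    also have "(LINT x|torus. v0 x \<bullet> \<phi> 0 x) = (LINT x|torus. u0 x \<bullet> \<phi> 0 x)"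
      by (rule torus_cong_AE) (use u0(3) in eventually_elim, simp)
    finally show "(LINT t|lebesgue_on {0<..<T}. LINT x|torus. ?F u t x) = - (LINT x|torus. u0 x \<bullet> \<phi> 0 x)" .
  qed
  have dense: "\<exists>s\<in>insert 0 good. \<bar>s - t\<bar> < \<delta>" if "t \<in> {0..T}" "0 < \<delta>" for t \<delta>
    using AE_interval_dense[OF AE_good that(1) assms(1) that(2)] by blast
  obtain W where W: "\<And>t. t \<in> insert 0 good \<Longrightarrow> W t = curve t" "\<And>t. t \<in> {0..T} \<Longrightarrow> L2_field (W t)"
    "\<And>t \<epsilon>. t \<in> {0..T} \<Longrightarrow> 0 < \<epsilon> \<Longrightarrow> \<exists>s\<in>insert 0 good. \<bar>s - t\<bar> < \<epsilon> \<and> (LINT x|torus. (norm (W t x - curve s x))\<^sup>2) < \<epsilon>"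
    "\<And>\<epsilon>. 0 < \<epsilon> \<Longrightarrow> \<exists>\<delta>>0. \<forall>s\<in>{0..T}. \<forall>t\<in>{0..T}. \<bar>t - s\<bar> < \<delta> \<longrightarrow> (LINT x|torus. (norm (W t x - W s x))\<^sup>2) < \<epsilon>"
    using L2_uniform_extension[OF curve_L2 curve_uniformly_continuous dense] by blast
  show ?thesis
    unfolding conserves_energy_def weakly_continuous_representative_def
  proof (intro exI[of _ W] conjI ballI)
    show "weakly_continuous_L2 T W" by (rule strongly_continuous_imp_weakly_continuous[OF W(2,4)])
    show "AE t in lebesgue_on {0<..<T}. AE x in torus. W t x = v t x"
      using AE_good AE_A
    proof eventually_elim
      case (elim t)
      have "AE x in torus. v t x = u' t x" using Aok[OF elim(2)] by (simp add: ok_def)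
      then show ?case
        using W(1)[of t] curve_good[OF elim(1)] elim by (auto simp: u_def elim: eventually_mono)
    qed
    have W0: "W 0 = u0" using W(1)[of 0] by (simp add: curve_def)
    show "AE x in torus. W 0 x = v0 x" unfolding W0 using u0(3) by eventually_elim simp
    fix t assume t: "t \<in> {0..T}"
    have "(LINT x|torus. (norm (W t x))\<^sup>2) = (LINT x|torus. (norm (u0 x))\<^sup>2)"
    proof (rule L2_norm_limit[OF W(2)[OF t]])
      fix \<epsilon> :: real assume "0 < \<epsilon>"
      from W(3)[OF t this] obtain s where s: "s \<in> insert 0 good" "(LINT x|torus. (norm (W t x - curve s x))\<^sup>2) < \<epsilon>" by blast
      show "\<exists>g. L2_field g \<and> (LINT x|torus. (norm (g x))\<^sup>2) = (LINT x|torus. (norm (u0 x))\<^sup>2) \<and> (LINT x|torus. (norm (W t x - g x))\<^sup>2) < \<epsilon>"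
        using curve_L2 energy_constant[OF s(1)] s(2) by blast
    qed
    also have "\<dots> = (LINT x|torus. (norm (v0 x))\<^sup>2)"
      by (rule torus_cong_AE) (use u0(3) in eventually_elim, simp)
    finally show "1 / 2 * (Lp_norm 2 (W t))\<^sup>2 = 1 / 2 * (Lp_norm 2 v0)\<^sup>2" by (simp add: Lp_norm_2)
  qed
qed

end
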